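(* Let $m=(m_\alpha)_{\alpha\in\mathbb{N}_0^d}$ be a multi-sequence of real numbers which fulfills the classical multivariate Carleman condition: for every $i\in\{1,\dots,d\}$ the class $C\{\sqrt{|m_{2n\,e_i}|}\}$ is quasi-analytic, where $2n\,e_i=(0,\dots,0,2n,0,\dots,0)\in\mathbb{N}_0^d$ has the entry $2n$ at the $i$-th position. Let $$\mathcal{S}=\bigcap_{i\in Y}\{\mathbf{r}\in\mathbb{R}^d\mid P_i(\mathbf{r})\ge0\},$$ where $Y$ is an index set, not necessarily countable, and each $P_i$ is a polynomial on $\mathbb{R}^d$ with real coefficients. Then $m$ is realized by a unique non-negative measure $\mu\in\mathcal{M}^*(\mathcal{S})$ if and only if $$L_m(h^2)\ge0,\qquad L_m(P_ih^2)\ge0\qquad\text{for all polynomials } h\in\mathscr{P}_{\mathbb{R}}(\mathbb{R}^d)\text{ and all } i\in Y.$$ Equivalently, if and only if the functional $L_m$ is non-negative on the quadratic module $\mathcal{Q}(\mathscr{P}_{\mathcal{S}})$.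
   Context: $\mathscr{P}_{\mathbb{R}}(\mathbb{R}^d)$ is the set of polynomials on $\mathbb{R}^d$ with real coefficients. $L_m:\mathscr{P}_{\mathbb{R}}(\mathbb{R}^d)\to\mathbb{R}$ is the Riesz functional, i.e. the linear functional with $L_m(\mathbf{r}^\alpha)=m_\alpha$ for all $\alpha\in\mathbb{N}_0^d$. $\mathcal{M}^*(\mathcal{S})$ is the set of finite non-negative Borel measures $\mu$ on $\mathbb{R}^d$ with finite moments of all orders that are concentrated on $\mathcal{S}$, i.e. $\mu(\mathbb{R}^d\setminus\mathcal{S})=0$; $m$ is realized by $\mu$ if $m_\alpha=\int\mathbf{r}^\alpha\mu(d\mathbf{r})$ for all $\alpha\in\mathbb{N}_0^d$. $\mathscr{P}_{\mathcal{S}}=\{P_i: i\in Y\}$ is the given family of polynomials, with the convention (not affecting $\mathcal{S}$) that $0\in Y$ and $P_0$ is the constant polynomial $1$. The quadratic module $\mathcal{Q}(\mathscr{P}_{\mathcal{S}})$ is the set of all finite sums $\sum_{i\in Y_0}Q_iP_i$, where $Y_0\subset Y$ is finite and each $Q_i$ is a sum of squares of polynomials in $\mathscr{P}_{\mathbb{R}}(\mathbb{R}^d)$. For a sequence $(M_n)_{n\in\mathbb{N}_0}$ of non-negative reals, $C\{M_n\}$ is the set of $f\in\mathcal{C}^\infty(\mathbb{R})$ for which there are constants $\beta_f,B_f>0$ with $\sup_{x\in\mathbb{R}}|D^nf(x)|\le\beta_fB_f^nM_n$ for all $n\in\mathbb{N}_0$. The class is quasi-analytic if every $f\in C\{M_n\}$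 with $D^nf(0)=0$ for all $n\in\mathbb{N}_0$ vanishes identically. *)

theory Defs
  imports "HOL-Analysis.Analysis" "HOL-Library.Poly_Mapping"
begin

text \<open>
  Real polynomials in \<open>d = CARD('n)\<close> variables are represented as finitely supported maps from
  multi-indices to coefficients; the ring structure is the convolution product of
  \<^theory>\<open>HOL-Library.Poly_Mapping\<close>.
\<close>

type_synonym 'n multi_index = "'n \<Rightarrow>\<^sub>0 nat"
type_synonym 'n rpoly = "('n \<Rightarrow>\<^sub>0 nat) \<Rightarrow>\<^sub>0 real"

definition monomial :: "'n::finite multi_index \<Rightarrow> real ^ 'n \<Rightarrow> real"
  where "monomial \<alpha> r = (\<Prod>i\<in>UNIV. (r $ i) ^ Poly_Mapping.lookup \<alpha> i)"

definition eval_poly :: "'n::finite rpoly \<Rightarrow> real ^ 'n \<Rightarrow> real"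
  where "eval_poly p r = (\<Sum>\<alpha>\<in>Poly_Mapping.keys p. Poly_Mapping.lookup p \<alpha> * monomial \<alpha> r)"

definition riesz :: "('n::finite multi_index \<Rightarrow> real) \<Rightarrow> 'n rpoly \<Rightarrow> real"
  where "riesz m p = (\<Sum>\<alpha>\<in>Poly_Mapping.keys p. Poly_Mapping.lookup p \<alpha> * m \<alpha>)"


definition smooth_fun :: "(real \<Rightarrow> real) \<Rightarrow> bool"
  where "smooth_fun f \<longleftrightarrow> (\<forall>n. (deriv ^^ n) f differentiable_on UNIV)"

text \<open>
  The bound on \<open>sup\<^sub>x |D\<^sup>n f(x)|\<close> is stated pointwise: the real-valued supremum of an unbounded
  set is unspecified, so the bound must also express that the supremum is finite.
\<close>

definition ultra_class :: "(nat \<Rightarrow> real) \<Rightarrow> (real \<Rightarrow> real) set"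
  where "ultra_class M = {f. smooth_fun f \<and>
    (\<exists>\<beta>>0. \<exists>B>0. \<forall>n x. \<bar>(deriv ^^ n) f x\<bar> \<le> \<beta> * B ^ n * M n)}"

definition quasi_analytic :: "(real \<Rightarrow> real) set \<Rightarrow> bool"
  where "quasi_analytic C \<longleftrightarrow>
    (\<forall>f\<in>C. (\<forall>n. (deriv ^^ n) f 0 = 0) \<longrightarrow> (\<forall>x. f x = 0))"

definition carleman :: "('n::finite multi_index \<Rightarrow> real) \<Rightarrow> bool"
  where "carleman m \<longleftrightarrow> (\<forall>i.
    quasi_analytic (ultra_class (\<lambda>n. sqrt \<bar>m (Poly_Mapping.single i (2 * n))\<bar>)))"


definition semialg :: "'i set \<Rightarrow> ('i \<Rightarrow> 'n::finite rpoly) \<Rightarrow> (real ^ 'n) set"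
  where "semialg Y P = (\<Inter>i\<in>Y. {r. eval_poly (P i) r \<ge> 0})"

text \<open>
  Membership in \<open>null_sets\<close>, unlike \<open>emeasure \<mu> (- S) = 0\<close>, does not hold vacuously when \<open>S\<close> is
  not a Borel set.
\<close>

definition moment_measures :: "(real ^ 'n::finite) set \<Rightarrow> (real ^ 'n) measure set"
  where "moment_measures S = {\<mu>. sets \<mu> = sets borel \<and> finite_measure \<mu> \<and>
    (\<forall>\<alpha>. integrable \<mu> (monomial \<alpha>)) \<and> - S \<in> null_sets \<mu>}"

definition realized_by ::
  "('n::finite multi_index \<Rightarrow> real) \<Rightarrow> (real ^ 'n) measure \<Rightarrow> bool"
  where "realized_by m \<mu> \<longleftrightarrow> (\<forall>\<alpha>. m \<alpha> = (\<integral>r. monomial \<alpha> r \<partial>\<mu>))"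


definition sums_of_squares :: "'n::finite rpoly set"
  where "sums_of_squares = {\<Sum>j<k. (h j)\<^sup>2 | (h :: nat \<Rightarrow> 'n rpoly) k. True}"

text \<open>
  The quadratic module is generated by a set \<open>G\<close> of polynomials rather than by an indexed family.
  Nothing is lost, since terms with the same generator can be merged. The convention that the
  constant polynomial \<open>1\<close> belongs to the generating family is built in here, so that \<open>Y\<close> itself
  may be an arbitrary index set.
\<close>

definition quadratic_module :: "'n::finite rpoly set \<Rightarrow> 'n rpoly set"
  where "quadratic_module G = {\<Sum>p\<in>F. Q p * p | F Q.
    finite F \<and> F \<subseteq> insert 1 G \<and> (\<forall>p\<in>F. Q p \<in> sums_of_squares)}"

end

theory Submission
  imports
    Defs
    "HOL-Probability.Probability"
    "HOL-Computational_Algebra.Fundamental_Theorem_Algebra"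
    "HOL-Real_Asymp.Real_Asymp"
begin

text \<open>
  For a tame form \<open>\<Lambda>\<close> and a weight \<open>w\<close> with \<open>\<Lambda> (w * h\<^sup>2) \<ge> 0\<close> for all \<open>h\<close>, Hamburger's theorem
  represents \<open>k \<mapsto> \<Lambda> (x\<^sub>i^k * w)\<close> by a measure on the line. Quasi-analyticity makes this measure
  unique, even among signed combinations of measures: the Fourier transform of the difference of
  two solutions, divided by \<open>x - \<i>\<close>, satisfies the bounds of the class and has the Taylor
  coefficients of \<open>c * exp (- t)\<close> at \<open>0\<close>, hence equals it on a half line. Uniqueness turns the
  measures into a restriction \<open>\<Lambda> \<mapsto> cutoff i B \<Lambda>\<close> to \<open>{x. x $ i \<in> B}\<close> that is linear in the
  polynomial and preserves every inequality \<open>\<Lambda> (w * h\<^sup>2) \<ge> 0\<close>, in particular those for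
  \<open>w = P i\<close>. Cutting off in all coordinates assigns a mass to every box; Kolmogorov's extension
  theorem for the events \<open>x $ i \<le> q\<close> with rational \<open>q\<close> turns these masses into the measure, whose
  moments are read off on small boxes. Boxes on which some \<open>P i\<close> is negative have mass zero, and
  every representing measure has to give the same masses to boxes.
\<close>

section \<open>Sums of squares of univariate polynomials\<close>

text \<open>Nonnegative polynomials in several variables need not be sums of squares, so the
  hypothesis does not make \<open>L\<close> positive on all of them, and extension of positive
  functionals is applied in one variable only. The sequence of the class at order \<open>n\<close>
  is the square root of the moment of order \<open>2 * n\<close>. Cauchy-Schwarz bounds
  \<open>L (x\<^sub>i^(2 k) * h\<^sup>2)\<close>, for each fixed \<open>h\<close>, by a multiple of
  the term at order \<open>2 * k\<close>; this is precisely a derivative bound of even order for the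
  transforms of all slices. At odd orders, interpolation yields only the geometric mean of the two
  neighbouring terms, and log-convexity puts this above the term that is wanted. Division by
  \<open>x - \<i>\<close> saves one power, so that the even order just below suffices. The price is
  that the Taylor coefficients of the quotient are known only up to solutions of
  \<open>y' + y = 0\<close>: this is the origin of \<open>c * exp (- t)\<close>.\<close>

lemma sum_two_squares_mult:
  fixes a b c d :: "'a::comm_ring_1"
  shows "(a^2 + b^2) * (c^2 + d^2) = (a*c - b*d)^2 + (a*d + b*c)^2"
  by (simp add: power2_eq_square algebra_simps)

lemma map_poly_of_real_add:
  "map_poly of_real (p + q) = (map_poly of_real p + map_poly of_real q :: complex poly)"
  by (intro poly_eqI) (simp add: coeff_map_poly)

lemma map_poly_of_real_mult:
  "map_poly of_real (p * q) = (map_poly of_real p * map_poly of_real q :: complex poly)"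
  by (intro poly_eqI) (simp add: coeff_map_poly coeff_mult)

lemma poly_map_poly_of_real:
  "poly (map_poly of_real p) (of_real x :: complex) = of_real (poly p x)"
  by (induction p) (simp_all add: map_poly_pCons)

lemma poly_nonneg_by_continuity:
  fixes p :: "real poly"
  assumes "\<And>x. x \<noteq> a \<Longrightarrow> poly p x \<ge> 0"
  shows "poly p a \<ge> 0"
proof -
  have "(poly p \<longlongrightarrow> poly p a) (at a)"
    using isCont_def by (metis poly_isCont)
  moreover have "\<forall>\<^sub>F x in at a. 0 \<le> poly p x"
    using assms by (auto simp: eventually_at intro!: exI[of _ 1])
  ultimately show ?thesis
    by (rule tendsto_lowerbound) auto
qed

text \<open>A root given by the fundamental theorem of algebra splits off a real quadratic factor
  that is a square or a sum of two squares; the product identity for sums of two squares then closes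
  the induction on the degree.\<close>

theorem nonneg_poly_sum_two_squares:
  fixes p :: "real poly"
  assumes "\<And>x. poly p x \<ge> 0"
  shows "\<exists>q r. p = q^2 + r^2"
  using assms
proof (induction "degree p" arbitrary: p rule: less_induct)
  case (less p)
  show ?case
  proof (cases "degree p = 0")
    case True
    then obtain c where c: "p = [:c:]" by (rule degree_eq_zeroE)
    with less.prems[of 0] have "c \<ge> 0" by simp
    then have "p = [:sqrt c:]^2 + 0^2" by (simp add: c power2_eq_square)
    then show ?thesis by blast
  next
    case False
    then have p0: "p \<noteq> 0" by auto
    have "\<not> constant (poly (map_poly of_real p :: complex poly))"
      using False by (simp add: constant_degree degree_map_poly)
    then obtain z where z: "poly (map_poly of_real p) (z::complex) = 0"
      using fundamental_theorem_of_algebra by blast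
    show ?thesis
    proof (cases "Im z = 0")
      case True
      define a where "a = Re z"
      have za: "z = of_real a" using True by (simp add: a_def complex_eq_iff)
      have "poly p a = 0"
        using z by (simp add: za poly_map_poly_of_real)
      then obtain p1 where p1: "p = [:-a, 1:] * p1"
        by (metis dvd_def poly_eq_0_iff_dvd)
      \<comment> \<open>A real root is at least double: division by \<open>x - a\<close> leaves a
        quotient with opposite signs on the two sides of \<open>a\<close>, hence with value zero
        there.\<close>
      have pos: "poly p1 x \<ge> 0" if "x > a" for x
        using less.prems[of x] that by (auto simp: p1 zero_le_mult_iff simp del: poly_pCons mult_pCons_left) (auto simp: mult_le_cancel_right algebra_simps)
      have neg: "poly p1 x \<le> 0" if "x < a" for x
        using less.prems[of x] that by (auto simp: p1 zero_le_mult_iff simp del: poly_pCons mult_pCons_left) (auto simp: mult_le_cancel_right algebra_simps)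
      have lim: "(poly p1 \<longlongrightarrow> poly p1 a) (at a)"
        using isCont_def by (metis poly_isCont)
      have "poly p1 a \<ge> 0"
      proof (rule tendsto_lowerbound)
        show "(poly p1 \<longlongrightarrow> poly p1 a) (at_right a)"
          using lim by (simp add: filterlim_at_split)
        show "\<forall>\<^sub>F x in at_right a. 0 \<le> poly p1 x"
          using pos by (auto simp: eventually_at_filter)
      qed auto
      moreover have "poly p1 a \<le> 0"
      proof (rule tendsto_upperbound)
        show "(poly p1 \<longlongrightarrow> poly p1 a) (at_left a)"
          using lim by (simp add: filterlim_at_split)
        show "\<forall>\<^sub>F x in at_left a. poly p1 x \<le> 0"
          using neg by (auto simp: eventually_at_filter)
      qed auto
      ultimately have "poly p1 a = 0" by simp
      then obtain p2 where p2: "p1 = [:-a, 1:] * p2"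
        by (metis dvd_def poly_eq_0_iff_dvd)
      have pp: "p = [:-a, 1:]^2 * p2"
        by (simp only: p1 p2 power2_eq_square mult.assoc)
      have p20: "p2 \<noteq> 0" using p0 pp by auto
      have "poly p2 x \<ge> 0" if "x \<noteq> a" for x
        using less.prems[of x] that by (simp add: pp zero_le_mult_iff)
      then have p2nn: "poly p2 x \<ge> 0" for x
        using poly_nonneg_by_continuity[of a p2] by (cases "x = a") auto
      have "degree p = degree ([:-a, 1:]^2) + degree p2"
        unfolding pp using p20 by (intro degree_mult_eq) auto
      then have "degree p2 < degree p" by (simp add: degree_power_eq)
      from less.hyps[OF this p2nn] obtain q r where "p2 = q^2 + r^2" by blast
      then have "p = ([:-a, 1:] * q)^2 + ([:-a, 1:] * r)^2"
        unfolding pp by (simp only: power_mult_distrib distrib_left)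
      then show ?thesis by blast
    next
      case False
      define t where "t = [:-Re z, 1:]^2 + [:Im z:]^2"
      have t_expl: "t = [:(Re z)\<^sup>2 + (Im z)\<^sup>2, -2 * Re z, 1:]"
        by (simp add: t_def power2_eq_square)
      have degt: "degree t = 2" "t \<noteq> 0" by (simp_all add: t_expl)
      have tz: "poly (map_poly of_real t) z = 0"
        by (simp add: t_expl map_poly_pCons complex_eq_iff power2_eq_square algebra_simps)
      \<comment> \<open>The conjugate root never has to be split off: a real remainder of degree at
        most one that vanishes at a non-real point is zero.\<close>
      define r where "r = p mod t"
      have pdiv: "p = t * (p div t) + r" by (simp add: r_def)
      have "degree r < 2" using degree_mod_less[of t p] degt by (auto simp: r_def)
      then have r_expl: "r = [:coeff r 0, coeff r 1:]"
        by (intro poly_eqI) (auto simp: coeff_pCons coeff_eq_0 split: nat.splits)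
      have "poly (map_poly of_real p) z = poly (map_poly of_real r) z"
        by (subst pdiv) (simp add: map_poly_of_real_add map_poly_of_real_mult tz)
      then have "poly (map_poly of_real [:coeff r 0, coeff r 1:]) z = 0"
        using z r_expl by simp
      then have "coeff r 1 = 0 \<and> coeff r 0 = 0"
        using False by (auto simp: map_poly_pCons complex_eq_iff)
      then have "r = 0" using r_expl by simp
      with pdiv have pp: "p = t * (p div t)" by simp
      define u where "u = p div t"
      have pu: "p = t * u" using pp by (simp add: u_def)
      have tpos: "poly t x > 0" for x
        using False by (simp add: t_def sum_power2_gt_zero_iff)
      have unn: "poly u x \<ge> 0" for x
        using less.prems[of x] tpos[of x] by (simp add: pu zero_le_mult_iff)
      have "u \<noteq> 0" using p0 pu by auto
      then have "degree p = 2 + degree u"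
        using degt by (simp add: pu degree_mult_eq)
      then have "degree u < degree p" by simp
      from less.hyps[OF this unn] obtain q r where "u = q^2 + r^2" by blast
      then have "p = ([:-Re z, 1:] * q - [:Im z:] * r)^2 + ([:-Re z, 1:] * r + [:Im z:] * q)^2"
        unfolding pu t_def by (simp only: sum_two_squares_mult)
      then show ?thesis by blast
    qed
  qed
qed

section \<open>Hamburger moment problem\<close>

definition moment_functional :: "(nat \<Rightarrow> real) \<Rightarrow> real poly \<Rightarrow> real"
  where "moment_functional s p = (\<Sum>k\<le>degree p. coeff p k * s k)"

lemma moment_functional_eq:
  assumes "degree p \<le> n"
  shows "moment_functional s p = (\<Sum>k\<le>n. coeff p k * s k)"
  unfolding moment_functional_def
  by (rule sum.mono_neutral_left) (use assms in \<open>auto simp: coeff_eq_0\<close>)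

lemma moment_functional_add:
  "moment_functional s (p + q) = moment_functional s p + moment_functional s q"
proof -
  define n where "n = max (degree p) (degree q)"
  have "degree (p + q) \<le> n" "degree p \<le> n" "degree q \<le> n"
    by (auto simp: n_def degree_add_le_max)
  then show ?thesis
    by (simp add: moment_functional_eq[of _ n] sum.distrib algebra_simps)
qed

lemma moment_functional_smult:
  "moment_functional s (smult c p) = c * moment_functional s p"
  by (simp add: moment_functional_eq[OF degree_smult_le] moment_functional_def sum_distrib_left mult.assoc)

lemma moment_functional_monom:
  "moment_functional s (monom c k) = c * s k"
proof -
  have "moment_functional s (monom c k) = (\<Sum>j\<le>k. coeff (monom c k) j * s j)"
    by (intro moment_functional_eq degree_monom_le)
  also have "\<dots> = (\<Sum>j\<in>{k}. coeff (monom c k) j * s j)"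
    by (rule sum.mono_neutral_right) auto
  finally show ?thesis by simp
qed

definition psd_sequence :: "(nat \<Rightarrow> real) \<Rightarrow> bool"
  where "psd_sequence s \<longleftrightarrow> (\<forall>p. moment_functional s (p\<^sup>2) \<ge> 0)"

lemma moment_functional_nonneg:
  assumes "psd_sequence s" "\<And>x. poly p x \<ge> 0"
  shows "moment_functional s p \<ge> 0"
proof -
  obtain q r where "p = q^2 + r^2"
    using nonneg_poly_sum_two_squares assms(2) by blast
  then show ?thesis
    using assms(1) by (simp add: moment_functional_add psd_sequence_def)
qed

text \<open>The domain of the extended functional. Polynomials lie above and below each such
  function, which keeps the one-step extension finite, and indicators of half lines belong to
  it.\<close>

definition poly_bounded :: "(real \<Rightarrow> real) \<Rightarrow> bool"
  where "poly_bounded f \<longleftrightarrow> (\<exists>p. \<forall>x. \<bar>f x\<bar> \<le> poly p x)"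

text \<open>A positive linear functional on a space of functions, encoded by its graph so that
  extension is inclusion and chains have unions. The graph is single-valued by positivity on
  \<open>f - f\<close>.\<close>

definition positive_graph :: "(nat \<Rightarrow> real) \<Rightarrow> ((real \<Rightarrow> real) \<times> real) set \<Rightarrow> bool"
  where "positive_graph s W \<longleftrightarrow>
    (\<forall>p. (poly p, moment_functional s p) \<in> W) \<and>
    (\<forall>f v g w. (f, v) \<in> W \<longrightarrow> (g, w) \<in> W \<longrightarrow> ((\<lambda>x. f x + g x), v + w) \<in> W) \<and>
    (\<forall>f v c. (f, v) \<in> W \<longrightarrow> ((\<lambda>x. c * f x), c * v) \<in> W) \<and>
    (\<forall>f v. (f, v) \<in> W \<longrightarrow> (\<forall>x. f x \<ge> 0) \<longrightarrow> v \<ge> 0)"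

lemma positive_graph_poly: "positive_graph s W \<Longrightarrow> (poly p, moment_functional s p) \<in> W"
  and positive_graph_add: "positive_graph s W \<Longrightarrow> (f, v) \<in> W \<Longrightarrow> (g, w) \<in> W \<Longrightarrow> ((\<lambda>x. f x + g x), v + w) \<in> W"
  and positive_graph_scale: "positive_graph s W \<Longrightarrow> (f, v) \<in> W \<Longrightarrow> ((\<lambda>x. c * f x), c * v) \<in> W"
  and positive_graph_pos: "positive_graph s W \<Longrightarrow> (f, v) \<in> W \<Longrightarrow> (\<And>x. f x \<ge> 0) \<Longrightarrow> v \<ge> 0"
  by (auto simp: positive_graph_def)

lemma positive_graph_mono:
  assumes "positive_graph s W" "(f, v) \<in> W" "(g, w) \<in> W" "\<And>x. f x \<le> g x"
  shows "v \<le> w"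
proof -
  have "((\<lambda>x. g x + (-1) * f x), w + (-1) * v) \<in> W"
    by (intro positive_graph_add[OF assms(1)] positive_graph_scale[OF assms(1)] assms)
  from positive_graph_pos[OF assms(1) this] assms(4) show ?thesis by simp
qed

text \<open>One step of M. Riesz' extension of positive functionals.\<close>

lemma positive_graph_extend:
  assumes W: "positive_graph s W" and g: "poly_bounded g"
  obtains W' d where "positive_graph s W'" "W \<subseteq> W'" "(g, d) \<in> W'"
proof -
  obtain p0 where p0: "\<And>x. \<bar>g x\<bar> \<le> poly p0 x"
    using g by (auto simp: poly_bounded_def)
  define Lo where "Lo = {v. \<exists>f. (f, v) \<in> W \<and> (\<forall>x. f x \<le> g x)}"
  have up: "v \<le> w" if "v \<in> Lo" "(f, w) \<in> W" "\<And>x. g x \<le> f x" for v w f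
  proof -
    from that(1) obtain f' where f': "(f', v) \<in> W" "\<And>x. f' x \<le> g x" by (auto simp: Lo_def)
    have "f' x \<le> f x" for x using f'(2)[of x] that(3)[of x] by linarith
    from positive_graph_mono[OF W f'(1) that(2) this] show ?thesis .
  qed
  have "(poly (smult (-1) p0), moment_functional s (smult (-1) p0)) \<in> W"
    by (rule positive_graph_poly[OF W])
  then have ne: "moment_functional s (smult (-1) p0) \<in> Lo"
    unfolding Lo_def using p0 by (auto simp: abs_le_iff minus_le_iff intro!: exI[of _ "poly (smult (-1) p0)"])
  have bdd: "bdd_above Lo"
    using up[OF _ positive_graph_poly[OF W, of p0]] p0 by (intro bdd_aboveI) (auto simp: abs_le_iff)
  define d where "d = Sup Lo"
  have lo_d: "v \<le> d" if "v \<in> Lo" for v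
    unfolding d_def by (rule cSup_upper[OF that bdd])
  have d_up: "d \<le> w" if "(f, w) \<in> W" "\<And>x. g x \<le> f x" for f w
    unfolding d_def by (rule cSup_least) (use ne up[OF _ that] in auto)
  define W' where "W' = {((\<lambda>x. f x + a * g x), v + a * d) | f v a. (f, v) \<in> W}"
  have sub: "W \<subseteq> W'"
  proof (rule subrelI)
    fix f v assume "(f, v) \<in> W"
    then show "(f, v) \<in> W'"
      unfolding W'_def by (intro CollectI exI[of _ f] exI[of _ v] exI[of _ 0]) auto
  qed
  have W'I: "((\<lambda>x. f x + a * g x), v + a * d) \<in> W'" if "(f, v) \<in> W" for f v a
    using that by (auto simp: W'_def)
  have "positive_graph s W'"
    unfolding positive_graph_def
  proof (intro conjI allI impI)
    fix p show "(poly p, moment_functional s p) \<in> W'"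
      using sub positive_graph_poly[OF W] by auto
  next
    fix f v h w assume "(f, v) \<in> W'" "(h, w) \<in> W'"
    then obtain f1 v1 a1 f2 v2 a2 where *: "(f1, v1) \<in> W" "(f2, v2) \<in> W"
      "f = (\<lambda>x. f1 x + a1 * g x)" "v = v1 + a1 * d" "h = (\<lambda>x. f2 x + a2 * g x)" "w = v2 + a2 * d"
      by (auto simp: W'_def)
    have "((\<lambda>x. (f1 x + f2 x) + (a1 + a2) * g x), (v1 + v2) + (a1 + a2) * d) \<in> W'"
      by (intro W'I positive_graph_add[OF W] *)
    then show "((\<lambda>x. f x + h x), v + w) \<in> W'"
      by (simp add: * algebra_simps)
  next
    fix f v c assume "(f, v) \<in> W'"
    then obtain f1 v1 a1 where *: "(f1, v1) \<in> W" 
      "f = (\<lambda>x. f1 x + a1 * g x)" "v = v1 + a1 * d"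
      by (auto simp: W'_def)
    have "((\<lambda>x. c * f1 x + (c * a1) * g x), c * v1 + (c * a1) * d) \<in> W'"
      by (intro W'I positive_graph_scale[OF W] *)
    then show "((\<lambda>x. c * f x), c * v) \<in> W'"
      by (simp add: * algebra_simps)
  next
    fix f v assume "(f, v) \<in> W'" and pos: "\<forall>x. 0 \<le> f x"
    then obtain f1 v1 a where *: "(f1, v1) \<in> W" 
      "f = (\<lambda>x. f1 x + a * g x)" "v = v1 + a * d"
      by (auto simp: W'_def)
    have sc: "((\<lambda>x. (- 1 / a) * f1 x), (- 1 / a) * v1) \<in> W"
      by (rule positive_graph_scale[OF W *(1)])
    consider "a = 0" | "a > 0" | "a < 0" by linarith
    then show "0 \<le> v"
    proof cases
      case 1
      then show ?thesis using positive_graph_pos[OF W *(1)] pos by (simp add: *)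
    next
      case 2
      have "(- 1 / a) * f1 x \<le> g x" for x
        using pos[rule_format, of x] 2 by (simp add: * field_simps)
      then have "(- 1 / a) * v1 \<in> Lo"
        using sc unfolding Lo_def by blast
      then have "(- 1 / a) * v1 \<le> d" by (rule lo_d)
      then show ?thesis using 2 by (simp add: * field_simps)
    next
      case 3
      have "g x \<le> (- 1 / a) * f1 x" for x
        using pos[rule_format, of x] 3 by (simp add: * field_simps)
      then have "d \<le> (- 1 / a) * v1" by (rule d_up[OF sc])
      then show ?thesis using 3 by (simp add: * field_simps)
    qed
  qed
  moreover have "(g, d) \<in> W'"
  proof -
    have "(poly 0, moment_functional s 0) \<in> W" by (rule positive_graph_poly[OF W])
    from W'I[OF this, of 1] show ?thesis by (simp add: moment_functional_def)
  qed
  ultimately show ?thesis using that sub by blast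
qed

text \<open>Zorn's lemma for graphs ordered by inclusion: two pairs from a chain lie in a common
  member, so unions stay graphs. A maximal graph is total because the one-step extension cannot
  enlarge it.\<close>

lemma positive_graph_total_exists:
  assumes "psd_sequence s"
  shows "\<exists>W. positive_graph s W \<and> (\<forall>g. poly_bounded g \<longrightarrow> (\<exists>v. (g, v) \<in> W))"
proof -
  have "\<exists>W\<in>{W. positive_graph s W}. \<forall>X\<in>{W. positive_graph s W}. W \<subseteq> X \<longrightarrow> X = W"
  proof (rule subset_Zorn_nonempty)
    let ?W = "{(poly p, moment_functional s p) | p. True}"
    have "positive_graph s ?W"
      unfolding positive_graph_def
    proof (intro conjI allI impI)
      fix f v g w assume "(f, v) \<in> ?W" "(g, w) \<in> ?W"
      then obtain p q where "f = poly p" "v = moment_functional s p" "g = poly q" "w = moment_functional s q"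
        by auto
      then show "((\<lambda>x. f x + g x), v + w) \<in> ?W"
        by (auto intro!: exI[of _ "p + q"] simp: moment_functional_add)
    next
      fix f v c assume "(f, v) \<in> ?W"
      then obtain p where "f = poly p" "v = moment_functional s p" by auto
      then show "((\<lambda>x. c * f x), c * v) \<in> ?W"
        by (auto intro!: exI[of _ "smult c p"] simp: moment_functional_smult)
    qed (use moment_functional_nonneg[OF assms] in auto)
    then show "{W. positive_graph s W} \<noteq> {}" by blast
  next
    fix C assume C: "C \<noteq> {}" "subset.chain {W. positive_graph s W} C"
    then have pg: "positive_graph s X" if "X \<in> C" for X
      using that by (auto simp: subset.chain_def)
    have "positive_graph s (\<Union>C)"
      unfolding positive_graph_def
    proof (intro conjI allI impI)
      fix p show "(poly p, moment_functional s p) \<in> \<Union>C"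
        using C(1) pg positive_graph_poly by blast
    next
      fix f v g w assume "(f, v) \<in> \<Union>C" "(g, w) \<in> \<Union>C"
      then obtain X Y where XY: "X \<in> C" "Y \<in> C" "(f, v) \<in> X" "(g, w) \<in> Y" by auto
      then have "X \<subseteq> Y \<or> Y \<subseteq> X" using C(2) by (auto simp: subset.chain_def)
      then obtain Z where "Z \<in> C" "(f, v) \<in> Z" "(g, w) \<in> Z" using XY by blast
      then show "((\<lambda>x. f x + g x), v + w) \<in> \<Union>C"
        using positive_graph_add pg by blast
    next
      fix f v c assume "(f, v) \<in> \<Union>C"
      then show "((\<lambda>x. c * f x), c * v) \<in> \<Union>C"
        using positive_graph_scale pg by blast
    next
      fix f v assume "(f, v) \<in> \<Union>C" "\<forall>x. 0 \<le> f x"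
      then show "0 \<le> v" using positive_graph_pos pg by blast
    qed
    then show "\<Union>C \<in> {W. positive_graph s W}" by simp
  qed
  then obtain W where W: "positive_graph s W" and max: "\<And>X. positive_graph s X \<Longrightarrow> W \<subseteq> X \<Longrightarrow> X = W"
    by auto
  have "\<exists>v. (g, v) \<in> W" if g: "poly_bounded g" for g
  proof -
    obtain W' d where "positive_graph s W'" "W \<subseteq> W'" "(g, d) \<in> W'"
      by (rule positive_graph_extend[OF W g])
    with max show ?thesis by blast
  qed
  with W show ?thesis by blast
qed

theorem positive_extension_exists:
  assumes "psd_sequence s"
  obtains \<Lambda> :: "(real \<Rightarrow> real) \<Rightarrow> real" where
    "\<And>p. \<Lambda> (poly p) = moment_functional s p"
    "\<And>f g. poly_bounded f \<Longrightarrow> poly_bounded g \<Longrightarrow> \<Lambda> (\<lambda>x. f x + g x) = \<Lambda> f + \<Lambda> g"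
    "\<And>f c. poly_bounded f \<Longrightarrow> \<Lambda> (\<lambda>x. c * f x) = c * \<Lambda> f"
    "\<And>f g. poly_bounded f \<Longrightarrow> poly_bounded g \<Longrightarrow> \<forall>x. f x \<le> g x \<Longrightarrow> \<Lambda> f \<le> \<Lambda> g"
proof -
  obtain W where W: "positive_graph s W" and tot: "\<And>g. poly_bounded g \<Longrightarrow> \<exists>v. (g, v) \<in> W"
    using positive_graph_total_exists[OF assms] by blast
  define \<Lambda> where "\<Lambda> f = (SOME v. (f, v) \<in> W)" for f
  have eq: "\<Lambda> f = v" if "(f, v) \<in> W" for f v
  proof -
    have "(f, \<Lambda> f) \<in> W" unfolding \<Lambda>_def using that by (rule someI)
    with that show ?thesis using positive_graph_mono[OF W] by (metis order_antisym order_refl)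
  qed
  have mem: "(f, \<Lambda> f) \<in> W" if "poly_bounded f" for f
    using tot[OF that] eq by auto
  show ?thesis
  proof (rule that[of \<Lambda>])
    show "\<Lambda> (poly p) = moment_functional s p" for p by (intro eq positive_graph_poly[OF W])
    show "\<Lambda> (\<lambda>x. f x + g x) = \<Lambda> f + \<Lambda> g" if "poly_bounded f" "poly_bounded g" for f g
      by (intro eq positive_graph_add[OF W] mem that)
    show "\<Lambda> (\<lambda>x. c * f x) = c * \<Lambda> f" if "poly_bounded f" for f c
      by (intro eq positive_graph_scale[OF W] mem that)
    show "\<Lambda> f \<le> \<Lambda> g" if "poly_bounded f" "poly_bounded g" "\<forall>x. f x \<le> g x" for f g
      by (rule positive_graph_mono[OF W mem mem]) (use that in auto)
  qed
qed

lemma poly_bounded_poly: "poly_bounded (poly p)"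
proof -
  have "\<bar>poly p x\<bar> \<le> poly (1 + p\<^sup>2) x" for x
  proof -
    have "0 \<le> (\<bar>poly p x\<bar> - 1)\<^sup>2" by simp
    then have "2 * \<bar>poly p x\<bar> \<le> 1 + (poly p x)\<^sup>2" by (simp add: power2_diff)
    then show ?thesis by simp
  qed
  then show ?thesis unfolding poly_bounded_def by blast
qed

lemma poly_bounded_add:
  assumes "poly_bounded f" "poly_bounded g" shows "poly_bounded (\<lambda>x. f x + g x)"
proof -
  obtain p q where "\<And>x. \<bar>f x\<bar> \<le> poly p x" "\<And>x. \<bar>g x\<bar> \<le> poly q x"
    using assms by (auto simp: poly_bounded_def)
  then have "\<bar>f x + g x\<bar> \<le> poly (p + q) x" for x
    by (simp add: abs_triangle_ineq[THEN order_trans] add_mono)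
  then show ?thesis unfolding poly_bounded_def by blast
qed

lemma poly_bounded_scale:
  assumes "poly_bounded f" shows "poly_bounded (\<lambda>x. c * f x)"
proof -
  obtain p where "\<And>x. \<bar>f x\<bar> \<le> poly p x"
    using assms by (auto simp: poly_bounded_def)
  then have "\<bar>c * f x\<bar> \<le> poly (smult \<bar>c\<bar> p) x" for x
    by (simp add: abs_mult mult_left_mono)
  then show ?thesis unfolding poly_bounded_def by blast
qed

lemma poly_bounded_indicator: "poly_bounded (indicator A)"
  unfolding poly_bounded_def by (intro exI[of _ 1]) (auto simp: indicator_def)

lemma poly_bounded_sum:
  assumes "\<And>j. poly_bounded (f j)" shows "poly_bounded (\<lambda>x. \<Sum>j<(n::nat). f j x)"
proof (induction n)
  case 0
  have "poly 0 = (\<lambda>x. 0 :: real)" by auto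
  then show ?case using poly_bounded_poly[of 0] by simp
next
  case (Suc n)
  then show ?case using poly_bounded_add[OF Suc assms[of n]] by simp
qed

section \<open>Approximation of powers by step functions\<close>

lemma power_lipschitz:
  fixes B :: real
  assumes "B \<ge> 0"
  shows "\<exists>K\<ge>0. \<forall>x y. \<bar>x\<bar> \<le> B \<longrightarrow> \<bar>y\<bar> \<le> B \<longrightarrow> \<bar>x ^ k - y ^ k\<bar> \<le> K * \<bar>x - y\<bar>"
proof (induction k)
  case 0
  show ?case by (auto intro: exI[of _ 0])
next
  case (Suc k)
  then obtain K where K: "K \<ge> 0" "\<And>x y. \<bar>x\<bar> \<le> B \<Longrightarrow> \<bar>y\<bar> \<le> B \<Longrightarrow> \<bar>x ^ k - y ^ k\<bar> \<le> K * \<bar>x - y\<bar>"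
    by blast
  have "\<bar>x ^ Suc k - y ^ Suc k\<bar> \<le> (B * K + B ^ k) * \<bar>x - y\<bar>" if xy: "\<bar>x\<bar> \<le> B" "\<bar>y\<bar> \<le> B" for x y
  proof -
    have "x ^ Suc k - y ^ Suc k = x * (x ^ k - y ^ k) + (x - y) * y ^ k"
      by (simp add: algebra_simps)
    then have "\<bar>x ^ Suc k - y ^ Suc k\<bar> \<le> \<bar>x\<bar> * \<bar>x ^ k - y ^ k\<bar> + \<bar>x - y\<bar> * \<bar>y\<bar> ^ k"
      by (simp add: abs_mult[symmetric] power_abs[symmetric])
    also have "\<dots> \<le> B * (K * \<bar>x - y\<bar>) + \<bar>x - y\<bar> * B ^ k"
      using xy K assms by (intro add_mono mult_mono power_mono) auto
    finally show ?thesis by (simp add: algebra_simps)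
  qed
  then show ?case using K(1) assms by (intro exI[of _ "B * K + B ^ k"]) auto
qed

definition grid :: "real \<Rightarrow> nat \<Rightarrow> nat \<Rightarrow> real"
  where "grid R N j = - R + real j * (2 * R / real N)"

text \<open>Only the jump points are moved by \<open>h\<close>, not the values. Positive shifts
  evaluate the functional on half lines ending just to the right of the grid points, so that letting
  \<open>h\<close> tend to \<open>0\<close> produces a right-continuous distribution function; the
  shift \<open>0\<close> is the function that is finally integrated.\<close>

definition step_power :: "nat \<Rightarrow> real \<Rightarrow> nat \<Rightarrow> real \<Rightarrow> real \<Rightarrow> real"
  where "step_power k R N h x = (\<Sum>j<N. grid R N j ^ k *
     (indicator {..grid R N (Suc j) + h} x + (-1) * indicator {..grid R N j + h} x))"

lemma grid_0 [simp]: "grid R N 0 = - R"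
  and grid_N: "N > 0 \<Longrightarrow> grid R N N = R"
  and grid_Suc: "grid R N (Suc j) = grid R N j + 2 * R / real N"
  by (simp_all add: grid_def algebra_simps add_divide_distrib)

lemma step_power_approx:
  assumes "R \<ge> 0" "N > 0" and h: "0 \<le> h" "h \<le> 2 * R / real N" "h \<le> 1" and K: "K \<ge> 0"
    "\<And>x y. \<bar>x\<bar> \<le> R + 1 \<Longrightarrow> \<bar>y\<bar> \<le> R + 1 \<Longrightarrow> \<bar>x ^ k - y ^ k\<bar> \<le> K * \<bar>x - y\<bar>"
  shows "\<bar>x ^ k * indicator {-R + h<..R + h} x - step_power k R N h x\<bar>
           \<le> 2 * K * (2 * R / real N) * indicator {-R + h<..R + h} x"
proof -
  define b where "b j = (indicator {..grid R N (Suc j) + h} x + (-1) * indicator {..grid R N j + h} x :: real)" for j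
  have sumb: "(\<Sum>j<N. b j) = indicator {-R + h<..R + h} x"
  proof -
    have "(\<Sum>j<N. b j) = indicator {..grid R N N + h} x - indicator {..grid R N 0 + h} x"
      using sum_lessThan_telescope[of "\<lambda>j. indicator {..grid R N j + h} x :: real" N] by (simp add: b_def)
    also have "\<dots> = indicator {-R + h<..R + h} x"
      using assms by (auto simp: grid_N indicator_def)
    finally show ?thesis .
  qed
  have step: "2 * R / real N \<ge> 0" using assms by simp
  have b01: "b j \<ge> 0" for j
    using step by (auto simp: b_def indicator_def grid_Suc)
  have grid_le: "\<bar>grid R N j\<bar> \<le> R" if "j < N" for j
  proof -
    have "real j * (2 * R / real N) \<le> real N * (2 * R / real N)"
      using that step by (intro mult_right_mono) auto
    moreover have "real j * (2 * R / real N) \<ge> 0" using step by (intro mult_nonneg_nonneg) auto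
    moreover have "real N * (2 * R / real N) = 2 * R" using assms(2) by simp
    ultimately show ?thesis unfolding grid_def by linarith
  qed
  have bj: "b j * \<bar>x ^ k - grid R N j ^ k\<bar> \<le> b j * (2 * K * (2 * R / real N))" if "j < N" for j
  proof (cases "b j = 0")
    case False
    then have x: "grid R N j + h < x" "x \<le> grid R N (Suc j) + h"
      using step by (auto simp: b_def indicator_def of_bool_def grid_Suc split: if_splits)
    have gS: "grid R N (Suc j) \<le> R"
    proof -
      have "real (Suc j) * (2 * R / real N) \<le> real N * (2 * R / real N)"
        using that step by (intro mult_right_mono) auto
      moreover have "real N * (2 * R / real N) = 2 * R" using assms(2) by simp
      ultimately show ?thesis unfolding grid_def by linarith
    qed
    have "\<bar>x\<bar> \<le> R + 1" using x grid_le[OF that] gS h by linarith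
    then have "\<bar>x ^ k - grid R N j ^ k\<bar> \<le> K * \<bar>x - grid R N j\<bar>"
      using grid_le[OF that] by (intro K) auto
    \<comment> \<open>The shifted cell containing \<open>x\<close> starts at distance
      \<open>h\<close> from its grid point, and \<open>h\<close> is at most one mesh width: two
      widths in total.\<close>
    also have "\<dots> \<le> K * (2 * (2 * R / real N))"
      using x h K(1) by (intro mult_left_mono) (auto simp: grid_Suc)
    also have "\<dots> = 2 * K * (2 * R / real N)" by (simp only: mult_ac)
    finally show ?thesis by (rule mult_left_mono) (rule b01)
  qed simp
  have "x ^ k * indicator {-R + h<..R + h} x - step_power k R N h x = (\<Sum>j<N. b j * (x ^ k - grid R N j ^ k))"
    unfolding sumb[symmetric] step_power_def b_def[symmetric]
    by (simp add: sum_distrib_left sum_subtractf algebra_simps)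
  also have "\<bar>\<dots>\<bar> \<le> (\<Sum>j<N. b j * \<bar>x ^ k - grid R N j ^ k\<bar>)"
    by (rule order_trans[OF sum_abs]) (simp add: abs_mult b01)
  also have "\<dots> \<le> (\<Sum>j<N. b j * (2 * K * (2 * R / real N)))"
    by (intro sum_mono bj) simp
  also have "\<dots> = 2 * K * (2 * R / real N) * indicator {-R + h<..R + h} x"
    unfolding sumb[symmetric] sum_distrib_left by (intro sum.cong) (simp_all only: mult_ac)
  finally show ?thesis .
qed

text \<open>Outside the window \<open>\<bar>x\<bar>\<close> is at least \<open>R - 1\<close>, so the
  power can be traded for \<open>x ^ (2 * k + 2) / (R - 1)\<close>. The exponent is even, hence the
  error bound is a polynomial, and the functional turns it into a moment divided by
  \<open>R - 1\<close>.\<close>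

lemma step_power_approx_global:
  assumes "R \<ge> 2" "N > 0" and h: "0 \<le> h" "h \<le> 2 * R / real N" "h \<le> 1" and K: "K \<ge> 0"
    "\<And>x y. \<bar>x\<bar> \<le> R + 1 \<Longrightarrow> \<bar>y\<bar> \<le> R + 1 \<Longrightarrow> \<bar>x ^ k - y ^ k\<bar> \<le> K * \<bar>x - y\<bar>"
  shows "\<bar>x ^ k - step_power k R N h x\<bar> \<le> 2 * K * (2 * R / real N) + x ^ (2 * k + 2) / (R - 1)"
proof -
  have near: "\<bar>x ^ k * indicator {-R + h<..R + h} x - step_power k R N h x\<bar>
           \<le> 2 * K * (2 * R / real N) * indicator {-R + h<..R + h} x"
    by (rule step_power_approx) (use assms in auto)
  have step: "2 * K * (2 * R / real N) \<ge> 0" using assms by simp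
  show ?thesis
  proof (cases "x \<in> {-R + h<..R + h}")
    case True
    have "x ^ (2 * k + 2) / (R - 1) \<ge> 0"
      using assms(1) by (intro divide_nonneg_nonneg zero_le_even_power) auto
    then show ?thesis using near True by simp
  next
    case False
    then have "\<bar>x\<bar> \<ge> R - 1" using h by auto
    then have x1: "\<bar>x\<bar> \<ge> 1" using assms(1) by linarith
    have "\<bar>x\<bar> ^ k * (R - 1) \<le> \<bar>x\<bar> ^ k * \<bar>x\<bar>"
      using \<open>\<bar>x\<bar> \<ge> R - 1\<close> by (intro mult_left_mono) auto
    also have "\<dots> = \<bar>x\<bar> ^ (k + 1)" by simp
    also have "\<dots> \<le> \<bar>x\<bar> ^ (2 * k + 2)" by (rule power_increasing) (use x1 in auto)
    also have "\<dots> = x ^ (2 * k + 2)" by (simp add: power_even_abs)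
    finally have "\<bar>x\<bar> ^ k \<le> x ^ (2 * k + 2) / (R - 1)"
      using assms(1) by (simp add: field_simps)
    then show ?thesis using near False step by (simp add: power_abs)
  qed
qed

lemma tendsto_right_limit_mono:
  fixes F :: "real \<Rightarrow> real"
  assumes mono: "\<And>x y. x \<le> y \<Longrightarrow> F x \<le> F y" and lb: "\<And>x. a \<le> F x"
  shows "((\<lambda>h. F (x + h)) \<longlongrightarrow> (INF y\<in>{x<..}. F y)) (at_right 0)"
proof (rule order_tendstoI)
  have bdd: "bdd_below (F ` {x<..})" using lb by (intro bdd_belowI[of _ a]) auto
  fix c
  show "\<forall>\<^sub>F h in at_right 0. c < F (x + h)" if "c < (INF y\<in>{x<..}. F y)"
  proof -
    have "c < F (x + h)" if "h > 0" for h
      using \<open>c < _\<close> cINF_lower[OF bdd, of "x + h"] that by simp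
    then show ?thesis by (auto simp: eventually_at_filter)
  qed
  show "\<forall>\<^sub>F h in at_right 0. F (x + h) < c" if less: "(INF y\<in>{x<..}. F y) < c"
  proof -
    obtain y where y: "y > x" "F y < c"
      using less cINF_less_iff[OF _ bdd, of c] by auto
    have "F (x + h) < c" if "h < y - x" for h
      using mono[of "x + h" y] y that by simp
    then show ?thesis
      using y by (intro eventually_at_rightI[of 0 "y - x"]) auto
  qed
qed

lemma abs_power_le:
  fixes x R :: real
  assumes "-R \<le> x" "x \<le> R"
  shows "\<bar>x ^ k\<bar> \<le> R ^ k"
  using assms power_mono[of "\<bar>x\<bar>" R k] by (simp add: power_abs)

text \<open>On indicators of half lines the extended functional is a distribution function up to
  right-continuity. It need not be countably additive, so the moments are compared through step
  functions on bounded windows, with tails controlled by a higher even moment.\<close>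

theorem hamburger:
  assumes psd: "psd_sequence s"
  obtains \<mu> :: "real measure" where "sets \<mu> = sets borel" "finite_measure \<mu>"
    "\<And>k. integrable \<mu> (\<lambda>x. x ^ k)" "\<And>k. (\<integral>x. x ^ k \<partial>\<mu>) = s k"
proof -
  obtain \<Lambda> where \<Lambda>_poly: "\<And>p. \<Lambda> (poly p) = moment_functional s p"
    and \<Lambda>_add: "\<And>f g. poly_bounded f \<Longrightarrow> poly_bounded g \<Longrightarrow> \<Lambda> (\<lambda>x. f x + g x) = \<Lambda> f + \<Lambda> g"
    and \<Lambda>_scale: "\<And>f c. poly_bounded f \<Longrightarrow> \<Lambda> (\<lambda>x. c * f x) = c * \<Lambda> f"
    and \<Lambda>_mono: "\<And>f g. poly_bounded f \<Longrightarrow> poly_bounded g \<Longrightarrow> \<forall>x. f x \<le> g x \<Longrightarrow> \<Lambda> f \<le> \<Lambda> g"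
    by (rule positive_extension_exists[OF psd]) (rule that)
  have s_even: "s (2 * n) \<ge> 0" for n
    using moment_functional_nonneg[OF psd, of "monom 1 (2 * n)"]
    by (simp add: moment_functional_monom poly_monom zero_le_even_power)
  have s0: "s 0 \<ge> 0" using s_even[of 0] by simp
  have \<Lambda>_const: "\<Lambda> (\<lambda>x. c) = c * s 0" for c
  proof -
    have "(\<lambda>x. c) = poly (monom c 0)" by (auto simp: poly_monom)
    then show ?thesis by (simp only: \<Lambda>_poly moment_functional_monom)
  qed
  have pb_const: "poly_bounded (\<lambda>x. c)" for c :: real
    unfolding poly_bounded_def by (intro exI[of _ "[:\<bar>c\<bar>:]"]) simp
  have \<Lambda>_sum: "\<Lambda> (\<lambda>x. \<Sum>j<n. f j x) = (\<Sum>j<n. \<Lambda> (f j))" if "\<And>j. poly_bounded (f j)" for f and n :: nat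
  proof (induction n)
    case 0 then show ?case using \<Lambda>_const[of 0] by simp
  next
    case (Suc n)
    then show ?case using \<Lambda>_add[OF poly_bounded_sum[OF that] that] by simp
  qed
  define F where "F x = \<Lambda> (indicator {..x})" for x
  have F_mono: "F x \<le> F y" if "x \<le> y" for x y
    unfolding F_def using that by (intro \<Lambda>_mono poly_bounded_indicator) (auto simp: indicator_def)
  have F_ge: "0 \<le> F x" for x
    using \<Lambda>_mono[OF pb_const[of 0] poly_bounded_indicator[of "{..x}"]] \<Lambda>_const[of 0] by (simp add: F_def)
  have F_le: "F x \<le> s 0" for x
    using \<Lambda>_mono[OF poly_bounded_indicator[of "{..x}"] pb_const[of 1]] \<Lambda>_const[of 1]
    by (simp add: F_def indicator_def)
  \<comment> \<open>The values \<open>F x\<close> may fail to be right-continuous, which the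
    Stieltjes measure requires; \<open>G\<close> is the right limit.\<close>
  define G where "G x = (INF y\<in>{x<..}. F y)" for x
  have F_lim: "((\<lambda>h. F (x + h)) \<longlongrightarrow> G x) (at_right 0)" for x
    unfolding G_def by (rule tendsto_right_limit_mono[where a = 0]) (use F_mono F_ge in auto)
  have bdd: "bdd_below (F ` A)" for A using F_ge by (intro bdd_belowI[of _ 0]) auto
  have G_mono: "G x \<le> G y" if "x \<le> y" for x y
    unfolding G_def using that by (intro cINF_superset_mono bdd) auto
  have G_ge: "0 \<le> G x" for x unfolding G_def by (intro cINF_greatest F_ge) auto
  have G_le: "G x \<le> s 0" for x
    unfolding G_def by (rule cINF_lower2[OF bdd, of "x + 1"]) (auto simp: F_le)
  have G_cont: "continuous (at_right x) G" for x
    unfolding continuous_within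
  proof (rule order_tendstoI)
    fix c assume "c < G x"
    then show "\<forall>\<^sub>F y in at_right x. c < G y"
      using G_mono by (intro eventually_at_rightI[of x "x + 1"]) (auto intro: less_le_trans)
  next
    fix c assume "G x < c"
    then obtain y where y: "y > x" "F y < c"
      unfolding G_def using cINF_less_iff[OF _ bdd, of "{x<..}" c] by auto
    have "G z < c" if "z < y" for z
      unfolding G_def using cINF_lower[OF bdd, of y "{z<..}"] y that by simp
    then show "\<forall>\<^sub>F y in at_right x. G y < c"
      using y by (intro eventually_at_rightI[of x y]) auto
  qed
  define \<mu> where "\<mu> = interval_measure G"
  have sets_mu [measurable_cong, simp]: "sets \<mu> = sets borel" by (simp add: \<mu>_def)
  have space_mu [simp]: "space \<mu> = UNIV" by (simp add: \<mu>_def)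
  have em: "emeasure \<mu> {a<..b} = ennreal (G b - G a)" if "a \<le> b" for a b
    unfolding \<mu>_def using that G_mono G_cont by (intro emeasure_interval_measure_Ioc) auto
  have "emeasure \<mu> UNIV \<le> ennreal (s 0)"
  proof -
    have "(\<Union>n. {-real n<..real n}) = UNIV"
    proof (rule sym, rule UNIV_eq_I)
      fix x :: real
      obtain n where "real n > \<bar>x\<bar>" using reals_Archimedean2 by blast
      then show "x \<in> (\<Union>n. {-real n<..real n})" by (auto intro!: exI[of _ n])
    qed
    moreover have "(SUP n. emeasure \<mu> {-real n<..real n}) = emeasure \<mu> (\<Union>n. {-real n<..real n})"
      by (intro SUP_emeasure_incseq) (auto simp: incseq_def)
    moreover have "(SUP n. emeasure \<mu> {-real n<..real n}) \<le> ennreal (s 0)"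
    proof (rule SUP_least)
      fix n
      show "emeasure \<mu> {-real n<..real n} \<le> ennreal (s 0)"
        using G_le[of "real n"] G_ge[of "-real n"] by (auto simp: em intro!: ennreal_leI)
    qed
    ultimately show ?thesis by simp
  qed
  then have "emeasure \<mu> (space \<mu>) \<noteq> \<infinity>"
    by (metis space_mu ennreal_less_top infinity_ennreal_def leD)
  then interpret finite_measure \<mu> by (rule finite_measureI)
  have meas: "measure \<mu> {a<..b} = G b - G a" if "a \<le> b" for a b
    using em[OF that] G_mono[OF that] by (simp add: measure_def)
  have int_ind: "integrable \<mu> (indicator {a<..b} :: real \<Rightarrow> real)" for a b
    by (intro integrable_real_indicator) (auto simp: emeasure_eq_measure)
  have key: "\<bar>(\<integral>x. x ^ k * indicator {-R<..R} x \<partial>\<mu>) - s k\<bar> \<le> s (2 * k + 2) / (R - 1)" if R: "R \<ge> 2" for k R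
  proof -
    obtain K where K: "K \<ge> 0" "\<And>x y. \<bar>x\<bar> \<le> R + 1 \<Longrightarrow> \<bar>y\<bar> \<le> R + 1 \<Longrightarrow> \<bar>x ^ k - y ^ k\<bar> \<le> K * \<bar>x - y\<bar>"
      using power_lipschitz[of "R + 1" k] R by auto
    \<comment> \<open>The mesh error enters twice: between the functional and the step function, and
      between the step function and the integral. It vanishes as \<open>N\<close> grows; the tail
      term has to wait for \<open>R\<close>.\<close>
    have bound: "\<bar>(\<integral>x. x ^ k * indicator {-R<..R} x \<partial>\<mu>) - s k\<bar> \<le> 2 * (2 * K * (2 * R / real N)) * s 0 + s (2 * k + 2) / (R - 1)"
      if N: "N > 0" for N
    proof -
      define e where "e = 2 * K * (2 * R / real N)"
      have e: "e \<ge> 0" using K R by (simp add: e_def)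
      define T where "T h = (\<Sum>j<N. grid R N j ^ k * (F (grid R N (Suc j) + h) + (-1) * F (grid R N j + h)))" for h
      have pb_step: "poly_bounded (step_power k R N h)" for h
      proof -
        have "step_power k R N h = (\<lambda>x. \<Sum>j<N. grid R N j ^ k *
              (indicator {..grid R N (Suc j) + h} x + (-1) * indicator {..grid R N j + h} x))"
          by (auto simp: step_power_def)
        then show ?thesis
          by (simp only:) (intro poly_bounded_sum poly_bounded_scale poly_bounded_add poly_bounded_indicator)
      qed
      have \<Lambda>_step: "\<Lambda> (step_power k R N h) = T h" for h
      proof -
        have "step_power k R N h = (\<lambda>x. \<Sum>j<N. grid R N j ^ k *
              (indicator {..grid R N (Suc j) + h} x + (-1) * indicator {..grid R N j + h} x))"
          by (auto simp: step_power_def)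
        then show ?thesis
          by (simp only: T_def F_def \<Lambda>_sum \<Lambda>_scale \<Lambda>_add poly_bounded_sum poly_bounded_scale poly_bounded_add poly_bounded_indicator)
      qed
      define P where "P = monom e 0 + monom (1 / (R - 1)) (2 * k + 2)"
      have P: "poly P x = e + x ^ (2 * k + 2) / (R - 1)" for x by (simp add: P_def poly_monom)
      have \<Lambda>P: "\<Lambda> (poly P) = e * s 0 + s (2 * k + 2) / (R - 1)"
        by (simp add: \<Lambda>_poly P_def moment_functional_add moment_functional_monom)
      have T_bound: "\<bar>T h - s k\<bar> \<le> e * s 0 + s (2 * k + 2) / (R - 1)" if h: "0 \<le> h" "h \<le> 2 * R / real N" "h \<le> 1" for h
      proof -
        have ap: "\<bar>x ^ k - step_power k R N h x\<bar> \<le> poly P x" for x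
          unfolding P e_def by (rule step_power_approx_global) (use R N h K in auto)
        have "\<Lambda> (step_power k R N h) \<le> \<Lambda> (\<lambda>x. poly (monom 1 k) x + poly P x)"
          using ap by (intro \<Lambda>_mono pb_step poly_bounded_add poly_bounded_poly) (auto simp: poly_monom abs_le_iff algebra_simps)
        moreover have "\<Lambda> (poly (monom 1 k)) \<le> \<Lambda> (\<lambda>x. step_power k R N h x + poly P x)"
          using ap by (intro \<Lambda>_mono pb_step poly_bounded_add poly_bounded_poly) (auto simp: poly_monom abs_le_iff algebra_simps)
        ultimately show ?thesis
          by (simp add: \<Lambda>_add pb_step poly_bounded_poly \<Lambda>P \<Lambda>_step) (simp add: \<Lambda>_poly moment_functional_monom abs_le_iff)
      qed
      define T0 where "T0 = (\<Sum>j<N. grid R N j ^ k * (G (grid R N (Suc j)) + (-1) * G (grid R N j)))"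
      have "(T \<longlongrightarrow> T0) (at_right 0)"
        unfolding T_def T0_def by (intro tendsto_intros F_lim)
      then have "((\<lambda>h. \<bar>T h - s k\<bar>) \<longlongrightarrow> \<bar>T0 - s k\<bar>) (at_right 0)"
        by (intro tendsto_intros)
      moreover have "\<forall>\<^sub>F h in at_right 0. \<bar>T h - s k\<bar> \<le> e * s 0 + s (2 * k + 2) / (R - 1)"
      proof -
        have "min 1 (2 * R / real N) > 0" using R N by simp
        then show ?thesis
          using T_bound by (intro eventually_at_rightI[of 0 "min 1 (2 * R / real N)"]) auto
      qed
      ultimately have T0_bound: "\<bar>T0 - s k\<bar> \<le> e * s 0 + s (2 * k + 2) / (R - 1)"
        by (rule tendsto_upperbound) auto
      have grid_mono: "grid R N j \<le> grid R N (Suc j)" for j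
        using R N by (simp add: grid_Suc)
      have step_eq: "step_power k R N 0 = (\<lambda>x. \<Sum>j<N. grid R N j ^ k * indicator {grid R N j<..grid R N (Suc j)} x)"
      proof
        fix x
        have "indicator {..grid R N (Suc j)} x + (-1) * indicator {..grid R N j} x = (indicator {grid R N j<..grid R N (Suc j)} x :: real)" for j
          using grid_mono[of j] by (auto simp: indicator_def)
        then show "step_power k R N 0 x = (\<Sum>j<N. grid R N j ^ k * indicator {grid R N j<..grid R N (Suc j)} x)"
          by (simp add: step_power_def)
      qed
      have int_step: "integrable \<mu> (step_power k R N 0)"
        unfolding step_eq by (intro Bochner_Integration.integrable_sum integrable_mult_right int_ind)
      have "(\<integral>x. step_power k R N 0 x \<partial>\<mu>) = (\<Sum>j<N. grid R N j ^ k * (\<integral>x. indicator {grid R N j<..grid R N (Suc j)} x \<partial>\<mu>))"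
        unfolding step_eq
        by (subst Bochner_Integration.integral_sum) (auto intro!: integrable_mult_right int_ind)
      also have "\<dots> = T0" by (simp add: T0_def meas grid_mono)
      finally have step_int: "(\<integral>x. step_power k R N 0 x \<partial>\<mu>) = T0" .
      have int_k: "integrable \<mu> (\<lambda>x. x ^ k * indicator {-R<..R} x)"
      proof (rule integrable_const_bound[where B = "R ^ k"])
        show "AE x in \<mu>. norm (x ^ k * indicator {-R<..R} x) \<le> R ^ k"
        proof (rule AE_I2)
          fix x
          show "norm (x ^ k * indicator {-R<..R} x) \<le> R ^ k"
            using R by (auto simp: indicator_def intro!: abs_power_le)
        qed
      qed measurable
      have "\<bar>(\<integral>x. x ^ k * indicator {-R<..R} x \<partial>\<mu>) - T0\<bar> = \<bar>\<integral>x. x ^ k * indicator {-R<..R} x - step_power k R N 0 x \<partial>\<mu>\<bar>"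
        using int_k int_step by (simp add: step_int)
      also have "\<dots> \<le> (\<integral>x. e * indicator {-R<..R} x \<partial>\<mu>)"
      proof (rule integral_abs_bound[THEN order_trans], rule integral_mono)
        show "integrable \<mu> (\<lambda>x. \<bar>x ^ k * indicator {-R<..R} x - step_power k R N 0 x\<bar>)"
          using int_k int_step by auto
        show "\<bar>x ^ k * indicator {-R<..R} x - step_power k R N 0 x\<bar> \<le> e * indicator {-R<..R} x" for x
          using step_power_approx[of R N 0 K k x] R N K unfolding e_def by simp
      qed (intro integrable_mult_right int_ind)
      also have "\<dots> = e * (G R - G (-R))" using R by (simp add: meas)
      also have "\<dots> \<le> e * s 0"
        using e G_le[of R] G_ge[of "-R"] by (intro mult_left_mono) auto
      finally show ?thesis using T0_bound unfolding e_def[symmetric] by (simp add: abs_le_iff)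
    qed
    have lim: "(\<lambda>N. 2 * (2 * K * (2 * R / real N)) * s 0 + s (2 * k + 2) / (R - 1)) \<longlonglongrightarrow> 2 * (2 * K * 0) * s 0 + s (2 * k + 2) / (R - 1)"
      by (intro tendsto_intros lim_const_over_n)
    have "\<bar>(\<integral>x. x ^ k * indicator {-R<..R} x \<partial>\<mu>) - s k\<bar> \<le> 2 * (2 * K * 0) * s 0 + s (2 * k + 2) / (R - 1)"
      by (rule LIMSEQ_le_const[OF lim]) (use bound in \<open>intro exI[of _ 1] allI impI, simp\<close>)
    then show ?thesis by simp
  qed
  have key_lim: "(\<lambda>n. \<integral>x. x ^ k * indicator {-real n<..real n} x \<partial>\<mu>) \<longlonglongrightarrow> s k" for k
  proof (rule LIM_zero_cancel, rule Lim_null_comparison)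
    show "\<forall>\<^sub>F n in sequentially. norm ((\<integral>x. x ^ k * indicator {-real n<..real n} x \<partial>\<mu>) - s k) \<le> s (2 * k + 2) / (real n - 1)"
      using key[of "real _" k] by (auto simp: eventually_sequentially intro!: exI[of _ 2])
    show "(\<lambda>n. s (2 * k + 2) / (real n - 1)) \<longlonglongrightarrow> 0"
      by real_asymp
  qed
  have ev: "\<forall>\<^sub>F n in sequentially. x ^ k * indicator {-real n<..real n} x = x ^ k" for x :: real and k
  proof -
    obtain N where "real N > \<bar>x\<bar>" using reals_Archimedean2 by blast
    then show ?thesis
      by (auto simp: eventually_sequentially indicator_def intro!: exI[of _ N])
  qed
  \<comment> \<open>Even powers come first, because monotone convergence turns the convergent
    integrals over windows into integrability; all powers are then dominated by
    \<open>1 + x ^ (2 * k)\<close>.\<close>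
  have int_even: "integrable \<mu> (\<lambda>x. x ^ (2 * k))" for k
  proof (rule integrable_monotone_convergence[where f = "\<lambda>n x. x ^ (2 * k) * indicator {-real n<..real n} x"])
    show "integrable \<mu> (\<lambda>x. x ^ (2 * k) * indicator {-real n<..real n} x)" for n
    proof (rule integrable_const_bound[where B = "real n ^ (2 * k)"])
      show "AE x in \<mu>. norm (x ^ (2 * k) * indicator {-real n<..real n} x) \<le> real n ^ (2 * k)"
      proof (rule AE_I2)
        fix x
        show "norm (x ^ (2 * k) * indicator {-real n<..real n} x) \<le> real n ^ (2 * k)"
        proof (cases "x \<in> {-real n<..real n}")
          case True
          then have "\<bar>x ^ (2 * k)\<bar> \<le> real n ^ (2 * k)" by (intro abs_power_le) auto
          with True show ?thesis by simp
        qed simp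
      qed
    qed measurable
    show "AE x in \<mu>. incseq (\<lambda>n. x ^ (2 * k) * indicator {-real n<..real n} x)"
      by (auto simp: incseq_def indicator_def zero_le_even_power)
    show "AE x in \<mu>. (\<lambda>n. x ^ (2 * k) * indicator {-real n<..real n} x) \<longlonglongrightarrow> x ^ (2 * k)"
      by (intro AE_I2 tendsto_eventually ev)
    show "(\<lambda>n. \<integral>x. x ^ (2 * k) * indicator {-real n<..real n} x \<partial>\<mu>) \<longlonglongrightarrow> s (2 * k)"
      by (rule key_lim)
  qed measurable
  have int_pow: "integrable \<mu> (\<lambda>x. x ^ k)" for k
  proof (rule Bochner_Integration.integrable_bound)
    show "integrable \<mu> (\<lambda>x. 1 + x ^ (2 * k))"
      using int_even by auto
    show "AE x in \<mu>. norm (x ^ k) \<le> norm (1 + x ^ (2 * k))"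
    proof (rule AE_I2)
      fix x :: real
      have "0 \<le> (\<bar>x ^ k\<bar> - 1)\<^sup>2" by simp
      then have "2 * \<bar>x ^ k\<bar> \<le> 1 + x ^ (2 * k)"
        by (simp add: power2_diff power_mult[symmetric] mult.commute)
      then show "norm (x ^ k) \<le> norm (1 + x ^ (2 * k))" by simp
    qed
  qed measurable
  have "(\<integral>x. x ^ k \<partial>\<mu>) = s k" for k
  proof (rule LIMSEQ_unique[OF _ key_lim])
    show "(\<lambda>n. \<integral>x. x ^ k * indicator {-real n<..real n} x \<partial>\<mu>) \<longlonglongrightarrow> (\<integral>x. x ^ k \<partial>\<mu>)"
    proof (rule integral_dominated_convergence[where w = "\<lambda>x. \<bar>x ^ k\<bar>"])
      show "AE x in \<mu>. (\<lambda>n. x ^ k * indicator {-real n<..real n} x) \<longlonglongrightarrow> x ^ k"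
        by (intro AE_I2 tendsto_eventually ev)
      show "integrable \<mu> (\<lambda>x. \<bar>x ^ k\<bar>)" using int_pow by auto
      show "AE x in \<mu>. norm (x ^ k * indicator {-real n<..real n} x) \<le> \<bar>x ^ k\<bar>" for n
        by (auto simp: indicator_def)
    qed measurable
  qed
  then show ?thesis
    using that[of \<mu>] int_pow finite_measure_axioms by simp
qed

section \<open>Uniqueness under quasi-analyticity\<close>

text \<open>Meant for differentiation under the integral sign: a pointwise remainder bound that is
  quadratic in \<open>h\<close> with an integrable constant survives integration.\<close>

lemma DERIV_quadratic_remainder:
  fixes f :: "real \<Rightarrow> real"
  assumes "\<And>h. \<bar>f (t + h) - f t - h * D\<bar> \<le> C * h\<^sup>2"
  shows "(f has_real_derivative D) (at t)"
  unfolding DERIV_def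
proof (rule LIM_zero_cancel, rule Lim_null_comparison)
  show "\<forall>\<^sub>F h in at 0. norm ((f (t + h) - f t) / h - D) \<le> C * \<bar>h\<bar>"
    unfolding eventually_at_filter
  proof (rule always_eventually, intro allI impI)
    fix h :: real assume h: "h \<noteq> 0"
    have "\<bar>(f (t + h) - f t) / h - D\<bar> * \<bar>h\<bar> = \<bar>f (t + h) - f t - h * D\<bar>"
      using h by (simp add: abs_mult[symmetric] field_simps)
    also have "\<dots> \<le> (C * \<bar>h\<bar>) * \<bar>h\<bar>"
      using assms[of h] by (simp add: power2_eq_square abs_mult[symmetric])
    finally show "norm ((f (t + h) - f t) / h - D) \<le> C * \<bar>h\<bar>"
      using h by simp
  qed
  show "((\<lambda>h. C * \<bar>h\<bar>) \<longlongrightarrow> 0) (at 0)"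
    by (auto intro!: tendsto_eq_intros)
qed

lemma quadratic_remainder_bound:
  fixes g g' g'' :: "real \<Rightarrow> real"
  assumes g: "\<And>t. (g has_real_derivative g' t) (at t)"
    and g': "\<And>t. (g' has_real_derivative g'' t) (at t)"
    and C: "\<And>t. \<bar>g'' t\<bar> \<le> C"
  shows "\<bar>g (t + h) - g t - h * g' t\<bar> \<le> C * h\<^sup>2"
proof -
  have lip: "\<bar>g' x - g' y\<bar> \<le> C * \<bar>x - y\<bar>" for x y
    using field_differentiable_bound[of UNIV g' g'' C x y] g' C
    by (auto simp: has_field_derivative_at_within)
  have "\<bar>(g (t + h) - (t + h) * g' t) - (g t - t * g' t)\<bar> \<le> (C * \<bar>h\<bar>) * \<bar>(t + h) - t\<bar>"
  proof -
    have "norm ((g (t + h) - (t + h) * g' t) - (g t - t * g' t)) \<le> (C * \<bar>h\<bar>) * norm ((t + h) - t)"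
    proof (rule field_differentiable_bound[of "closed_segment t (t + h)" "\<lambda>u. g u - u * g' t" "\<lambda>u. g' u - g' t"])
      show "((\<lambda>u. g u - u * g' t) has_field_derivative g' u - g' t) (at u within closed_segment t (t + h))" for u
        by (auto intro!: derivative_eq_intros has_field_derivative_at_within[OF g])
      show "norm (g' u - g' t) \<le> C * \<bar>h\<bar>" if "u \<in> closed_segment t (t + h)" for u
      proof -
        have "\<bar>u - t\<bar> \<le> \<bar>h\<bar>" using that by (auto simp: closed_segment_eq_real_ivl split: if_splits)
        moreover have "C \<ge> 0" using C[of 0] by linarith
        ultimately show ?thesis using lip[of u t] by (simp add: mult_left_mono order_trans)
      qed
    qed auto
    then show ?thesis by simp
  qed
  then show ?thesis by (simp add: algebra_simps power2_eq_square abs_mult[symmetric])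
qed

text \<open>Glueing the zero function on the left half line: a function whose Taylor coefficients at
  \<open>0\<close> are those of \<open>c * exp (- t)\<close> must equal it on the right half line, although
  \<open>exp (- t)\<close> itself is unbounded on the left and so not in the class.\<close>

lemma quasi_analytic_exp:
  fixes F :: "nat \<Rightarrow> real \<Rightarrow> real"
  assumes qa: "quasi_analytic (ultra_class M)"
    and der: "\<And>n t. (F n has_real_derivative F (Suc n) t) (at t)"
    and flat: "\<And>n. F (Suc n) 0 = - F n 0"
    and bound: "\<And>n t. \<bar>F n t\<bar> \<le> A * B ^ n * M n" and AB: "A > 0" "B > 0"
    and lower: "\<And>n. 1 \<le> A * B ^ n * M n"
    and t: "t \<ge> 0"
  shows "F 0 t = F 0 0 * exp (- t)"
proof -
  define c where "c = F 0 0"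
  have F0: "F n 0 = (-1) ^ n * c" for n
    by (induction n) (simp_all add: c_def flat)
  define f where "f n t = F n t - (-1) ^ n * c * exp (- t)" for n t
  define G where "G n t = (if t \<ge> 0 then f n t else 0)" for n t
  have f0: "f n 0 = 0" for n by (simp add: f_def F0)
  have derf: "(f n has_real_derivative f (Suc n) t) (at t)" for n t
    unfolding f_def by (auto intro!: derivative_eq_intros der)
  have derG: "(G n has_real_derivative G (Suc n) t) (at t)" for n t
  proof -
    consider "t > 0" | "t < 0" | "t = 0" by linarith
    then show ?thesis
    proof cases
      case 1
      have "\<forall>\<^sub>F x in nhds t. x > 0" using 1 by (intro order_tendstoD(1)[OF filterlim_ident])
      then have "\<forall>\<^sub>F x in nhds t. f n x = G n x" by eventually_elim (simp add: G_def)
      then show ?thesis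
        using derf[of n t] 1 DERIV_cong_ev[of t t "f n" "G n" "f (Suc n) t" "f (Suc n) t"] by (simp add: G_def[of "Suc n"])
    next
      case 2
      have "\<forall>\<^sub>F x in nhds t. x < 0" using 2 by (intro order_tendstoD(2)[OF filterlim_ident])
      then have "\<forall>\<^sub>F x in nhds t. (\<lambda>_. 0) x = G n x" by eventually_elim (simp add: G_def)
      moreover have "((\<lambda>_. 0) has_real_derivative 0) (at t)" by simp
      ultimately show ?thesis using 2 DERIV_cong_ev[of t t "\<lambda>_. 0" "G n" 0 0] by (simp add: G_def[of "Suc n"])
    next
      case 3
      \<comment> \<open>All \<open>f n\<close> vanish at \<open>0\<close>, so at every order both
        one-sided difference quotients of the glued function tend to \<open>0\<close>.\<close>
      have "((\<lambda>y. (G n y - G n 0) / (y - 0)) \<longlongrightarrow> 0) (at_right 0)"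
      proof (rule Lim_transform_eventually)
        show "((\<lambda>y. (f n y - f n 0) / (y - 0)) \<longlongrightarrow> 0) (at_right 0)"
          using derf[of n 0] unfolding has_field_derivative_iff by (simp add: f0 filterlim_at_split)
        show "\<forall>\<^sub>F y in at_right 0. (f n y - f n 0) / (y - 0) = (G n y - G n 0) / (y - 0)"
          by (auto simp: eventually_at_filter G_def)
      qed
      moreover have "((\<lambda>y. (G n y - G n 0) / (y - 0)) \<longlongrightarrow> 0) (at_left 0)"
        by (rule tendsto_eventually) (auto simp: eventually_at_filter G_def f0)
      ultimately show ?thesis
        unfolding 3 has_field_derivative_iff by (simp add: filterlim_at_split G_def f0)
    qed
  qed
  have derivn: "(deriv ^^ n) (G 0) = G n" for n
  proof (induction n)
    case (Suc n)
    have "deriv (G n) = G (Suc n)" using DERIV_imp_deriv[OF derG] by auto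
    then show ?case by (simp add: Suc)
  qed simp
  have "smooth_fun (G 0)"
    unfolding smooth_fun_def derivn differentiable_on_def
    using derG by (auto simp: real_differentiable_def)
  moreover have "\<bar>(deriv ^^ n) (G 0) x\<bar> \<le> (A * (1 + \<bar>c\<bar>)) * B ^ n * M n" for n x
  proof -
    \<comment> \<open>The lower bound absorbs the exponential into the class, as
      \<open>exp (- x) \<le> 1\<close> on the right half line.\<close>
    have M: "A * B ^ n * M n \<ge> 1" by (rule lower)
    have "\<bar>G n x\<bar> \<le> A * B ^ n * M n + \<bar>c\<bar> * (A * B ^ n * M n)"
    proof (cases "x \<ge> 0")
      case True
      have "\<bar>f n x\<bar> \<le> \<bar>F n x\<bar> + \<bar>(-1) ^ n * c * exp (- x)\<bar>"
        unfolding f_def by (rule abs_triangle_ineq4)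
      also have "\<bar>(-1) ^ n * c * exp (- x)\<bar> = \<bar>c\<bar> * exp (-x)"
        by (simp add: abs_mult power_abs)
      also have "\<dots> \<le> \<bar>c\<bar> * (A * B ^ n * M n)"
        using True M by (intro mult_left_mono) (auto intro: order_trans[OF _ M])
      finally show ?thesis using bound[of n x] True by (simp add: G_def)
    next
      case False
      have "\<bar>c\<bar> * (A * B ^ n * M n) \<ge> 0" using M mult_nonneg_nonneg[of "\<bar>c\<bar>" "A * B ^ n * M n"] by auto
      then show ?thesis using False M by (simp add: G_def)
    qed
    then show ?thesis by (simp add: derivn algebra_simps)
  qed
  moreover have "A * (1 + \<bar>c\<bar>) > 0" using AB by simp
  ultimately have "G 0 \<in> ultra_class M"
    unfolding ultra_class_def using AB by blast
  moreover have "(deriv ^^ n) (G 0) 0 = 0" for n by (simp add: derivn G_def f0)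
  ultimately have "G 0 t = 0" using qa by (auto simp: quasi_analytic_def)
  then show ?thesis using t by (simp add: G_def f_def c_def)
qed

text \<open>The kernel \<open>kern 0 \<theta> x\<close> solves \<open>y' + y = cos (t x + \<theta>)\<close>; dividing by
  \<open>x\<^sup>2 + 1\<close> gains one power of \<open>x\<close>, so that moments of even order bound all derivatives.\<close>

definition kern :: "nat \<Rightarrow> real \<Rightarrow> real \<Rightarrow> real \<Rightarrow> real"
  where "kern n \<theta> x t = x ^ n * ((cos (t * x + \<theta>) + x * sin (t * x + \<theta>)) / (1 + x\<^sup>2))"

lemma one_plus_square_pos: "1 + x\<^sup>2 > (0::real)"
  by (metis add_pos_nonneg zero_less_one zero_le_power2)

text \<open>Lagrange's identity for the vectors \<open>(1, x)\<close> and
  \<open>(cos y, sin y)\<close>: the difference of the two squares is again a square.\<close>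

lemma abs_cos_sin_le: "\<bar>cos y + x * sin y\<bar> \<le> sqrt (1 + x\<^sup>2)"
proof (rule real_le_rsqrt)
  have alg: "(1 + x\<^sup>2) * (c\<^sup>2 + s\<^sup>2) - (c + x * s)\<^sup>2 = (s - x * c)\<^sup>2" for c s :: real
    by (simp add: power2_eq_square algebra_simps)
  have "1 + x\<^sup>2 - (cos y + x * sin y)\<^sup>2 = (sin y - x * cos y)\<^sup>2"
    unfolding alg[symmetric] by simp
  then have "(cos y + x * sin y)\<^sup>2 \<le> 1 + x\<^sup>2"
    by (metis diff_ge_0_iff_ge zero_le_power2)
  then show "\<bar>cos y + x * sin y\<bar>\<^sup>2 \<le> 1 + x\<^sup>2" by simp
qed

lemma kern_bound: "\<bar>kern n \<theta> x t\<bar> \<le> \<bar>x\<bar> ^ n"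
proof -
  have s: "sqrt (1 + x\<^sup>2) \<le> 1 + x\<^sup>2"
    using power_increasing[of 1 2 "1 + x\<^sup>2"] by (intro real_le_lsqrt) auto
  have "\<bar>(cos (t * x + \<theta>) + x * sin (t * x + \<theta>)) / (1 + x\<^sup>2)\<bar> \<le> 1"
    using abs_cos_sin_le[of "t * x + \<theta>" x] s one_plus_square_pos[of x] by (simp add: abs_divide)
  then show ?thesis
    unfolding kern_def abs_mult power_abs[symmetric]
    by (metis abs_ge_zero mult.right_neutral mult_left_mono)
qed

text \<open>Both the numerator and \<open>x\<close> are at most \<open>sqrt (1 + x\<^sup>2)\<close>
  in absolute value, so the denominator absorbs one factor \<open>x\<close>. Odd orders are thereby
  bounded by the even moment just below.\<close>

lemma kern_bound_Suc: "\<bar>kern (Suc n) \<theta> x t\<bar> \<le> \<bar>x\<bar> ^ n"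
proof -
  have "\<bar>x\<bar> * sqrt (1 + x\<^sup>2) \<le> sqrt (1 + x\<^sup>2) * sqrt (1 + x\<^sup>2)"
    by (intro mult_right_mono) (auto intro!: real_le_rsqrt)
  also have "\<dots> = 1 + x\<^sup>2" using one_plus_square_pos[of x] by simp
  finally have s: "\<bar>x\<bar> * sqrt (1 + x\<^sup>2) \<le> 1 + x\<^sup>2" .
  have "\<bar>x\<bar> * \<bar>cos (t * x + \<theta>) + x * sin (t * x + \<theta>)\<bar> \<le> \<bar>x\<bar> * sqrt (1 + x\<^sup>2)"
    by (intro mult_left_mono abs_cos_sin_le) auto
  then have "\<bar>x * ((cos (t * x + \<theta>) + x * sin (t * x + \<theta>)) / (1 + x\<^sup>2))\<bar> \<le> 1"
    using s one_plus_square_pos[of x] by (simp add: abs_mult abs_divide)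
  moreover have "kern (Suc n) \<theta> x t = x ^ n * (x * ((cos (t * x + \<theta>) + x * sin (t * x + \<theta>)) / (1 + x\<^sup>2)))"
    by (simp add: kern_def)
  ultimately show ?thesis
    unfolding abs_mult[of "x ^ n"] power_abs[symmetric]
    by (metis abs_ge_zero abs_mult mult.right_neutral mult_left_mono)
qed

text \<open>\<open>kern n \<theta> x t\<close> is the real part of
  \<open>x^n * exp (\<i> * (t * x + \<theta>)) / (1 + \<i> * x)\<close>. Differentiation in
  \<open>t\<close> multiplies by \<open>\<i> * x\<close>, and the factor \<open>\<i>\<close> is a
  phase shift by \<open>pi / 2\<close>; the phase replaces complex arithmetic.\<close>

lemma kern_deriv: "(kern n \<theta> x has_real_derivative kern (Suc n) (\<theta> + pi / 2) x t) (at t)"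
proof -
  have *: "cos (t * x + (\<theta> + pi / 2)) = - sin (t * x + \<theta>)" "sin (t * x + (\<theta> + pi / 2)) = cos (t * x + \<theta>)"
    using cos_add[of "t * x + \<theta>" "pi/2"] sin_add[of "t * x + \<theta>" "pi/2"] by (simp_all add: add.assoc)
  show ?thesis
    unfolding kern_def[abs_def] unfolding * unfolding divide_inverse
    by (auto intro!: derivative_eq_intros simp: algebra_simps)
qed

lemma kern_ode: "kern (Suc n) (\<theta> + pi / 2) x t + kern n \<theta> x t = x ^ n * cos (t * x + \<theta>)"
proof -
  have *: "cos (t * x + (\<theta> + pi / 2)) = - sin (t * x + \<theta>)" "sin (t * x + (\<theta> + pi / 2)) = cos (t * x + \<theta>)"
    using cos_add[of "t * x + \<theta>" "pi/2"] sin_add[of "t * x + \<theta>" "pi/2"] by (simp_all add: add.assoc)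
  have "1 + x\<^sup>2 \<noteq> 0" using one_plus_square_pos[of x] by simp
  have "x * (- sin (t * x + \<theta>) + x * cos (t * x + \<theta>)) + (cos (t * x + \<theta>) + x * sin (t * x + \<theta>))
      = (1 + x\<^sup>2) * cos (t * x + \<theta>)"
    by (simp add: power2_eq_square algebra_simps)
  then have "(x * (- sin (t * x + \<theta>) + x * cos (t * x + \<theta>)) + (cos (t * x + \<theta>) + x * sin (t * x + \<theta>))) / (1 + x\<^sup>2)
      = cos (t * x + \<theta>)"
    using \<open>1 + x\<^sup>2 \<noteq> 0\<close> by simp
  moreover have "kern (Suc n) (\<theta> + pi / 2) x t + kern n \<theta> x t = x ^ n *
      ((x * (- sin (t * x + \<theta>) + x * cos (t * x + \<theta>)) + (cos (t * x + \<theta>) + x * sin (t * x + \<theta>))) / (1 + x\<^sup>2))"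
    unfolding kern_def * by (simp only: add_divide_distrib power_Suc2 distrib_left times_divide_eq_right mult.assoc)
  ultimately show ?thesis by simp
qed

lemma kern_measurable [measurable]: "(\<lambda>x. kern n \<theta> x t) \<in> borel_measurable borel"
  unfolding kern_def by measurable

locale moment_measure = finite_measure M for M :: "real measure" +
  assumes sets_M [measurable_cong]: "sets M = sets borel"
    and powers: "\<And>k. integrable M (\<lambda>x. x ^ k)"
begin

lemma space_M [simp]: "space M = UNIV"
  using sets_M by (metis sets_eq_imp_space_eq space_borel)

lemma abs_powers: "integrable M (\<lambda>x. \<bar>x\<bar> ^ k)"
  using integrable_abs[OF powers[of k]] by (simp add: power_abs)

lemma integrable_kern: "integrable M (\<lambda>x. kern n \<theta> x t)"
  by (rule Bochner_Integration.integrable_bound[OF abs_powers[of n]])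
     (use kern_bound in auto)

lemma integral_kern_bound: "\<bar>\<integral>x. kern n \<theta> x t \<partial>M\<bar> \<le> (\<integral>x. \<bar>x\<bar> ^ n \<partial>M)"
  by (rule order_trans[OF integral_abs_bound])
     (intro integral_mono abs_powers integrable_abs integrable_kern kern_bound)

lemma integral_kern_bound_Suc: "\<bar>\<integral>x. kern (Suc n) \<theta> x t \<partial>M\<bar> \<le> (\<integral>x. \<bar>x\<bar> ^ n \<partial>M)"
  by (rule order_trans[OF integral_abs_bound])
     (intro integral_mono abs_powers integrable_abs integrable_kern kern_bound_Suc)

lemma integral_kern_deriv:
  "((\<lambda>t. \<integral>x. kern n \<theta> x t \<partial>M) has_real_derivative (\<integral>x. kern (Suc n) (\<theta> + pi / 2) x t \<partial>M)) (at t)"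
proof (rule DERIV_quadratic_remainder)
  fix h
  have "(\<integral>x. kern n \<theta> x (t + h) \<partial>M) - (\<integral>x. kern n \<theta> x t \<partial>M) - h * (\<integral>x. kern (Suc n) (\<theta> + pi / 2) x t \<partial>M)
      = (\<integral>x. kern n \<theta> x (t + h) - kern n \<theta> x t - h * kern (Suc n) (\<theta> + pi / 2) x t \<partial>M)"
    by (simp add: integrable_kern)
  also have "\<bar>\<dots>\<bar> \<le> (\<integral>x. \<bar>x\<bar> ^ (Suc (Suc n)) * h\<^sup>2 \<partial>M)"
  proof (rule order_trans[OF integral_abs_bound], rule integral_mono)
    show "\<bar>kern n \<theta> x (t + h) - kern n \<theta> x t - h * kern (Suc n) (\<theta> + pi / 2) x t\<bar> \<le> \<bar>x\<bar> ^ (Suc (Suc n)) * h\<^sup>2" for x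
      by (rule quadratic_remainder_bound[OF kern_deriv kern_deriv kern_bound])
  qed (intro integrable_abs Bochner_Integration.integrable_diff integrable_mult_right integrable_mult_left integrable_kern abs_powers)+
  finally show "\<bar>(\<integral>x. kern n \<theta> x (t + h) \<partial>M) - (\<integral>x. kern n \<theta> x t \<partial>M) - h * (\<integral>x. kern (Suc n) (\<theta> + pi / 2) x t \<partial>M)\<bar>
      \<le> (\<integral>x. \<bar>x\<bar> ^ (Suc (Suc n)) \<partial>M) * h\<^sup>2" by simp
qed

lemma integral_kern_ode:
  "(\<integral>x. kern (Suc n) (\<theta> + pi / 2) x t \<partial>M) + (\<integral>x. kern n \<theta> x t \<partial>M) = (\<integral>x. x ^ n * cos (t * x + \<theta>) \<partial>M)"
  by (subst Bochner_Integration.integral_add[symmetric]) (simp_all add: integrable_kern kern_ode)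

end

text \<open>The sequence \<open>a\<close> plays the role of the even moments \<open>m\<^sub>0, m\<^sub>2, m\<^sub>4, \<dots>\<close> of one variable.\<close>

lemma cos_transform_unique_pos:
  assumes M: "moment_measure M" and N: "moment_measure N"
    and mom: "\<And>k. (\<integral>x. x ^ k \<partial>M) = (\<integral>x. x ^ k \<partial>N)"
    and bound: "\<And>k. (\<integral>x. x ^ (2 * k) \<partial>M) \<le> C * sqrt (a (2 * k))"
    and a: "\<And>n. 0 \<le> a n" "\<And>n. (a (Suc n))\<^sup>2 \<le> a n * a (Suc (Suc n))"
    and qa: "quasi_analytic (ultra_class (\<lambda>n. sqrt \<bar>a n\<bar>))"
    and a1: "a 1 > 0" and t: "t \<ge> 0"
  shows "(\<integral>x. cos (t * x + \<theta>) \<partial>M) = (\<integral>x. cos (t * x + \<theta>) \<partial>N)"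
proof -
  interpret M: moment_measure M by (rule M)
  interpret N: moment_measure N by (rule N)
  define m where "m n = sqrt \<bar>a n\<bar>" for n
  \<comment> \<open>Log-convexity spreads positivity from index \<open>1\<close> down to
    \<open>0\<close> and then upwards through all indices.\<close>
  have a_pos: "a n > 0" for n
  proof (induction n)
    case 0
    have "0 < (a 1)\<^sup>2" using a1 by simp
    then show ?case using a(2)[of 0] a(1)[of 0] by (metis One_nat_def less_le mult_zero_left not_less)
  next
    case (Suc n)
    show ?case
    proof (cases n)
      case 0 then show ?thesis using a1 by simp
    next
      case (Suc k)
      have "0 < (a n)\<^sup>2" using \<open>a n > 0\<close> by simp
      then show ?thesis using a(2)[of k] a(1)[of "Suc n"] Suc by (metis less_le mult_zero_right not_less)
    qed
  qed
  define r where "r = sqrt (a 0 / a 1)"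
  have r: "r > 0" using a_pos by (simp add: r_def)
  \<comment> \<open>By log-convexity the quotients \<open>a (Suc n) / a n\<close> are nondecreasing,
    so the first one bounds them all from below.\<close>
  have ratio: "a n \<le> (a 0 / a 1) * a (Suc n)" for n
  proof (induction n)
    case 0 then show ?case using a_pos[of 1] by simp
  next
    case (Suc n)
    have "a (Suc n) * a (Suc n) \<le> a n * a (Suc (Suc n))" using a(2)[of n] by (simp add: power2_eq_square)
    also have "\<dots> \<le> (a 0 / a 1 * a (Suc n)) * a (Suc (Suc n))"
      using Suc a(1) by (intro mult_right_mono) auto
    finally have "a (Suc n) * a (Suc n) \<le> a (Suc n) * (a 0 / a 1 * a (Suc (Suc n)))" by (simp only: mult_ac)
    then show ?case using a_pos[of "Suc n"] by (simp only: mult_le_cancel_left_pos)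
  qed
  have m_step: "m n \<le> r * m (Suc n)" for n
    using real_sqrt_le_mono[OF ratio[of n]] by (simp only: m_def r_def real_sqrt_mult abs_of_nonneg[OF a(1)])
  have m0: "m 0 > 0" using a_pos[of 0] by (simp add: m_def)
  have m_pos: "m n > 0" for n using a_pos[of n] by (simp add: m_def)
  have m_lower: "m 0 \<le> r ^ n * m n" for n
  proof (induction n)
    case (Suc n)
    have "r ^ n * m n \<le> r ^ n * (r * m (Suc n))" using r m_step by (intro mult_left_mono) auto
    then show ?case using Suc by (simp add: mult_ac)
  qed simp
  \<comment> \<open>In \<open>D\<close> the amount \<open>2 * \<bar>C\<bar> * (1 + r)\<close> covers
    the two measures at even and odd orders, and \<open>1 / m 0\<close> secures the lower bound
    \<open>1 \<le> D * B ^ n * m n\<close>. The base \<open>B = 1 + r\<close> dominates both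
    \<open>1\<close> and \<open>r\<close>.\<close>
  define D where "D = (2 * \<bar>C\<bar> + 1) * (1 + r) + 1 / m 0"
  define B where "B = 1 + r"
  have "2 * \<bar>C\<bar> + 1 > 0" by linarith
  then have DB: "D > 0" "B > 0"
    using r m0 mult_pos_pos[of "2 * \<bar>C\<bar> + 1" "1 + r"] by (auto simp: D_def B_def add_pos_pos)
  define F where "F n t = (\<integral>x. kern n (\<theta> + real n * (pi / 2)) x t \<partial>M) - (\<integral>x. kern n (\<theta> + real n * (pi / 2)) x t \<partial>N)" for n t
  have arg: "\<theta> + real (Suc n) * (pi / 2) = \<theta> + real n * (pi / 2) + pi / 2" for n
    by (simp add: algebra_simps)
  have der: "(F n has_real_derivative F (Suc n) t) (at t)" for n t
    unfolding F_def arg by (intro DERIV_diff M.integral_kern_deriv N.integral_kern_deriv)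
  have sum_F: "F (Suc n) t + F n t = (\<integral>x. x ^ n * cos (t * x + (\<theta> + real n * (pi / 2))) \<partial>M) - (\<integral>x. x ^ n * cos (t * x + (\<theta> + real n * (pi / 2))) \<partial>N)" for n t
    unfolding M.integral_kern_ode[symmetric] N.integral_kern_ode[symmetric] F_def arg by simp
  \<comment> \<open>At \<open>t = 0\<close> the right-hand side of the differential equation is a
    difference of equal moments times a cosine. The values \<open>F n 0\<close> themselves are not
    moments and stay unknown.\<close>
  have flat: "F (Suc n) 0 = - F n 0" for n
    using sum_F[of n 0] by (simp add: mom)
  have absm: "(\<integral>x. \<bar>x\<bar> ^ (2 * k) \<partial>M) \<le> \<bar>C\<bar> * m (2 * k)" "(\<integral>x. \<bar>x\<bar> ^ (2 * k) \<partial>N) \<le> \<bar>C\<bar> * m (2 * k)" for k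
  proof -
    have "C * sqrt (a (2 * k)) \<le> \<bar>C\<bar> * m (2 * k)" using a(1) by (simp add: m_def mult_right_mono)
    then show "(\<integral>x. \<bar>x\<bar> ^ (2 * k) \<partial>M) \<le> \<bar>C\<bar> * m (2 * k)" "(\<integral>x. \<bar>x\<bar> ^ (2 * k) \<partial>N) \<le> \<bar>C\<bar> * m (2 * k)"
      using bound[of k] mom[of "2 * k"] by (simp_all add: power_even_abs)
  qed
  have F_bound: "\<bar>F n t\<bar> \<le> D * B ^ n * m n" for n t
  proof -
    have "\<bar>F n t\<bar> \<le> 2 * \<bar>C\<bar> * (1 + r) * m n"
    proof (cases "even n")
      case True
      then obtain k where k: "n = 2 * k" by blast
      have "\<bar>F n t\<bar> \<le> 2 * \<bar>C\<bar> * m n"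
        using M.integral_kern_bound[of n "\<theta> + real n * (pi / 2)" t] N.integral_kern_bound[of n "\<theta> + real n * (pi / 2)" t] absm[of k]
        unfolding F_def k by linarith
      also have "\<dots> \<le> 2 * \<bar>C\<bar> * m n + 2 * \<bar>C\<bar> * m n * r"
        using m_pos[of n] r by simp
      finally show ?thesis by (simp add: algebra_simps)
    next
      case False
      then obtain k where k: "n = Suc (2 * k)" by (metis oddE Suc_eq_plus1)
      \<comment> \<open>Order \<open>2 * k + 1\<close> is bounded by the moment of order
        \<open>2 * k\<close>; passing from \<open>m (2 * k)\<close> to \<open>m n\<close> costs the
        factor \<open>r\<close>.\<close>
      have "\<bar>F n t\<bar> \<le> 2 * \<bar>C\<bar> * m (2 * k)"
        using M.integral_kern_bound_Suc[of "2 * k" "\<theta> + real n * (pi / 2)" t] N.integral_kern_bound_Suc[of "2 * k" "\<theta> + real n * (pi / 2)" t] absm[of k]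
        unfolding F_def k by linarith
      also have "\<dots> \<le> 2 * \<bar>C\<bar> * (r * m n)"
        using m_step[of "2 * k"] by (intro mult_left_mono) (auto simp: k)
      also have "\<dots> \<le> 2 * \<bar>C\<bar> * (r * m n) + 2 * \<bar>C\<bar> * m n"
        using m_pos[of n] by simp
      finally show ?thesis by (simp add: algebra_simps)
    qed
    also have "\<dots> \<le> D * m n"
    proof (rule mult_right_mono)
      have "D = 2 * \<bar>C\<bar> * (1 + r) + (1 + r) + 1 / m 0" by (simp add: D_def algebra_simps)
      moreover have "1 / m 0 > 0" using m0 by simp
      ultimately show "2 * \<bar>C\<bar> * (1 + r) \<le> D" using r by linarith
    qed (use m_pos[of n] in simp)
    also have "\<dots> \<le> D * (B ^ n * m n)"
      using m_pos[of n] DB r by (intro mult_left_mono) (auto simp: B_def intro!: one_le_power)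
    finally show ?thesis by (simp add: mult.assoc)
  qed
  have lower: "1 \<le> D * B ^ n * m n" for n
  proof -
    have "1 \<le> (1 / m 0) * (r ^ n * m n)" using m_lower[of n] m0 by (simp add: field_simps)
    also have "\<dots> \<le> D * (B ^ n * m n)"
    proof (rule mult_mono)
      have "(2 * \<bar>C\<bar> + 1) * (1 + r) \<ge> 0" using r by (intro mult_nonneg_nonneg) linarith+
      then show "1 / m 0 \<le> D" unfolding D_def by linarith
      have "r ^ n \<le> B ^ n" using r by (intro power_mono) (auto simp: B_def)
      then show "r ^ n * m n \<le> B ^ n * m n" using m_pos[of n] by (intro mult_right_mono) auto
      show "0 \<le> r ^ n * m n" using r m_pos[of n] by (intro mult_nonneg_nonneg zero_le_power) linarith+
      show "0 \<le> D" using DB by linarith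
    qed
    finally show ?thesis by (simp add: mult.assoc)
  qed
  have F_exp: "F 0 t = F 0 0 * exp (- t)" if "t \<ge> 0" for t
    by (rule quasi_analytic_exp[OF _ der flat F_bound DB lower that]) (use qa in \<open>simp add: m_def\<close>)
  \<comment> \<open>The sum of \<open>F 0\<close> and its derivative is the difference of the two
    cosine transforms, and this operator annihilates \<open>c * exp (- t)\<close> whatever
    \<open>c\<close> is.\<close>
  have "F (Suc 0) t + F 0 t = 0"
  proof (cases "t = 0")
    case True
    then show ?thesis using flat[of 0] by simp
  next
    case False
    then have "t > 0" using t by simp
    then have "\<forall>\<^sub>F u in nhds t. u > 0" by (intro order_tendstoD(1)[OF filterlim_ident])
    then have "\<forall>\<^sub>F u in nhds t. F 0 u = F 0 0 * exp (- u)" by eventually_elim (rule F_exp, simp)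
    moreover have "((\<lambda>u. F 0 0 * exp (- u)) has_real_derivative - (F 0 0 * exp (- t))) (at t)"
      by (auto intro!: derivative_eq_intros)
    ultimately have "(F 0 has_real_derivative - (F 0 0 * exp (- t))) (at t)"
      using DERIV_cong_ev[of t t "F 0" "\<lambda>u. F 0 0 * exp (- u)"] by blast
    with der[of 0 t] have "F (Suc 0) t = - (F 0 0 * exp (- t))" by (rule DERIV_unique)
    then show ?thesis using F_exp[OF t] by simp
  qed
  then show ?thesis using sum_F[of 0 t] by simp
qed

text \<open>Negative \<open>t\<close> is reflected by evenness of the cosine. If
  \<open>a 1 = 0\<close>, log-convexity gives \<open>a 2 = 0\<close>, so both second moments vanish
  and both measures sit at the origin with equal mass.\<close>

lemma cos_transform_unique:
  assumes M: "moment_measure M" and N: "moment_measure N"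
    and mom: "\<And>k. (\<integral>x. x ^ k \<partial>M) = (\<integral>x. x ^ k \<partial>N)"
    and bound: "\<And>k. (\<integral>x. x ^ (2 * k) \<partial>M) \<le> C * sqrt (a (2 * k))"
    and a: "\<And>n. 0 \<le> a n" "\<And>n. (a (Suc n))\<^sup>2 \<le> a n * a (Suc (Suc n))"
    and qa: "quasi_analytic (ultra_class (\<lambda>n. sqrt \<bar>a n\<bar>))"
  shows "(\<integral>x. cos (t * x + \<theta>) \<partial>M) = (\<integral>x. cos (t * x + \<theta>) \<partial>N)"
proof -
  interpret M: moment_measure M by (rule M)
  interpret N: moment_measure N by (rule N)
  show ?thesis
  proof (cases "a 1 > 0")
    case True
    note * = cos_transform_unique_pos[OF M N mom bound a qa True]
    show ?thesis
    proof (cases "t \<ge> 0")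
      case False
      have "(\<integral>x. cos ((- t) * x + - \<theta>) \<partial>M) = (\<integral>x. cos ((- t) * x + - \<theta>) \<partial>N)"
        using False by (intro *) auto
      moreover have "cos ((- t) * x + - \<theta>) = cos (t * x + \<theta>)" for x
        by (metis cos_minus minus_add_distrib mult_minus_left)
      ultimately show ?thesis by simp
    qed (rule *)
  next
    case False
    then have "a 1 = 0" using a(1)[of 1] by simp
    then have "(a 2)\<^sup>2 \<le> 0" using a(2)[of 1] by (simp add: numeral_2_eq_2)
    then have a2: "a 2 = 0" by simp
    have "(\<integral>x. x\<^sup>2 \<partial>M) \<le> 0" "(\<integral>x. x\<^sup>2 \<partial>N) \<le> 0"
      using bound[of 1] mom[of 2] a2 by auto
    then have "(\<integral>x. x\<^sup>2 \<partial>M) = 0" "(\<integral>x. x\<^sup>2 \<partial>N) = 0"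
      by (auto intro!: antisym integral_nonneg)
    then have ae: "AE x in M. x = 0" "AE x in N. x = 0"
      using integral_nonneg_eq_0_iff_AE[OF M.powers[of 2]] integral_nonneg_eq_0_iff_AE[OF N.powers[of 2]] by auto
    have "(\<integral>x. cos (t * x + \<theta>) \<partial>M) = (\<integral>x. cos \<theta> * x ^ 0 \<partial>M)"
      by (rule integral_cong_AE) (use ae in auto)
    moreover have "(\<integral>x. cos (t * x + \<theta>) \<partial>N) = (\<integral>x. cos \<theta> * x ^ 0 \<partial>N)"
      by (rule integral_cong_AE) (use ae in auto)
    ultimately show ?thesis using mom[of 0] by simp
  qed
qed

text \<open>The phase \<open>- pi / 2\<close> turns cosines into sines, so characteristic functions
  are determined. Levy's uniqueness theorem concerns probability measures; both measures are
  therefore divided by their common mass, the value at \<open>t = \<theta> = 0\<close>, unless it is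
  zero.\<close>

lemma finite_measure_eq_cos_transform:
  fixes M N :: "real measure"
  assumes M: "finite_measure M" "sets M = sets borel" and N: "finite_measure N" "sets N = sets borel"
    and eq: "\<And>t \<theta>. (\<integral>x. cos (t * x + \<theta>) \<partial>M) = (\<integral>x. cos (t * x + \<theta>) \<partial>N)"
  shows "M = N"
proof -
  interpret M: finite_measure M by fact
  interpret N: finite_measure N by fact
  note [measurable_cong] = M(2) N(2)
  have sp [simp]: "space M = UNIV" "space N = UNIV"
    using M(2) N(2) by (metis sets_eq_imp_space_eq space_borel)+
  define c where "c = measure M UNIV"
  have cN: "measure N UNIV = c" using eq[of 0 0] by (simp add: c_def)
  have emM: "emeasure M UNIV = ennreal c" using M.emeasure_eq_measure by (simp add: c_def)
  have emN: "emeasure N UNIV = ennreal c" using N.emeasure_eq_measure by (simp add: cN)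
  have c0: "c \<ge> 0" by (simp add: c_def)
  show ?thesis
  proof (cases "c = 0")
    case True
    show ?thesis
    proof (rule measure_eqI)
      show "emeasure M A = emeasure N A" if "A \<in> sets M" for A
        using emeasure_mono[of A UNIV M] emeasure_mono[of A UNIV N] emM emN True that M(2) N(2) by auto
    qed (simp add: M N)
  next
    case False
    with c0 have c: "c > 0" by simp
    define scale :: "real measure \<Rightarrow> real measure" where "scale K = density K (\<lambda>_. ennreal (1 / c))" for K
    have em_scale: "emeasure (scale K) A = ennreal (1 / c) * emeasure K A" if "A \<in> sets K" for K A
      unfolding scale_def using that by (subst emeasure_density_const) auto
    have inv: "ennreal (1 / c) * ennreal c = 1"
      using c by (simp add: ennreal_mult[symmetric])
    have rd: "real_distribution (scale K)" if "sets K = sets borel" "emeasure K UNIV = ennreal c" for K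
    proof -
      have "space K = UNIV" using that(1) by (metis sets_eq_imp_space_eq space_borel)
      then show ?thesis
        using that em_scale[of UNIV K] inv
        by (intro real_distribution.intro prob_spaceI real_distribution_axioms.intro) (auto simp: scale_def)
    qed
    have int: "integrable K (\<lambda>x. cos (t * x + \<theta>))" if "finite_measure K" "sets K = sets borel" for K and t \<theta> :: real
    proof -
      interpret K: finite_measure K by fact
      note [measurable_cong] = that(2)
      show ?thesis by (rule K.integrable_const_bound[where B = 1]) auto
    qed
    have ch: "char (scale K) t = complex_of_real ((1 / c) * (\<integral>x. cos (t * x + 0) \<partial>K)) + \<i> * complex_of_real ((1 / c) * (\<integral>x. cos (t * x + - pi / 2) \<partial>K))"
      if K: "finite_measure K" "sets K = sets borel" for K t
    proof -
      note [measurable_cong] = that(2)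
      have iexp: "iexp (t * x) = complex_of_real (cos (t * x + 0)) + \<i> * complex_of_real (cos (t * x + - pi / 2))" for x
      proof -
        have "cos (t * x + - pi / 2) = sin (t * x)"
          using cos_add[of "t * x" "- (pi / 2)"] by simp
        then show ?thesis by (simp add: complex_eq_iff Re_exp Im_exp)
      qed
      have "char (scale K) t = (\<integral>x. (1 / c) *\<^sub>R iexp (t * x) \<partial>K)"
        unfolding char_def scale_def
        by (subst integral_density) (use c in \<open>auto\<close>)
      also have "\<dots> = (1 / c) *\<^sub>R (\<integral>x. complex_of_real (cos (t * x + 0)) + \<i> * complex_of_real (cos (t * x + - pi / 2)) \<partial>K)"
        by (subst integral_scaleR_right) (simp_all only: iexp)
      also have "(\<integral>x. complex_of_real (cos (t * x + 0)) + \<i> * complex_of_real (cos (t * x + - pi / 2)) \<partial>K)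
         = complex_of_real (\<integral>x. cos (t * x + 0) \<partial>K) + \<i> * complex_of_real (\<integral>x. cos (t * x + - pi / 2) \<partial>K)"
        using int[OF K, of t 0] int[OF K, of t "- pi / 2"]
        by (subst Bochner_Integration.integral_add) (auto intro!: integrable_mult_right)
      finally show ?thesis by (simp add: scaleR_conv_of_real algebra_simps)
    qed
    have "scale M = scale N"
    proof (rule Levy_uniqueness)
      show "char (scale M) = char (scale N)"
        by (rule ext) (simp only: ch[OF M] ch[OF N] eq)
    qed (use rd M N emM emN in auto)
    then have *: "ennreal (1 / c) * emeasure M A = ennreal (1 / c) * emeasure N A" if "A \<in> sets borel" for A
      using em_scale[of A M] em_scale[of A N] that M(2) N(2) by simp
    have inv': "ennreal c * ennreal (1 / c) = 1" using inv by (simp add: mult.commute)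
    show ?thesis
    proof (rule measure_eqI)
      show "emeasure M A = emeasure N A" if "A \<in> sets M" for A
      proof -
        have "ennreal c * (ennreal (1 / c) * emeasure M A) = ennreal c * (ennreal (1 / c) * emeasure N A)"
          using * that M(2) by simp
        then show ?thesis by (simp add: mult.assoc[symmetric] inv')
      qed
    qed (simp add: M N)
  qed
qed

section \<open>Finite nonnegative combinations of measures on the line\<close>

definition mixture :: "'j set \<Rightarrow> ('j \<Rightarrow> real) \<Rightarrow> ('j \<Rightarrow> real measure) \<Rightarrow> real measure"
  where "mixture J c \<mu> = measure_of UNIV (sets borel) (\<lambda>A. \<Sum>j\<in>J. ennreal (c j) * emeasure (\<mu> j) A)"

context
  fixes J :: "'j set" and c :: "'j \<Rightarrow> real" and \<mu> :: "'j \<Rightarrow> real measure"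
  assumes J: "finite J" and c: "\<And>j. c j \<ge> 0" and \<mu>: "\<And>j. j \<in> J \<Longrightarrow> moment_measure (\<mu> j)"
begin

lemma sets_mixture [simp, measurable_cong]: "sets (mixture J c \<mu>) = sets borel"
  and space_mixture [simp]: "space (mixture J c \<mu>) = UNIV"
  using sets.sigma_sets_eq[of borel]
  by (simp_all add: mixture_def sets_measure_of_conv space_measure_of_conv)

lemma emeasure_mixture:
  assumes "A \<in> sets borel"
  shows "emeasure (mixture J c \<mu>) A = (\<Sum>j\<in>J. ennreal (c j) * emeasure (\<mu> j) A)"
proof (rule emeasure_measure_of[OF mixture_def])
  have sets_\<mu>: "sets (\<mu> j) = sets borel" if "j \<in> J" for j
    using \<mu>[OF that] by (rule moment_measure.sets_M)
  show "countably_additive (sets (mixture J c \<mu>)) (\<lambda>A. \<Sum>j\<in>J. ennreal (c j) * emeasure (\<mu> j) A)"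
  proof (rule countably_additiveI)
    fix A :: "nat \<Rightarrow> real set"
    assume A: "range A \<subseteq> sets (mixture J c \<mu>)" "disjoint_family A"
    have "suminf (\<lambda>i. \<Sum>j\<in>J. ennreal (c j) * emeasure (\<mu> j) (A i)) = (\<Sum>j\<in>J. suminf (\<lambda>i. ennreal (c j) * emeasure (\<mu> j) (A i)))"
      by (intro suminf_sum) auto
    also have "\<dots> = (\<Sum>j\<in>J. ennreal (c j) * emeasure (\<mu> j) (\<Union>i. A i))"
      using A sets_\<mu> by (intro sum.cong refl) (auto simp: ennreal_suminf_cmult intro!: arg_cong2[where f = times] suminf_emeasure)
    finally show "suminf (\<lambda>i. \<Sum>j\<in>J. ennreal (c j) * emeasure (\<mu> j) (A i)) = (\<Sum>j\<in>J. ennreal (c j) * emeasure (\<mu> j) (\<Union>i. A i))" .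
  qed
qed (use assms in \<open>auto simp: positive_def\<close>)

lemma nn_integral_mixture:
  assumes f: "f \<in> borel_measurable borel"
  shows "(\<integral>\<^sup>+x. f x \<partial>mixture J c \<mu>) = (\<Sum>j\<in>J. ennreal (c j) * (\<integral>\<^sup>+x. f x \<partial>\<mu> j))"
  using f
proof (induction rule: borel_measurable_induct)
  have sets_\<mu> [measurable_cong]: "sets (\<mu> j) = sets borel" if "j \<in> J" for j
    using \<mu>[OF that] by (rule moment_measure.sets_M)
  have meas: "g \<in> borel_measurable (\<mu> j) \<longleftrightarrow> g \<in> borel_measurable borel" if "j \<in> J" for j and g :: "real \<Rightarrow> ennreal"
    by (simp add: measurable_cong_sets[OF sets_\<mu>[OF that] refl])
  have meas': "g \<in> borel_measurable (mixture J c \<mu>) \<longleftrightarrow> g \<in> borel_measurable borel" for g :: "real \<Rightarrow> ennreal"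
    by (simp add: measurable_cong_sets[OF sets_mixture refl])
  { case (cong f g) then show ?case by simp
  next
    case (set A)
    then show ?case by (auto simp: emeasure_mixture sets_\<mu> intro!: sum.cong)
  next
    case (mult u k)
    then show ?case
      by (simp add: nn_integral_cmult meas' sum_distrib_left)
         (auto simp: meas nn_integral_cmult mult_ac intro!: sum.cong)
  next
    case (add u v)
    then show ?case
      by (simp add: nn_integral_add meas')
         (auto simp: meas nn_integral_add distrib_left sum.distrib[symmetric] intro!: sum.cong)
  next
    case (seq U)
    have "(\<integral>\<^sup>+x. (SUP i. U i) x \<partial>mixture J c \<mu>) = (SUP i. \<integral>\<^sup>+x. U i x \<partial>mixture J c \<mu>)"
      unfolding SUP_apply using seq by (intro nn_integral_monotone_convergence_SUP) (auto simp: meas')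
    also have "\<dots> = (SUP i. \<Sum>j\<in>J. ennreal (c j) * (\<integral>\<^sup>+x. U i x \<partial>\<mu> j))" using seq by simp
    also have "\<dots> = (\<Sum>j\<in>J. SUP i. ennreal (c j) * (\<integral>\<^sup>+x. U i x \<partial>\<mu> j))"
      using seq(3) by (intro ennreal_SUP_sum) (auto simp: incseq_def le_fun_def intro!: mult_left_mono nn_integral_mono)
    also have "\<dots> = (\<Sum>j\<in>J. ennreal (c j) * (\<integral>\<^sup>+x. (SUP i. U i) x \<partial>\<mu> j))"
      unfolding SUP_apply using seq
      by (intro sum.cong refl) (auto simp: SUP_mult_left_ennreal[symmetric] nn_integral_monotone_convergence_SUP meas)
    finally show ?case .
  }
qed

lemma integral_mixture:
  fixes f :: "real \<Rightarrow> real"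
  assumes f: "f \<in> borel_measurable borel" "\<And>j. j \<in> J \<Longrightarrow> integrable (\<mu> j) f"
  shows "integrable (mixture J c \<mu>) f"
    and "(\<integral>x. f x \<partial>mixture J c \<mu>) = (\<Sum>j\<in>J. c j * (\<integral>x. f x \<partial>\<mu> j))"
proof -
  have fin: "(\<integral>\<^sup>+x. ennreal (g x) \<partial>\<mu> j) < \<infinity>" if "j \<in> J" "\<And>x. g x \<le> \<bar>f x\<bar>" for j g
  proof -
    have "(\<integral>\<^sup>+x. ennreal (g x) \<partial>\<mu> j) \<le> (\<integral>\<^sup>+x. ennreal (norm (f x)) \<partial>\<mu> j)"
      using that by (intro nn_integral_mono) (auto intro: ennreal_leI)
    also have "\<dots> < \<infinity>" using f(2)[OF that(1)] by (simp add: integrable_iff_bounded)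
    finally show ?thesis .
  qed
  have "(\<integral>\<^sup>+x. ennreal (norm (f x)) \<partial>mixture J c \<mu>) < \<infinity>"
    using f(1) fin[of _ "\<lambda>x. norm (f x)"]
    by (subst nn_integral_mixture) (auto simp: ennreal_mult_less_top J)
  then show int: "integrable (mixture J c \<mu>) f"
    using f(1) by (simp add: integrable_iff_bounded measurable_cong_sets[OF sets_mixture refl])
  have e2r: "enn2real (\<Sum>j\<in>J. ennreal (c j) * (\<integral>\<^sup>+x. ennreal (g x) \<partial>\<mu> j))
      = (\<Sum>j\<in>J. c j * enn2real (\<integral>\<^sup>+x. ennreal (g x) \<partial>\<mu> j))" if "\<And>x. g x \<le> \<bar>f x\<bar>" for g
    using fin[OF _ that] c
    by (subst enn2real_sum) (auto simp: ennreal_mult_less_top enn2real_mult intro!: sum.cong)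
  show "(\<integral>x. f x \<partial>mixture J c \<mu>) = (\<Sum>j\<in>J. c j * (\<integral>x. f x \<partial>\<mu> j))"
    unfolding real_lebesgue_integral_def[OF int]
    using f(1)
    by (simp add: nn_integral_mixture e2r real_lebesgue_integral_def[OF f(2)] right_diff_distrib sum_subtractf)
qed

lemma moment_measure_mixture: "moment_measure (mixture J c \<mu>)"
proof -
  have "integrable (mixture J c \<mu>) (\<lambda>x. 1 :: real)"
  proof (rule integral_mixture(1))
    show "integrable (\<mu> j) (\<lambda>x. 1 :: real)" if "j \<in> J" for j
    proof -
      interpret moment_measure "\<mu> j" by (rule \<mu>[OF that])
      show ?thesis by simp
    qed
  qed simp
  then have "emeasure (mixture J c \<mu>) UNIV < \<infinity>"
    by (simp add: integrable_iff_bounded)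
  then have "finite_measure (mixture J c \<mu>)"
    by (intro finite_measureI) auto
  moreover have "integrable (mixture J c \<mu>) (\<lambda>x. x ^ k)" for k
    by (intro integral_mixture moment_measure.powers \<mu>) auto
  ultimately show ?thesis
    by (simp add: moment_measure_def moment_measure_axioms_def)
qed

end

text \<open>Linear relations between moment sequences pass to masses of Borel sets; this is what
  later makes restriction linear. Splitting \<open>c\<close> into positive and negative parts gives
  two mixtures with equal moments, and the individual growth constants add up to one for the
  mixture.\<close>

theorem signed_moment_unique:
  fixes c :: "'j \<Rightarrow> real"
  assumes J: "finite J" and \<mu>: "\<And>j. j \<in> J \<Longrightarrow> moment_measure (\<mu> j)"
    and mom: "\<And>k. (\<Sum>j\<in>J. c j * (\<integral>x. x ^ k \<partial>\<mu> j)) = 0"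
    and bound: "\<And>j. j \<in> J \<Longrightarrow> \<exists>C. \<forall>k. (\<integral>x. x ^ (2 * k) \<partial>\<mu> j) \<le> C * sqrt (a (2 * k))"
    and a: "\<And>n. 0 \<le> a n" "\<And>n. (a (Suc n))\<^sup>2 \<le> a n * a (Suc (Suc n))"
    and qa: "quasi_analytic (ultra_class (\<lambda>n. sqrt \<bar>a n\<bar>))"
    and B: "B \<in> sets borel"
  shows "(\<Sum>j\<in>J. c j * measure (\<mu> j) B) = 0"
proof -
  define cp where "cp j = max (c j) 0" for j
  define cm where "cm j = max (- c j) 0" for j
  have c_eq: "c j = cp j - cm j" for j by (simp add: cp_def cm_def)
  have cp: "cp j \<ge> 0" and cm: "cm j \<ge> 0" for j by (simp_all add: cp_def cm_def)
  note mixp = integral_mixture[OF J cp \<mu>] and mixm = integral_mixture[OF J cm \<mu>]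
  have pw: "integrable (\<mu> j) (\<lambda>x. x ^ k)" if "j \<in> J" for j k
    using \<mu>[OF that] by (rule moment_measure.powers)
  have "\<forall>j\<in>J. \<exists>C. \<forall>k. (\<integral>x. x ^ (2 * k) \<partial>\<mu> j) \<le> C * sqrt (a (2 * k))"
    using bound by blast
  then obtain C where C: "\<And>j k. j \<in> J \<Longrightarrow> (\<integral>x. x ^ (2 * k) \<partial>\<mu> j) \<le> C j * sqrt (a (2 * k))"
    by (metis bchoice)
  have "mixture J cp \<mu> = mixture J cm \<mu>"
  proof (rule finite_measure_eq_cos_transform)
    fix t \<theta> :: real
    show "(\<integral>x. cos (t * x + \<theta>) \<partial>mixture J cp \<mu>) = (\<integral>x. cos (t * x + \<theta>) \<partial>mixture J cm \<mu>)"
    proof (rule cos_transform_unique[OF _ _ _ _ a qa])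
      show "(\<integral>x. x ^ k \<partial>mixture J cp \<mu>) = (\<integral>x. x ^ k \<partial>mixture J cm \<mu>)" for k
        using mom[of k] by (simp add: mixp mixm pw c_eq left_diff_distrib sum_subtractf)
      show "(\<integral>x. x ^ (2 * k) \<partial>mixture J cp \<mu>) \<le> (\<Sum>j\<in>J. cp j * C j) * sqrt (a (2 * k))" for k
        using C cp by (simp add: mixp pw sum_distrib_right mult.assoc sum_mono mult_left_mono)
    qed (intro moment_measure_mixture J cp cm \<mu>; assumption)+
  qed (use moment_measure_mixture[OF J cp \<mu>] moment_measure_mixture[OF J cm \<mu>] in \<open>auto simp: moment_measure_def moment_measure_axioms_def\<close>)
  then have "(\<integral>x. indicator B x \<partial>mixture J cp \<mu>) = (\<integral>x. indicator B x \<partial>mixture J cm \<mu> :: real)"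
    by simp
  moreover have ind: "integrable (\<mu> j) (indicator B :: real \<Rightarrow> real)" "(\<integral>x. indicator B x \<partial>\<mu> j) = measure (\<mu> j) B" if "j \<in> J" for j
  proof -
    interpret moment_measure "\<mu> j" by (rule \<mu>[OF that])
    show "integrable (\<mu> j) (indicator B :: real \<Rightarrow> real)"
      using B by (intro integrable_real_indicator) (auto simp: sets_M emeasure_eq_measure)
    show "(\<integral>x. indicator B x \<partial>\<mu> j) = measure (\<mu> j) B" by simp
  qed
  moreover have "(\<integral>x. indicator B x \<partial>mixture J cp \<mu>) = (\<Sum>j\<in>J. cp j * (\<integral>x. indicator B x \<partial>\<mu> j))"
    by (rule mixp(2)) (use B ind(1) in auto)
  moreover have "(\<integral>x. indicator B x \<partial>mixture J cm \<mu>) = (\<Sum>j\<in>J. cm j * (\<integral>x. indicator B x \<partial>\<mu> j))"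
    by (rule mixm(2)) (use B ind(1) in auto)
  ultimately have "(\<Sum>j\<in>J. cp j * (\<integral>x. indicator B x \<partial>\<mu> j)) = (\<Sum>j\<in>J. cm j * (\<integral>x. indicator B x \<partial>\<mu> j))"
    by simp
  then have "(\<Sum>j\<in>J. cp j * measure (\<mu> j) B) = (\<Sum>j\<in>J. cm j * measure (\<mu> j) B)"
    by (simp only: ind(2) cong: sum.cong)
  then show ?thesis by (simp add: c_eq left_diff_distrib sum_subtractf)
qed

section \<open>Polynomials and positive semidefinite forms\<close>

lemma poly_mapping_induct_single [case_names zero single add]:
  fixes p :: "'a \<Rightarrow>\<^sub>0 'b::comm_monoid_add"
  assumes "P 0" "\<And>k v. P (Poly_Mapping.single k v)" "\<And>p q. P p \<Longrightarrow> P q \<Longrightarrow> P (p + q)"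
  shows "P p"
proof -
  have "p = (\<Sum>k\<in>Poly_Mapping.keys p. Poly_Mapping.single k (Poly_Mapping.lookup p k))"
    by (rule poly_mapping_eqI) (simp add: lookup_sum lookup_single when_def in_keys_iff)
  moreover have "P (\<Sum>k\<in>A. Poly_Mapping.single k (Poly_Mapping.lookup p k))" if "finite A" for A
    using that by (induction A) (auto intro: assms)
  ultimately show ?thesis by (metis finite_keys)
qed

definition cst :: "real \<Rightarrow> 'n::finite rpoly"
  where "cst c = Poly_Mapping.single 0 c"

definition var :: "'n::finite \<Rightarrow> 'n rpoly"
  where "var i = Poly_Mapping.single (Poly_Mapping.single i 1) 1"

lemma cst_add: "cst (a + b) = cst a + cst b"
  and cst_uminus: "cst (- a) = - cst a"
  and cst_mult: "cst (a * b) = cst a * cst b"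
  and cst_0 [simp]: "cst 0 = 0"
  and cst_1 [simp]: "cst 1 = 1"
  by (simp_all add: cst_def single_add single_diff single_uminus mult_single)

lemma cst_numeral [simp]: "cst (numeral k) = numeral k"
  by (simp add: cst_def)

lemma cst_eq_0: "cst c = 0 \<longleftrightarrow> c = 0"
  by (metis cst_0 cst_def lookup_single_eq)

lemma var_power: "var i ^ k = Poly_Mapping.single (Poly_Mapping.single i k) 1"
  by (induction k) (simp_all add: var_def mult_single single_add[symmetric])

lemma single_eq_cst_mult: "Poly_Mapping.single \<alpha> c = cst c * Poly_Mapping.single \<alpha> 1"
  by (simp add: cst_def mult_single)

text \<open>Suited to properties that are stable under products: continuity, boundedness on cubes,
  closeness to a point evaluation.\<close>

lemma rpoly_induct [case_names cst var add mult]: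
  fixes p :: "'n::finite rpoly"
  assumes "\<And>c. P (cst c)" "\<And>i. P (var i)"
    "\<And>p q. P p \<Longrightarrow> P q \<Longrightarrow> P (p + q)" "\<And>p q. P p \<Longrightarrow> P q \<Longrightarrow> P (p * q)"
  shows "P p"
proof (induction p rule: poly_mapping_induct_single)
  case zero
  show ?case using assms(1)[of 0] by simp
next
  case (single \<alpha> c)
  have pw: "P (var i ^ k)" for i k
    by (induction k) (use assms(1)[of 1] in \<open>auto intro: assms\<close>)
  have "P (Poly_Mapping.single \<alpha> 1)" for \<alpha> :: "'n multi_index"
  proof (induction \<alpha> rule: poly_mapping_induct_single)
    case zero
    show ?case using assms(1)[of 1] by simp
  next
    case (single i k)
    show ?case using pw[of i k] by (simp add: var_power)
  next
    case (add \<alpha> \<beta>)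
    have "Poly_Mapping.single (\<alpha> + \<beta>) (1::real) = Poly_Mapping.single \<alpha> 1 * Poly_Mapping.single \<beta> 1"
      by (simp add: mult_single)
    with add show ?case using assms(4) by metis
  qed
  then show ?case using assms(1,4) single_eq_cst_mult by metis
next
  case (add p q)
  then show ?case by (rule assms(3))
qed

section \<open>The Riesz functional and evaluation of polynomials\<close>

lemma riesz_eq:
  assumes "finite A" "Poly_Mapping.keys p \<subseteq> A"
  shows "riesz m p = (\<Sum>\<alpha>\<in>A. Poly_Mapping.lookup p \<alpha> * m \<alpha>)"
  unfolding riesz_def
  by (rule sum.mono_neutral_left) (use assms in \<open>auto simp: in_keys_iff\<close>)

lemma riesz_add: "riesz m (p + q) = riesz m p + riesz m q"
proof -
  let ?A = "Poly_Mapping.keys p \<union> Poly_Mapping.keys q"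
  have "Poly_Mapping.keys (p + q) \<subseteq> ?A" by (rule keys_add)
  then show ?thesis
    by (simp add: riesz_eq[of ?A] lookup_add distrib_right sum.distrib)
qed

lemma riesz_single: "riesz m (Poly_Mapping.single \<alpha> c) = c * m \<alpha>"
  by (simp add: riesz_eq[of "{\<alpha>}"])

lemma riesz_cst_mult: "riesz m (cst c * p) = c * riesz m p"
proof (induction p rule: poly_mapping_induct_single)
  case zero
  show ?case by (simp add: riesz_def)
next
  case (single \<alpha> v)
  show ?case by (simp add: cst_def mult_single riesz_single)
next
  case (add p q)
  then show ?case by (simp add: distrib_left riesz_add)
qed

text \<open>The monomial values at \<open>r\<close> are the moments of the unit mass at
  \<open>r\<close>, so linearity of evaluation is inherited.\<close>

lemma eval_poly_eq_riesz: "eval_poly p r = riesz (\<lambda>\<alpha>. monomial \<alpha> r) p"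
  by (simp add: eval_poly_def riesz_def)

lemma eval_poly_add [simp]: "eval_poly (p + q) r = eval_poly p r + eval_poly q r"
  by (simp add: eval_poly_eq_riesz riesz_add)

lemma monomial_add: "monomial (\<alpha> + \<beta>) r = monomial \<alpha> r * monomial \<beta> r"
  by (simp add: monomial_def lookup_add power_add prod.distrib)

lemma monomial_0 [simp]: "monomial 0 r = 1"
  by (simp add: monomial_def)

lemma monomial_single: "monomial (Poly_Mapping.single i k) r = (r $ i) ^ k"
proof -
  have "monomial (Poly_Mapping.single i k) r = (\<Prod>j\<in>UNIV. if j = i then (r $ i) ^ k else 1)"
    unfolding monomial_def by (intro prod.cong) (auto simp: lookup_single when_def)
  then show ?thesis by simp
qed

lemma eval_poly_single: "eval_poly (Poly_Mapping.single \<alpha> c) r = c * monomial \<alpha> r"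
  by (simp add: eval_poly_eq_riesz riesz_single)

lemma eval_poly_cst [simp]: "eval_poly (cst c) r = c"
  by (simp add: cst_def eval_poly_single)

lemma eval_poly_1 [simp]: "eval_poly 1 r = 1"
  using eval_poly_cst[of 1 r] by simp

lemma eval_poly_0 [simp]: "eval_poly 0 r = 0"
  using eval_poly_cst[of 0 r] by simp

lemma eval_poly_var [simp]: "eval_poly (var i) r = r $ i"
  by (simp add: var_def eval_poly_single monomial_single)

lemma eval_poly_mult [simp]: "eval_poly (p * q) r = eval_poly p r * eval_poly q r"
proof (induction p rule: poly_mapping_induct_single)
  case zero
  show ?case by simp
next
  case (single \<alpha> c)
  show ?case
  proof (induction q rule: poly_mapping_induct_single)
    case zero show ?case by simp
  next
    case (single \<beta> d)
    show ?case by (simp add: mult_single eval_poly_single monomial_add)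
  qed (simp add: distrib_left)
qed (simp add: distrib_right)

lemma eval_poly_power [simp]: "eval_poly (p ^ k) r = eval_poly p r ^ k"
  by (induction k) simp_all

lemma eval_poly_uminus [simp]: "eval_poly (- p) r = - eval_poly p r"
  using eval_poly_add[of p "- p" r] by (simp del: eval_poly_add)

lemma eval_poly_diff [simp]: "eval_poly (p - q) r = eval_poly p r - eval_poly q r"
  using eval_poly_add[of p "- q" r] by simp

lemma continuous_on_eval_poly: "continuous_on A (eval_poly p)"
proof (induction p rule: rpoly_induct)
  case (cst c)
  have "eval_poly (cst c) = (\<lambda>_. c)" by auto
  then show ?case by simp
next
  case (var i)
  have "eval_poly (var i) = (\<lambda>r. r $ i)" by auto
  then show ?case by (simp add: continuous_on_component)
next
  case (add p q)
  have "eval_poly (p + q) = (\<lambda>r. eval_poly p r + eval_poly q r)" by auto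
  then show ?case using add by (simp add: continuous_on_add)
next
  case (mult p q)
  have "eval_poly (p * q) = (\<lambda>r. eval_poly p r * eval_poly q r)" by auto
  then show ?case using mult by (simp add: continuous_on_mult)
qed

lemma borel_measurable_eval_poly [measurable]: "eval_poly p \<in> borel_measurable borel"
  by (rule borel_measurable_continuous_onI[OF continuous_on_eval_poly])

section \<open>Linear and positive semidefinite forms\<close>

definition linear_form :: "('n::finite rpoly \<Rightarrow> real) \<Rightarrow> bool"
  where "linear_form \<Lambda> \<longleftrightarrow> (\<forall>p q. \<Lambda> (p + q) = \<Lambda> p + \<Lambda> q) \<and> (\<forall>c p. \<Lambda> (cst c * p) = c * \<Lambda> p)"

lemma linear_form_add: "linear_form \<Lambda> \<Longrightarrow> \<Lambda> (p + q) = \<Lambda> p + \<Lambda> q"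
  and linear_form_cst: "linear_form \<Lambda> \<Longrightarrow> \<Lambda> (cst c * p) = c * \<Lambda> p"
  by (auto simp: linear_form_def)

lemma linear_form_uminus: "linear_form \<Lambda> \<Longrightarrow> \<Lambda> (- p) = - \<Lambda> p"
  using linear_form_cst[of \<Lambda> "-1" p] by (simp add: cst_uminus)

lemma linear_form_diff: "linear_form \<Lambda> \<Longrightarrow> \<Lambda> (p - q) = \<Lambda> p - \<Lambda> q"
  using linear_form_add[of \<Lambda> p "- q"] by (simp add: linear_form_uminus)

lemma linear_form_0: "linear_form \<Lambda> \<Longrightarrow> \<Lambda> 0 = 0"
  using linear_form_cst[of \<Lambda> 0 0] by simp

lemma linear_form_sum: "linear_form \<Lambda> \<Longrightarrow> \<Lambda> (\<Sum>j\<in>A. f j) = (\<Sum>j\<in>A. \<Lambda> (f j))"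
  by (induction A rule: infinite_finite_induct) (simp_all add: linear_form_0 linear_form_add)

lemma linear_form_riesz: "linear_form (riesz m)"
  by (simp add: linear_form_def riesz_add riesz_cst_mult)

text \<open>Positivity speaks only about a weight times a square; all values
  \<open>\<Lambda> (w * p)\<close> are recovered from such terms.\<close>

lemma linear_form_polarize:
  assumes "linear_form \<Lambda>"
  shows "\<Lambda> (w * p) = (\<Lambda> (w * (p + 1)\<^sup>2) - \<Lambda> (w * (p - 1)\<^sup>2)) / 4"
proof -
  have "w * (p + 1)\<^sup>2 - w * (p - 1)\<^sup>2 = cst 4 * (w * p)"
  proof -
    have "cst 4 = (4 :: 'a rpoly)" by (simp add: cst_def)
    then show ?thesis by (simp add: power2_eq_square algebra_simps)
  qed
  then have "\<Lambda> (w * (p + 1)\<^sup>2) - \<Lambda> (w * (p - 1)\<^sup>2) = 4 * \<Lambda> (w * p)"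
    by (metis assms linear_form_cst linear_form_diff)
  then show ?thesis by simp
qed

definition psd_form :: "('n::finite rpoly \<Rightarrow> real) \<Rightarrow> bool"
  where "psd_form \<Lambda> \<longleftrightarrow> linear_form \<Lambda> \<and> (\<forall>h. \<Lambda> (h\<^sup>2) \<ge> 0)"

lemma psd_form_linear: "psd_form \<Lambda> \<Longrightarrow> linear_form \<Lambda>"
  and psd_form_nonneg: "psd_form \<Lambda> \<Longrightarrow> \<Lambda> (h\<^sup>2) \<ge> 0"
  by (auto simp: psd_form_def)

lemma psd_form_cauchy_schwarz:
  assumes "psd_form \<Lambda>"
  shows "(\<Lambda> (p * q))\<^sup>2 \<le> \<Lambda> (p\<^sup>2) * \<Lambda> (q\<^sup>2)"
proof -
  note lin = psd_form_linear[OF assms]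
  define a b c where "a = \<Lambda> (q\<^sup>2)" and "b = \<Lambda> (p * q)" and "c = \<Lambda> (p\<^sup>2)"
  have pos: "0 \<le> a * t\<^sup>2 + 2 * b * t + c" for t
  proof -
    have "cst 2 = (2 :: 'a rpoly)" by (simp add: cst_def)
    then have "(p + cst t * q)\<^sup>2 = p\<^sup>2 + (cst 2 * (cst t * (p * q)) + cst t * (cst t * q\<^sup>2))"
      by (simp add: power2_eq_square algebra_simps)
    then have "\<Lambda> ((p + cst t * q)\<^sup>2) = c + (2 * (t * b) + t * (t * a))"
      by (simp add: linear_form_add[OF lin] linear_form_cst[OF lin] a_def b_def c_def del: cst_numeral)
    moreover have "\<Lambda> ((p + cst t * q)\<^sup>2) \<ge> 0" by (rule psd_form_nonneg[OF assms])
    ultimately show ?thesis by (simp add: power2_eq_square algebra_simps)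
  qed
  have a: "a \<ge> 0" unfolding a_def by (rule psd_form_nonneg[OF assms])
  have c: "c \<ge> 0" unfolding c_def by (rule psd_form_nonneg[OF assms])
  have "b\<^sup>2 \<le> c * a"
  proof (cases "a = 0")
    case True
    have "b = 0"
    proof (rule ccontr)
      assume "b \<noteq> 0"
      \<comment> \<open>For \<open>a = 0\<close> the quadratic is affine in \<open>t\<close>, and
        this \<open>t\<close> gives it the value \<open>- 1\<close>.\<close>
      then show False using pos[of "- (c + 1) / (2 * b)"] True by simp
    qed
    then show ?thesis using a c by simp
  next
    case False
    then have "a > 0" using a by simp
    have "0 \<le> a * (- b / a)\<^sup>2 + 2 * b * (- b / a) + c" by (rule pos)
    also have "\<dots> = c - b\<^sup>2 / a" using \<open>a > 0\<close> by (simp add: power2_eq_square field_simps)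
    finally show ?thesis using \<open>a > 0\<close> by (simp add: field_simps)
  qed
  then show ?thesis by (simp add: a_def b_def c_def)
qed

definition subst_var :: "'n::finite \<Rightarrow> real poly \<Rightarrow> 'n rpoly"
  where "subst_var i p = poly (map_poly cst p) (var i)"

lemma subst_var_mult: "subst_var i (p * q) = subst_var i p * subst_var i q"
proof -
  have "cst (sum f A) = (\<Sum>j\<in>A. cst (f j) :: 'a rpoly)" for f :: "nat \<Rightarrow> real" and A
    by (induction A rule: infinite_finite_induct) (simp_all add: cst_add)
  then have "map_poly cst (p * q) = (map_poly cst p * map_poly cst q :: 'a rpoly poly)"
    by (intro poly_eqI) (simp add: coeff_map_poly coeff_mult cst_mult)
  then show ?thesis by (simp add: subst_var_def)
qed

text \<open>The bridge to one variable: substituting \<open>var i\<close> sends univariate squares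
  to squares, so a positive weight yields a positive semidefinite moment sequence.\<close>

lemma linear_form_subst_var:
  assumes "linear_form \<Lambda>"
  shows "\<Lambda> (subst_var i p * w) = moment_functional (\<lambda>k. \<Lambda> (var i ^ k * w)) p"
proof -
  have "poly (map_poly cst p) (var i) = (\<Sum>k\<le>degree p. cst (coeff p k) * var i ^ k)"
    by (simp add: poly_altdef degree_map_poly coeff_map_poly cst_eq_0)
  then show ?thesis
    by (simp add: subst_var_def moment_functional_def sum_distrib_right linear_form_sum[OF assms] mult.assoc linear_form_cst[OF assms])
qed

section \<open>Restricting a form in one coordinate\<close>

text \<open>The localising condition of moment theory. With \<open>w = P i\<close> it is a
  hypothesis of the theorem; with \<open>w = var i - cst a\<close> it expresses, without any
  measure, that the form lives on \<open>x $ i \<ge> a\<close>.\<close>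

definition nonneg_weight :: "('n::finite rpoly \<Rightarrow> real) \<Rightarrow> 'n rpoly \<Rightarrow> bool"
  where "nonneg_weight \<Lambda> w \<longleftrightarrow> (\<forall>h. \<Lambda> (w * h\<^sup>2) \<ge> 0)"

lemma nonneg_weight_square: "psd_form \<Lambda> \<Longrightarrow> nonneg_weight \<Lambda> (h\<^sup>2)"
  unfolding nonneg_weight_def by (metis power_mult_distrib psd_form_nonneg)

lemma nonneg_weight_times_square: "nonneg_weight \<Lambda> w \<Longrightarrow> nonneg_weight \<Lambda> (w * h\<^sup>2)"
  unfolding nonneg_weight_def by (metis mult.assoc power_mult_distrib)

text \<open>If \<open>\<Lambda>\<close> is integration against a measure and
  \<open>w \<ge> 0\<close>, these are the moments of the image under coordinate \<open>i\<close> of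
  that measure with density \<open>w\<close>. Hamburger's theorem gives only existence, hence the
  choice; for tame forms \<open>signed_moment_unique\<close> shows that the masses do not depend on
  it.\<close>

definition slice_measure :: "'n::finite \<Rightarrow> ('n rpoly \<Rightarrow> real) \<Rightarrow> 'n rpoly \<Rightarrow> real measure"
  where "slice_measure i \<Lambda> w =
    (SOME \<nu>. moment_measure \<nu> \<and> (\<forall>k. (\<integral>x. x ^ k \<partial>\<nu>) = \<Lambda> (var i ^ k * w)))"

lemma slice_measure:
  assumes lin: "linear_form \<Lambda>" and w: "nonneg_weight \<Lambda> w"
  shows "moment_measure (slice_measure i \<Lambda> w)"
    and "(\<integral>x. x ^ k \<partial>slice_measure i \<Lambda> w) = \<Lambda> (var i ^ k * w)"
proof -
  have "psd_sequence (\<lambda>k. \<Lambda> (var i ^ k * w))"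
    unfolding psd_sequence_def
  proof
    fix p
    have "\<Lambda> (w * (subst_var i p)\<^sup>2) \<ge> 0" using w by (simp add: nonneg_weight_def)
    then show "0 \<le> moment_functional (\<lambda>k. \<Lambda> (var i ^ k * w)) (p\<^sup>2)"
      unfolding linear_form_subst_var[OF lin, symmetric] power2_eq_square subst_var_mult
      by (simp only: mult.commute)
  qed
  then obtain \<nu> :: "real measure" where "sets \<nu> = sets borel" "finite_measure \<nu>"
    "\<And>k. integrable \<nu> (\<lambda>x. x ^ k)" "\<And>k. (\<integral>x. x ^ k \<partial>\<nu>) = \<Lambda> (var i ^ k * w)"
    by (rule hamburger) (rule that)
  then have "\<exists>\<nu>. moment_measure \<nu> \<and> (\<forall>k. (\<integral>x. x ^ k \<partial>\<nu>) = \<Lambda> (var i ^ k * w))"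
    by (intro exI[of _ \<nu>]) (auto simp: moment_measure_def moment_measure_axioms_def)
  from someI_ex[OF this, folded slice_measure_def]
  show "moment_measure (slice_measure i \<Lambda> w)"
    "(\<integral>x. x ^ k \<partial>slice_measure i \<Lambda> w) = \<Lambda> (var i ^ k * w)" by auto
qed

text \<open>For a form \<open>\<Lambda>\<close> represented by a measure, \<open>cutoff i B \<Lambda>\<close> is represented by its restriction to
  \<open>{x. x $ i \<in> B}\<close>; the definition polarizes \<open>p = ((p + 1)\<^sup>2 - (p - 1)\<^sup>2) / 4\<close>.\<close>

definition cutoff :: "'n::finite \<Rightarrow> real set \<Rightarrow> ('n rpoly \<Rightarrow> real) \<Rightarrow> 'n rpoly \<Rightarrow> real"
  where "cutoff i B \<Lambda> p = (measure (slice_measure i \<Lambda> ((p + 1)\<^sup>2)) B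
     - measure (slice_measure i \<Lambda> ((p - 1)\<^sup>2)) B) / 4"

locale carleman_form =
  fixes L :: "'n::finite rpoly \<Rightarrow> real"
  assumes psd: "psd_form L"
    and quasi: "\<And>i. quasi_analytic (ultra_class (\<lambda>n. sqrt \<bar>L (var i ^ (2 * n))\<bar>))"
begin

text \<open>The argument is half the exponent: the sequence of the class at order \<open>n\<close>
  is the square root of \<open>even_moment i n\<close>, and index \<open>2 * k\<close> stands for
  the exponent \<open>4 * k\<close>.\<close>

definition even_moment :: "'n \<Rightarrow> nat \<Rightarrow> real"
  where "even_moment i n = L (var i ^ (2 * n))"

lemma even_moment_nonneg: "0 \<le> even_moment i n"
  using psd_form_nonneg[OF psd, of "var i ^ n"] by (simp add: even_moment_def power_mult[symmetric] mult.commute)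

lemma even_moment_log_convex: "(even_moment i (Suc n))\<^sup>2 \<le> even_moment i n * even_moment i (Suc (Suc n))"
proof -
  have "(L (var i ^ n * var i ^ (Suc (Suc n))))\<^sup>2 \<le> L ((var i ^ n)\<^sup>2) * L ((var i ^ (Suc (Suc n)))\<^sup>2)"
    by (rule psd_form_cauchy_schwarz[OF psd])
  then show ?thesis
    unfolding even_moment_def power_add[symmetric] power_mult[symmetric]
    by (simp add: mult.commute mult_2 mult_2_right)
qed

lemma quasi': "quasi_analytic (ultra_class (\<lambda>n. sqrt \<bar>even_moment i n\<bar>))"
  using quasi[of i] by (simp add: even_moment_def)

definition tame_measure :: "'n \<Rightarrow> real measure \<Rightarrow> bool"
  where "tame_measure i \<nu> \<longleftrightarrow> moment_measure \<nu> \<and>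
    (\<exists>C. \<forall>k. (\<integral>x. x ^ (2 * k) \<partial>\<nu>) \<le> C * sqrt (even_moment i (2 * k)))"

text \<open>The right-hand side always refers to the moments of the initial \<open>L\<close>, never
  to those of \<open>\<Lambda>\<close>. The bound is therefore inherited by every form dominated on
  squares, and one quasi-analytic class per coordinate serves all restrictions.\<close>

definition tame :: "('n rpoly \<Rightarrow> real) \<Rightarrow> bool"
  where "tame \<Lambda> \<longleftrightarrow> psd_form \<Lambda> \<and>
    (\<forall>i h. \<exists>C. \<forall>k. \<Lambda> (var i ^ (2 * k) * h\<^sup>2) \<le> C * sqrt (even_moment i (2 * k)))"

lemma tame_psd: "tame \<Lambda> \<Longrightarrow> psd_form \<Lambda>"
  by (simp add: tame_def)

lemma tame_linear: "tame \<Lambda> \<Longrightarrow> linear_form \<Lambda>"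
  using tame_psd psd_form_linear by blast

text \<open>Cauchy-Schwarz with \<open>var i ^ (2 * k)\<close> and \<open>h\<^sup>2\<close>:
  squaring the first gives exponent \<open>4 * k\<close>, that is index \<open>2 * k\<close> of
  \<open>even_moment\<close>. The constant depends on \<open>h\<close> but not on
  \<open>k\<close>.\<close>

lemma tame_L: "tame L"
  unfolding tame_def
proof (intro conjI psd allI)
  fix i h
  have "L (var i ^ (2 * k) * h\<^sup>2) \<le> sqrt (L ((h\<^sup>2)\<^sup>2)) * sqrt (even_moment i (2 * k))" for k
  proof -
    have "(L (var i ^ (2 * k) * h\<^sup>2))\<^sup>2 \<le> L ((var i ^ (2 * k))\<^sup>2) * L ((h\<^sup>2)\<^sup>2)"
      by (rule psd_form_cauchy_schwarz[OF psd])
    also have "L ((var i ^ (2 * k))\<^sup>2) = even_moment i (2 * k)"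
      by (simp add: even_moment_def power_mult[symmetric] mult.commute)
    finally have "L (var i ^ (2 * k) * h\<^sup>2) \<le> sqrt (even_moment i (2 * k) * L ((h\<^sup>2)\<^sup>2))"
      by (rule real_le_rsqrt)
    then show ?thesis by (simp add: real_sqrt_mult mult.commute)
  qed
  then show "\<exists>C. \<forall>k. L (var i ^ (2 * k) * h\<^sup>2) \<le> C * sqrt (even_moment i (2 * k))" by blast
qed

text \<open>In \<open>4 * w = (w + 1)\<^sup>2 - (w - 1)\<^sup>2\<close> the subtracted square has
  nonnegative value, so the bound for \<open>(w + 1)\<^sup>2\<close> serves with a quarter of its
  constant.\<close>

lemma tame_weight_bound:
  assumes t: "tame \<Lambda>" and w: "nonneg_weight \<Lambda> w"
  shows "\<exists>C. \<forall>k. \<Lambda> (var i ^ (2 * k) * w) \<le> C * sqrt (even_moment i (2 * k))"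
proof -
  obtain C where C: "\<And>k. \<Lambda> (var i ^ (2 * k) * (w + 1)\<^sup>2) \<le> C * sqrt (even_moment i (2 * k))"
    using t unfolding tame_def by blast
  have "\<Lambda> (var i ^ (2 * k) * w) \<le> C / 4 * sqrt (even_moment i (2 * k))" for k
  proof -
    have "(var i ^ k * (w - 1))\<^sup>2 = var i ^ (2 * k) * (w - 1)\<^sup>2"
      by (simp add: power_mult_distrib power_mult[symmetric] mult.commute)
    then have "\<Lambda> (var i ^ (2 * k) * (w - 1)\<^sup>2) \<ge> 0"
      using psd_form_nonneg[OF tame_psd[OF t], of "var i ^ k * (w - 1)"] by simp
    then show ?thesis
      using linear_form_polarize[OF tame_linear[OF t], of "var i ^ (2 * k)" w] C[of k] by simp
  qed
  then show ?thesis by blast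
qed

lemma tame_slice_measure:
  assumes "tame \<Lambda>" "nonneg_weight \<Lambda> w"
  shows "tame_measure i (slice_measure i \<Lambda> w)"
  unfolding tame_measure_def
  using slice_measure[OF tame_linear[OF assms(1)] assms(2)] tame_weight_bound[OF assms] by simp

lemma tame_measure_moment: "tame_measure i \<nu> \<Longrightarrow> moment_measure \<nu>"
  by (simp add: tame_measure_def)

text \<open>The transfer principle behind all algebra of cutoffs: a linear relation valid for every
  power of \<open>var i\<close> also holds after restriction to \<open>B\<close>. Linearity in the
  polynomial, additivity in the form and independence of the chosen measures are instances.\<close>

lemma cutoff_combination:
  fixes \<Lambda> :: "'j \<Rightarrow> 'n rpoly \<Rightarrow> real" and \<nu> :: "'k \<Rightarrow> real measure"
  assumes J: "finite J" and K: "finite K" and \<Lambda>: "\<And>j. j \<in> J \<Longrightarrow> tame (\<Lambda> j)"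
    and \<nu>: "\<And>l. l \<in> K \<Longrightarrow> tame_measure i (\<nu> l)" and B: "B \<in> sets borel"
    and eq: "\<And>k. (\<Sum>j\<in>J. c j * \<Lambda> j (var i ^ k * p j)) = (\<Sum>l\<in>K. d l * (\<integral>x. x ^ k \<partial>\<nu> l))"
  shows "(\<Sum>j\<in>J. c j * cutoff i B (\<Lambda> j) (p j)) = (\<Sum>l\<in>K. d l * measure (\<nu> l) B)"
proof -
  \<comment> \<open>Each \<open>p j\<close> enters through its two polarising squares, told apart by
    a Boolean; the other half of the sum type carries the given measures, with opposite sign in
    \<open>e\<close>.\<close>
  define \<kappa> where "\<kappa> = case_sum (\<lambda>(j, b). slice_measure i (\<Lambda> j) ((p j + (if b then 1 else - 1))\<^sup>2)) \<nu>"
  define e where "e = case_sum (\<lambda>(j, b). (if b then 1 else - 1) * c j / 4) (\<lambda>l. - d l)"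
  define I where "I = (J \<times> (UNIV :: bool set)) <+> K"
  have sumI: "(\<Sum>q\<in>I. e q * f (\<kappa> q)) = (\<Sum>j\<in>J. c j / 4 * f (slice_measure i (\<Lambda> j) ((p j + 1)\<^sup>2)) - c j / 4 * f (slice_measure i (\<Lambda> j) ((p j - 1)\<^sup>2))) - (\<Sum>l\<in>K. d l * f (\<nu> l))" for f
    unfolding I_def using J K
    by (simp add: sum.Plus e_def \<kappa>_def sum_negf UNIV_bool split_def sum.cartesian_product' algebra_simps)
  have tame\<kappa>: "tame_measure i (\<kappa> q)" if "q \<in> I" for q
    using that \<nu> \<Lambda> unfolding I_def \<kappa>_def
    by (auto intro!: tame_slice_measure nonneg_weight_square tame_psd)
  have "(\<Sum>q\<in>I. e q * measure (\<kappa> q) B) = 0"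
  proof (rule signed_moment_unique[OF _ _ _ _ even_moment_nonneg even_moment_log_convex quasi' B])
    show "finite I" using J K by (simp add: I_def)
    show "moment_measure (\<kappa> q)" if "q \<in> I" for q using tame\<kappa>[OF that] by (rule tame_measure_moment)
    show "\<exists>C. \<forall>k. (\<integral>x. x ^ (2 * k) \<partial>\<kappa> q) \<le> C * sqrt (even_moment i (2 * k))" if "q \<in> I" for q
      using tame\<kappa>[OF that] by (simp add: tame_measure_def)
    show "(\<Sum>q\<in>I. e q * (\<integral>x. x ^ k \<partial>\<kappa> q)) = 0" for k
    proof -
      have "(\<Sum>j\<in>J. c j / 4 * (\<integral>x. x ^ k \<partial>slice_measure i (\<Lambda> j) ((p j + 1)\<^sup>2)) - c j / 4 * (\<integral>x. x ^ k \<partial>slice_measure i (\<Lambda> j) ((p j - 1)\<^sup>2)))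
          = (\<Sum>j\<in>J. c j * \<Lambda> j (var i ^ k * p j))"
      proof (rule sum.cong)
        fix j assume j: "j \<in> J"
        note lin = tame_linear[OF \<Lambda>[OF j]] and sq = nonneg_weight_square[OF tame_psd[OF \<Lambda>[OF j]]]
        show "c j / 4 * (\<integral>x. x ^ k \<partial>slice_measure i (\<Lambda> j) ((p j + 1)\<^sup>2)) - c j / 4 * (\<integral>x. x ^ k \<partial>slice_measure i (\<Lambda> j) ((p j - 1)\<^sup>2)) = c j * \<Lambda> j (var i ^ k * p j)"
          unfolding slice_measure(2)[OF lin sq] linear_form_polarize[OF lin, of "var i ^ k" "p j"]
          by (simp add: algebra_simps)
      qed simp
      then show ?thesis
        unfolding sumI[of "\<lambda>\<kappa>. \<integral>x. x ^ k \<partial>\<kappa>"] using eq[of k] by simp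
    qed
  qed
  then have "(\<Sum>j\<in>J. c j / 4 * measure (slice_measure i (\<Lambda> j) ((p j + 1)\<^sup>2)) B - c j / 4 * measure (slice_measure i (\<Lambda> j) ((p j - 1)\<^sup>2)) B) = (\<Sum>l\<in>K. d l * measure (\<nu> l) B)"
    using sumI[of "\<lambda>\<kappa>. measure \<kappa> B"] by simp
  then show ?thesis
    by (simp add: cutoff_def algebra_simps diff_divide_distrib)
qed

text \<open>Whichever measure was chosen as slice, any tame measure with the right moments computes
  the cutoff.\<close>

lemma cutoff_eq_measure:
  assumes "tame \<Lambda>" "tame_measure i \<nu>" "B \<in> sets borel"
    and "\<And>k. \<Lambda> (var i ^ k * p) = (\<integral>x. x ^ k \<partial>\<nu>)"
  shows "cutoff i B \<Lambda> p = measure \<nu> B"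
  using cutoff_combination[of "{()}" "{()}" "\<lambda>_. \<Lambda>" i "\<lambda>_. \<nu>" B "\<lambda>_. 1" "\<lambda>_. p" "\<lambda>_. 1"] assms by simp

lemma cutoff_weight:
  assumes "tame \<Lambda>" "nonneg_weight \<Lambda> w" "B \<in> sets borel"
  shows "cutoff i B \<Lambda> w = measure (slice_measure i \<Lambda> w) B"
  by (rule cutoff_eq_measure[OF assms(1) tame_slice_measure[OF assms(1,2)] assms(3)])
     (simp add: slice_measure[OF tame_linear[OF assms(1)] assms(2)])

lemma linear_form_cutoff:
  assumes t: "tame \<Lambda>" and B: "B \<in> sets borel"
  shows "linear_form (cutoff i B \<Lambda>)"
  unfolding linear_form_def
proof (intro conjI allI)
  note lin = tame_linear[OF t]
  fix p q
  \<comment> \<open>The relation \<open>\<Lambda> (p + q) - \<Lambda> p - \<Lambda> q = 0\<close> in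
    the format of the transfer principle. Its measure side is an empty sum, so \<open>lborel\<close>
    is a mere placeholder.\<close>
  have "(\<Sum>j<3::nat. [1, -1, -1] ! j * cutoff i B \<Lambda> ([p + q, p, q] ! j)) = (\<Sum>l\<in>({}::nat set). 0 * measure lborel B)"
    by (rule cutoff_combination[where \<nu> = "\<lambda>_. lborel" and d = "\<lambda>_. 0"])
       (use t B in \<open>auto simp: numeral_3_eq_3 distrib_left linear_form_add[OF lin]\<close>)
  then show "cutoff i B \<Lambda> (p + q) = cutoff i B \<Lambda> p + cutoff i B \<Lambda> q"
    by (simp add: numeral_3_eq_3)
next
  note lin = tame_linear[OF t]
  fix c p
  have "(\<Sum>j<2::nat. [1, -c] ! j * cutoff i B \<Lambda> ([cst c * p, p] ! j)) = (\<Sum>l\<in>({}::nat set). 0 * measure lborel B)"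
    by (rule cutoff_combination[where \<nu> = "\<lambda>_. lborel" and d = "\<lambda>_. 0"])
       (use t B in \<open>auto simp: numeral_2_eq_2 mult.left_commute[of _ "cst c"] linear_form_cst[OF lin]\<close>)
  then show "cutoff i B \<Lambda> (cst c * p) = c * cutoff i B \<Lambda> p"
    by (simp add: numeral_2_eq_2)
qed

lemma cutoff_form_add:
  assumes t: "tame \<Lambda>" "tame \<Lambda>'" "tame (\<lambda>p. \<Lambda> p + \<Lambda>' p)" and B: "B \<in> sets borel"
  shows "cutoff i B (\<lambda>p. \<Lambda> p + \<Lambda>' p) p = cutoff i B \<Lambda> p + cutoff i B \<Lambda>' p"
proof -
  have "(\<Sum>j<3::nat. [1, -1, -1] ! j * cutoff i B ([(\<lambda>p. \<Lambda> p + \<Lambda>' p), \<Lambda>, \<Lambda>'] ! j) p) = (\<Sum>l\<in>({}::nat set). 0 * measure lborel B)"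
    by (rule cutoff_combination[where \<nu> = "\<lambda>_. lborel" and d = "\<lambda>_. 0"])
       (use t B in \<open>auto simp: numeral_3_eq_3 less_Suc_eq\<close>)
  then show ?thesis by (simp add: numeral_3_eq_3)
qed

text \<open>Although \<open>cutoff\<close> is defined through squares, uniqueness identifies its
  value at \<open>w * h\<^sup>2\<close> with a mass of the slice measure of that very weight. In
  this way the inequalities for the \<open>P i\<close> survive restriction.\<close>

lemma cutoff_weight_nonneg:
  assumes "tame \<Lambda>" "nonneg_weight \<Lambda> w" "B \<in> sets borel"
  shows "nonneg_weight (cutoff i B \<Lambda>) w"
  unfolding nonneg_weight_def
  using cutoff_weight[OF assms(1) nonneg_weight_times_square[OF assms(2)] assms(3)] by simp

lemma cutoff_weight_le:
  assumes "tame \<Lambda>" "nonneg_weight \<Lambda> w" "B \<in> sets borel"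
  shows "cutoff i B \<Lambda> w \<le> \<Lambda> w"
proof -
  interpret moment_measure "slice_measure i \<Lambda> w"
    by (rule slice_measure[OF tame_linear[OF assms(1)] assms(2)])
  have "measure (slice_measure i \<Lambda> w) B \<le> measure (slice_measure i \<Lambda> w) UNIV"
    using assms(3) sets_M by (intro finite_measure_mono) auto
  also have "\<dots> = (\<integral>x. x ^ 0 \<partial>slice_measure i \<Lambda> w)" by simp
  also have "\<dots> = \<Lambda> w" using slice_measure(2)[OF tame_linear[OF assms(1)] assms(2), where k = 0 and i = i] by simp
  finally show ?thesis by (simp add: cutoff_weight[OF assms])
qed

lemma psd_form_cutoff:
  assumes "tame \<Lambda>" "B \<in> sets borel"
  shows "psd_form (cutoff i B \<Lambda>)"
  unfolding psd_form_def
  using linear_form_cutoff[OF assms] cutoff_weight[OF assms(1) nonneg_weight_square[OF tame_psd[OF assms(1)]] assms(2)]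
  by simp

text \<open>Domination on squares is enough because \<open>var i ^ (2 * k) * h\<^sup>2\<close> is
  itself a square. Since restriction only lowers the values on squares, it can be iterated over the
  coordinates.\<close>

lemma tame_mono:
  assumes "tame \<Lambda>" "psd_form \<Lambda>'" "\<And>h. \<Lambda>' (h\<^sup>2) \<le> \<Lambda> (h\<^sup>2)"
  shows "tame \<Lambda>'"
  unfolding tame_def
proof (intro conjI assms(2) allI)
  fix i h
  obtain C where C: "\<And>k. \<Lambda> (var i ^ (2 * k) * h\<^sup>2) \<le> C * sqrt (even_moment i (2 * k))"
    using assms(1) unfolding tame_def by blast
  have "\<Lambda>' (var i ^ (2 * k) * h\<^sup>2) \<le> C * sqrt (even_moment i (2 * k))" for k
  proof -
    have "(var i ^ k * h)\<^sup>2 = var i ^ (2 * k) * h\<^sup>2"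
      by (simp add: power_mult_distrib power_mult[symmetric] mult.commute)
    then show ?thesis using assms(3)[of "var i ^ k * h"] C[of k] by simp
  qed
  then show "\<exists>C. \<forall>k. \<Lambda>' (var i ^ (2 * k) * h\<^sup>2) \<le> C * sqrt (even_moment i (2 * k))" by blast
qed

lemma cutoff_square_le: "tame \<Lambda> \<Longrightarrow> B \<in> sets borel \<Longrightarrow> cutoff i B \<Lambda> (h\<^sup>2) \<le> \<Lambda> (h\<^sup>2)"
  by (intro cutoff_weight_le nonneg_weight_square tame_psd)

lemma tame_cutoff: "tame \<Lambda> \<Longrightarrow> B \<in> sets borel \<Longrightarrow> tame (cutoff i B \<Lambda>)"
  by (rule tame_mono[OF _ psd_form_cutoff cutoff_square_le])

lemma cutoff_Un:
  assumes t: "tame \<Lambda>" and B: "B \<in> sets borel" "C \<in> sets borel" "B \<inter> C = {}"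
  shows "cutoff i (B \<union> C) \<Lambda> p = cutoff i B \<Lambda> p + cutoff i C \<Lambda> p"
proof -
  have "measure (slice_measure i \<Lambda> (h\<^sup>2)) (B \<union> C) = measure (slice_measure i \<Lambda> (h\<^sup>2)) B + measure (slice_measure i \<Lambda> (h\<^sup>2)) C" for h
  proof -
    interpret moment_measure "slice_measure i \<Lambda> (h\<^sup>2)"
      by (rule slice_measure[OF tame_linear[OF t] nonneg_weight_square[OF tame_psd[OF t]]])
    show ?thesis using B sets_M by (intro finite_measure_Union) auto
  qed
  then show ?thesis by (simp add: cutoff_def add_divide_distrib diff_divide_distrib)
qed

lemma cutoff_UNIV:
  assumes t: "tame \<Lambda>"
  shows "cutoff i UNIV \<Lambda> = \<Lambda>"
proof
  fix p
  have "measure (slice_measure i \<Lambda> (h\<^sup>2)) UNIV = \<Lambda> (h\<^sup>2)" for h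
  proof -
    interpret moment_measure "slice_measure i \<Lambda> (h\<^sup>2)"
      by (rule slice_measure[OF tame_linear[OF t] nonneg_weight_square[OF tame_psd[OF t]]])
    show ?thesis
      using slice_measure(2)[OF tame_linear[OF t] nonneg_weight_square[OF tame_psd[OF t], of h], where k = 0 and i = i] by simp
  qed
  then show "cutoff i UNIV \<Lambda> p = \<Lambda> p"
    using linear_form_polarize[OF tame_linear[OF t], of 1 p] by (simp add: cutoff_def)
qed

text \<open>The slice measure of \<open>h\<^sup>2\<close> with density
  \<open>(x + c)\<^sup>2\<close> has the moments of the weight
  \<open>(var i + cst c)\<^sup>2 * h\<^sup>2\<close> and is tame, so it computes this cutoff. A
  square is used as density to stay within measures.\<close>

lemma cutoff_shifted_square:
  assumes t: "tame \<Lambda>" and B: "B \<in> sets borel"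
  shows "cutoff i B \<Lambda> ((var i + cst c)\<^sup>2 * h\<^sup>2) = (\<integral>x. indicator B x * (x + c)\<^sup>2 \<partial>slice_measure i \<Lambda> (h\<^sup>2))"
proof -
  note lin = tame_linear[OF t] and sq = nonneg_weight_square[OF tame_psd[OF t]]
  define M where "M = slice_measure i \<Lambda> (h\<^sup>2)"
  interpret M: moment_measure M unfolding M_def by (rule slice_measure[OF lin sq])
  note [measurable_cong] = M.sets_M
  have expand: "x ^ k * (x + c)\<^sup>2 = x ^ (k + 2) + 2 * c * x ^ (k + 1) + c\<^sup>2 * x ^ k" for x k
    by (simp add: power2_eq_square algebra_simps)
  have int: "integrable M (\<lambda>x. x ^ k * (x + c)\<^sup>2)" for k
    unfolding expand by (intro Bochner_Integration.integrable_add integrable_mult_right M.powers)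
  have mom: "(\<integral>x. x ^ k * (x + c)\<^sup>2 \<partial>M) = \<Lambda> (var i ^ k * ((var i + cst c)\<^sup>2 * h\<^sup>2))" for k
  proof -
    have "(\<integral>x. x ^ k * (x + c)\<^sup>2 \<partial>M) = \<Lambda> (var i ^ (k + 2) * h\<^sup>2) + 2 * c * \<Lambda> (var i ^ (k + 1) * h\<^sup>2) + c\<^sup>2 * \<Lambda> (var i ^ k * h\<^sup>2)"
      unfolding expand using M.powers[of k] M.powers[of "k + 1"] M.powers[of "k + 2"]
      by (simp add: M_def slice_measure(2)[OF lin sq] del: power_Suc)
    also have "\<dots> = \<Lambda> (var i ^ (k + 2) * h\<^sup>2 + cst (2 * c) * (var i ^ (k + 1) * h\<^sup>2) + cst (c\<^sup>2) * (var i ^ k * h\<^sup>2))"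
      by (simp only: linear_form_add[OF lin] linear_form_cst[OF lin])
    also have "var i ^ (k + 2) * h\<^sup>2 + cst (2 * c) * (var i ^ (k + 1) * h\<^sup>2) + cst (c\<^sup>2) * (var i ^ k * h\<^sup>2) = var i ^ k * ((var i + cst c)\<^sup>2 * h\<^sup>2)"
      by (simp add: power2_eq_square cst_mult algebra_simps)
    finally show ?thesis .
  qed
  define \<nu> where "\<nu> = density M (\<lambda>x. ennreal ((x + c)\<^sup>2))"
  have int\<nu>: "(\<integral>x. f x \<partial>\<nu>) = (\<integral>x. (x + c)\<^sup>2 * f x \<partial>M)" if "f \<in> borel_measurable borel" for f :: "real \<Rightarrow> real"
    unfolding \<nu>_def using that by (subst integral_density) auto
  have "integrable \<nu> (\<lambda>x. x ^ k)" for k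
    unfolding \<nu>_def using int[of k] by (subst integrable_density) (auto simp: mult.commute)
  moreover have "sets \<nu> = sets borel" by (simp add: \<nu>_def M.sets_M)
  moreover have "emeasure \<nu> (space \<nu>) \<noteq> \<infinity>"
  proof -
    have "emeasure \<nu> (space \<nu>) = (\<integral>\<^sup>+x. ennreal ((x + c)\<^sup>2) \<partial>M)"
      by (simp add: \<nu>_def emeasure_density)
    also have "\<dots> = ennreal (\<integral>x. (x + c)\<^sup>2 \<partial>M)"
      using int[of 0] by (intro nn_integral_eq_integral) auto
    finally show ?thesis by simp
  qed
  ultimately have mm\<nu>: "moment_measure \<nu>"
    by (simp add: moment_measure_def moment_measure_axioms_def finite_measureI)
  have mom\<nu>: "\<Lambda> (var i ^ k * ((var i + cst c)\<^sup>2 * h\<^sup>2)) = (\<integral>x. x ^ k \<partial>\<nu>)" for k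
    unfolding mom[symmetric] by (subst int\<nu>) (auto simp: mult.commute)
  have w: "nonneg_weight \<Lambda> ((var i + cst c)\<^sup>2 * h\<^sup>2)"
    by (intro nonneg_weight_times_square sq)
  have "tame_measure i \<nu>"
    unfolding tame_measure_def using mm\<nu> tame_weight_bound[OF t w, of i] by (simp add: mom\<nu>)
  from cutoff_eq_measure[OF t this B mom\<nu>]
  have "cutoff i B \<Lambda> ((var i + cst c)\<^sup>2 * h\<^sup>2) = measure \<nu> B" .
  also have "\<dots> = (\<integral>x. indicator B x \<partial>\<nu>)"
    using moment_measure.space_M[OF mm\<nu>] by simp
  also have "\<dots> = (\<integral>x. indicator B x * (x + c)\<^sup>2 \<partial>M)"
    using B by (subst int\<nu>) (auto simp: mult.commute)
  finally show ?thesis by (simp add: M_def)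
qed

lemma slice_square:
  assumes "tame \<Lambda>"
  shows "moment_measure (slice_measure i \<Lambda> (h\<^sup>2))"
  by (rule slice_measure[OF tame_linear[OF assms] nonneg_weight_square[OF tame_psd[OF assms]]])

lemma cutoff_square: "tame \<Lambda> \<Longrightarrow> B \<in> sets borel \<Longrightarrow> cutoff i B \<Lambda> (h\<^sup>2) = measure (slice_measure i \<Lambda> (h\<^sup>2)) B"
  by (intro cutoff_weight nonneg_weight_square tame_psd)

lemma integrable_slice:
  assumes "tame \<Lambda>" "B \<in> sets borel"
  shows "integrable (slice_measure i \<Lambda> (h\<^sup>2)) (\<lambda>x. indicator B x * x ^ k)"
proof -
  interpret moment_measure "slice_measure i \<Lambda> (h\<^sup>2)" by (rule slice_square[OF assms(1)])
  show ?thesis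
    using assms(2) sets_M by (intro integrable_real_mult_indicator[where f = "\<lambda>x. x ^ k", simplified mult.commute] powers) auto
qed

lemma cutoff_var:
  assumes t: "tame \<Lambda>" and B: "B \<in> sets borel"
  shows "cutoff i B \<Lambda> (var i * h\<^sup>2) = (\<integral>x. indicator B x * x \<partial>slice_measure i \<Lambda> (h\<^sup>2))"
    and "cutoff i B \<Lambda> ((var i)\<^sup>2 * h\<^sup>2) = (\<integral>x. indicator B x * x\<^sup>2 \<partial>slice_measure i \<Lambda> (h\<^sup>2))"
    and "cutoff i B \<Lambda> (h\<^sup>2) = (\<integral>x. indicator B x \<partial>slice_measure i \<Lambda> (h\<^sup>2))"
proof -
  note lin = linear_form_cutoff[OF t B, of i]
  interpret M: moment_measure "slice_measure i \<Lambda> (h\<^sup>2)" by (rule slice_square[OF t])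
  note int = integrable_slice[OF t B, of i h]
  show sq: "cutoff i B \<Lambda> ((var i)\<^sup>2 * h\<^sup>2) = (\<integral>x. indicator B x * x\<^sup>2 \<partial>slice_measure i \<Lambda> (h\<^sup>2))"
    using cutoff_shifted_square[OF t B, of i 0 h] by simp
  show one: "cutoff i B \<Lambda> (h\<^sup>2) = (\<integral>x. indicator B x \<partial>slice_measure i \<Lambda> (h\<^sup>2))"
    by (simp add: cutoff_square[OF t B])
  \<comment> \<open>The first power of \<open>var i\<close> is not a square; it is extracted from
    the shifts \<open>c = 0\<close> and \<open>c = 1\<close>.\<close>
  have "(var i + cst 1)\<^sup>2 * h\<^sup>2 = (var i)\<^sup>2 * h\<^sup>2 + (cst 2 * (var i * h\<^sup>2) + h\<^sup>2)"
    by (simp add: power2_eq_square algebra_simps)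
  then have "cutoff i B \<Lambda> ((var i + cst 1)\<^sup>2 * h\<^sup>2)
      = cutoff i B \<Lambda> ((var i)\<^sup>2 * h\<^sup>2) + (2 * cutoff i B \<Lambda> (var i * h\<^sup>2) + cutoff i B \<Lambda> (h\<^sup>2))"
    by (simp only: linear_form_add[OF lin] linear_form_cst[OF lin])
  moreover have "(\<integral>x. indicator B x * (x + 1)\<^sup>2 \<partial>slice_measure i \<Lambda> (h\<^sup>2))
      = (\<integral>x. indicator B x * x\<^sup>2 \<partial>slice_measure i \<Lambda> (h\<^sup>2)) + (2 * (\<integral>x. indicator B x * x \<partial>slice_measure i \<Lambda> (h\<^sup>2)) + (\<integral>x. indicator B x \<partial>slice_measure i \<Lambda> (h\<^sup>2)))"
  proof -
    have "indicator B x * (x + 1)\<^sup>2 = indicator B x * x ^ 2 + (2 * (indicator B x * x ^ 1) + indicator B x * x ^ 0)" for x :: real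
      by (simp add: power2_eq_square algebra_simps)
    then have "(\<integral>x. indicator B x * (x + 1)\<^sup>2 \<partial>slice_measure i \<Lambda> (h\<^sup>2)) = (\<integral>x. indicator B x * x ^ 2 + (2 * (indicator B x * x ^ 1) + indicator B x * x ^ 0) \<partial>slice_measure i \<Lambda> (h\<^sup>2))"
      by presburger
    also have "\<dots> = (\<integral>x. indicator B x * x ^ 2 \<partial>slice_measure i \<Lambda> (h\<^sup>2)) + (2 * (\<integral>x. indicator B x * x ^ 1 \<partial>slice_measure i \<Lambda> (h\<^sup>2)) + (\<integral>x. indicator B x * x ^ 0 \<partial>slice_measure i \<Lambda> (h\<^sup>2)))"
      using int by (simp only: Bochner_Integration.integral_add Bochner_Integration.integrable_add integral_mult_right_zero integrable_mult_right)
    finally show ?thesis by simp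
  qed
  ultimately show "cutoff i B \<Lambda> (var i * h\<^sup>2) = (\<integral>x. indicator B x * x \<partial>slice_measure i \<Lambda> (h\<^sup>2))"
    using cutoff_shifted_square[OF t B, of i 1 h] sq one by simp
qed

text \<open>A support statement in algebraic form, available before a measure on the whole space
  exists: on \<open>B\<close> the inequality \<open>a \<le> x\<close> is integrated against the
  slice measure of \<open>h\<^sup>2\<close>.\<close>

lemma cutoff_lower:
  assumes t: "tame \<Lambda>" and B: "B \<in> sets borel" "B \<subseteq> {a..}"
  shows "nonneg_weight (cutoff i B \<Lambda>) (var i - cst a)"
  unfolding nonneg_weight_def
proof
  fix h
  note lin = linear_form_cutoff[OF t B(1), of i]
  have "a * (\<integral>x. indicator B x \<partial>slice_measure i \<Lambda> (h\<^sup>2)) = (\<integral>x. a * indicator B x \<partial>slice_measure i \<Lambda> (h\<^sup>2))"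
    by simp
  also have "\<dots> \<le> (\<integral>x. indicator B x * x \<partial>slice_measure i \<Lambda> (h\<^sup>2))"
    using integrable_slice[OF t B(1), of i h 0] integrable_slice[OF t B(1), of i h 1] B(2)
    by (intro integral_mono) (auto simp: indicator_def)
  finally have "a * cutoff i B \<Lambda> (h\<^sup>2) \<le> cutoff i B \<Lambda> (var i * h\<^sup>2)"
    by (simp only: cutoff_var[OF t B(1)])
  then show "0 \<le> cutoff i B \<Lambda> ((var i - cst a) * h\<^sup>2)"
    by (simp add: left_diff_distrib linear_form_diff[OF lin] linear_form_cst[OF lin])
qed

lemma cutoff_upper:
  assumes t: "tame \<Lambda>" and B: "B \<in> sets borel" "B \<subseteq> {..b}"
  shows "nonneg_weight (cutoff i B \<Lambda>) (cst b - var i)"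
  unfolding nonneg_weight_def
proof
  fix h
  note lin = linear_form_cutoff[OF t B(1), of i]
  have "(\<integral>x. indicator B x * x \<partial>slice_measure i \<Lambda> (h\<^sup>2)) \<le> (\<integral>x. b * indicator B x \<partial>slice_measure i \<Lambda> (h\<^sup>2))"
    using integrable_slice[OF t B(1), of i h 0] integrable_slice[OF t B(1), of i h 1] B(2)
    by (intro integral_mono) (auto simp: indicator_def)
  also have "\<dots> = b * (\<integral>x. indicator B x \<partial>slice_measure i \<Lambda> (h\<^sup>2))"
    by simp
  finally have "cutoff i B \<Lambda> (var i * h\<^sup>2) \<le> b * cutoff i B \<Lambda> (h\<^sup>2)"
    by (simp only: cutoff_var[OF t B(1)])
  then show "0 \<le> cutoff i B \<Lambda> ((cst b - var i) * h\<^sup>2)"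
    by (simp add: left_diff_distrib linear_form_diff[OF lin] linear_form_cst[OF lin])
qed

text \<open>Chebyshev's inequality for a form; it controls what is lost by restricting to a bounded
  interval.\<close>

lemma cutoff_chebyshev:
  assumes t: "tame \<Lambda>" and B: "B \<in> sets borel" "\<And>x. x \<in> B \<Longrightarrow> R \<le> \<bar>x\<bar>" and R: "R \<ge> 0"
  shows "R\<^sup>2 * cutoff i B \<Lambda> (h\<^sup>2) \<le> \<Lambda> ((var i)\<^sup>2 * h\<^sup>2)"
proof -
  have "R\<^sup>2 * cutoff i B \<Lambda> (h\<^sup>2) = (\<integral>x. R\<^sup>2 * indicator B x \<partial>slice_measure i \<Lambda> (h\<^sup>2))"
    using cutoff_var(3)[OF t B(1)] by simp
  also have "\<dots> \<le> (\<integral>x. indicator B x * x\<^sup>2 \<partial>slice_measure i \<Lambda> (h\<^sup>2))"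
    using integrable_slice[OF t B(1), of i h 0] integrable_slice[OF t B(1), of i h 2] B(2) R
    by (intro integral_mono) (auto simp: indicator_def intro!: abs_le_square_iff[THEN iffD1])
  also have "\<dots> = cutoff i B \<Lambda> ((var i)\<^sup>2 * h\<^sup>2)" by (rule cutoff_var(2)[OF t B(1), symmetric])
  also have "\<dots> \<le> \<Lambda> ((var i)\<^sup>2 * h\<^sup>2)"
    by (intro cutoff_weight_le t B(1) nonneg_weight_times_square nonneg_weight_square tame_psd)
  finally show ?thesis .
qed

section \<open>Iterated restriction in several coordinates\<close>

fun cutoffs :: "'n list \<Rightarrow> ('n \<Rightarrow> real set) \<Rightarrow> ('n rpoly \<Rightarrow> real) \<Rightarrow> 'n rpoly \<Rightarrow> real" where
  "cutoffs [] B \<Lambda> = \<Lambda>"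
| "cutoffs (i # is) B \<Lambda> = cutoffs is B (cutoff i (B i) \<Lambda>)"

lemma cutoffs_cong: "(\<And>i. i \<in> set is \<Longrightarrow> B i = C i) \<Longrightarrow> cutoffs is B \<Lambda> = cutoffs is C \<Lambda>"
  by (induction "is" arbitrary: \<Lambda>) auto

lemma tame_cutoffs: "(\<And>i. B i \<in> sets borel) \<Longrightarrow> tame \<Lambda> \<Longrightarrow> tame (cutoffs is B \<Lambda>)"
  by (induction "is" arbitrary: \<Lambda>) (auto intro: tame_cutoff)

lemma cutoffs_weight_nonneg:
  "(\<And>i. B i \<in> sets borel) \<Longrightarrow> tame \<Lambda> \<Longrightarrow> nonneg_weight \<Lambda> w \<Longrightarrow> nonneg_weight (cutoffs is B \<Lambda>) w"
  by (induction "is" arbitrary: \<Lambda>) (auto intro: tame_cutoff cutoff_weight_nonneg)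

lemma cutoffs_square_le:
  assumes B: "\<And>i. B i \<in> sets borel"
  shows "tame \<Lambda> \<Longrightarrow> cutoffs is B \<Lambda> (h\<^sup>2) \<le> \<Lambda> (h\<^sup>2)"
proof (induction "is" arbitrary: \<Lambda>)
  case (Cons i "is")
  have "cutoffs is B (cutoff i (B i) \<Lambda>) (h\<^sup>2) \<le> cutoff i (B i) \<Lambda> (h\<^sup>2)"
    by (intro Cons tame_cutoff B)
  also have "\<dots> \<le> \<Lambda> (h\<^sup>2)" by (intro cutoff_square_le Cons B)
  finally show ?case by simp
qed simp

lemma tame_add:
  assumes t: "tame \<Lambda>" "tame \<Lambda>'"
  shows "tame (\<lambda>p. \<Lambda> p + \<Lambda>' p)"
  unfolding tame_def psd_form_def linear_form_def
proof (intro conjI allI)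
  fix i h
  obtain C D where "\<And>k. \<Lambda> (var i ^ (2 * k) * h\<^sup>2) \<le> C * sqrt (even_moment i (2 * k))"
    "\<And>k. \<Lambda>' (var i ^ (2 * k) * h\<^sup>2) \<le> D * sqrt (even_moment i (2 * k))"
    using t unfolding tame_def by blast
  then have "\<Lambda> (var i ^ (2 * k) * h\<^sup>2) + \<Lambda>' (var i ^ (2 * k) * h\<^sup>2) \<le> (C + D) * sqrt (even_moment i (2 * k))" for k
    by (simp add: distrib_right add_mono)
  then show "\<exists>C. \<forall>k. \<Lambda> (var i ^ (2 * k) * h\<^sup>2) + \<Lambda>' (var i ^ (2 * k) * h\<^sup>2) \<le> C * sqrt (even_moment i (2 * k))"
    by blast
qed (use t in \<open>auto simp: linear_form_add[OF tame_linear[OF t(1)]] linear_form_add[OF tame_linear[OF t(2)]]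
      linear_form_cst[OF tame_linear[OF t(1)]] linear_form_cst[OF tame_linear[OF t(2)]] distrib_left
      intro!: add_nonneg_nonneg psd_form_nonneg[OF tame_psd[OF t(1)]] psd_form_nonneg[OF tame_psd[OF t(2)]]\<close>)

lemma cutoffs_form_add:
  assumes B: "\<And>i. B i \<in> sets borel"
  shows "tame \<Lambda> \<Longrightarrow> tame \<Lambda>' \<Longrightarrow> cutoffs is B (\<lambda>p. \<Lambda> p + \<Lambda>' p) = (\<lambda>p. cutoffs is B \<Lambda> p + cutoffs is B \<Lambda>' p)"
proof (induction "is" arbitrary: \<Lambda> \<Lambda>')
  case (Cons i "is")
  have "cutoff i (B i) (\<lambda>p. \<Lambda> p + \<Lambda>' p) = (\<lambda>p. cutoff i (B i) \<Lambda> p + cutoff i (B i) \<Lambda>' p)"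
    by (rule ext, rule cutoff_form_add) (intro Cons.prems tame_add B)+
  then show ?case by (simp add: Cons tame_cutoff B)
qed simp

text \<open>Restrictions in different coordinates are never interchanged. The splitting at
  \<open>j\<close> is pushed through the later coordinates, where the iterated cutoff is additive in
  the form.\<close>

lemma cutoffs_Un:
  assumes B: "\<And>i. B i \<in> sets borel" and CD: "C \<in> sets borel" "D \<in> sets borel" "C \<inter> D = {}" "B j = C \<union> D"
  shows "tame \<Lambda> \<Longrightarrow> distinct is \<Longrightarrow> j \<in> set is \<Longrightarrow>
    cutoffs is B \<Lambda> p = cutoffs is (B(j := C)) \<Lambda> p + cutoffs is (B(j := D)) \<Lambda> p"
proof (induction "is" arbitrary: \<Lambda>)
  case (Cons i "is")
  show ?case
  proof (cases "i = j")
    case True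
    have "cutoff j (C \<union> D) \<Lambda> = (\<lambda>p. cutoff j C \<Lambda> p + cutoff j D \<Lambda> p)"
      using cutoff_Un[OF Cons.prems(1) CD(1-3)] by auto
    moreover have "cutoffs is (B(j := E)) \<Lambda>' = cutoffs is B \<Lambda>'" for E \<Lambda>'
      using Cons.prems(2) True by (intro cutoffs_cong) auto
    ultimately show ?thesis
      unfolding True cutoffs.simps fun_upd_same CD(4)
      by (simp only: cutoffs_form_add[OF B] tame_cutoff Cons.prems CD)
  next
    case False
    then show ?thesis using Cons by (simp add: tame_cutoff B)
  qed
qed simp

lemma cutoffs_UNIV:
  "tame \<Lambda> \<Longrightarrow> (\<And>i. i \<in> set is \<Longrightarrow> B i = UNIV) \<Longrightarrow> cutoffs is B \<Lambda> = \<Lambda>"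
  by (induction "is" arbitrary: \<Lambda>) (auto simp: cutoff_UNIV)

lemma cutoffs_one:
  assumes "B j \<in> sets borel"
  shows "tame \<Lambda> \<Longrightarrow> distinct is \<Longrightarrow> j \<in> set is \<Longrightarrow> (\<And>i. i \<in> set is \<Longrightarrow> i \<noteq> j \<Longrightarrow> B i = UNIV) \<Longrightarrow>
    cutoffs is B \<Lambda> = cutoff j (B j) \<Lambda>"
proof (induction "is" arbitrary: \<Lambda>)
  case (Cons i "is")
  show ?case
  proof (cases "i = j")
    case True
    then show ?thesis using Cons.prems assms by (auto intro!: cutoffs_UNIV tame_cutoff)
  next
    case False
    then show ?thesis using Cons by (simp add: cutoff_UNIV)
  qed
qed simp

lemma cutoffs_lower:
  assumes B: "\<And>i. B i \<in> sets borel" and "B j \<subseteq> {a..}"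
  shows "tame \<Lambda> \<Longrightarrow> j \<in> set is \<Longrightarrow> nonneg_weight (cutoffs is B \<Lambda>) (var j - cst a)"
proof (induction "is" arbitrary: \<Lambda>)
  case (Cons i "is")
  show ?case
  proof (cases "i = j")
    case True
    then show ?thesis using assms Cons.prems by (auto intro!: cutoffs_weight_nonneg cutoff_lower tame_cutoff)
  next
    case False
    then show ?thesis using Cons by (simp add: tame_cutoff B)
  qed
qed simp

lemma cutoffs_upper:
  assumes B: "\<And>i. B i \<in> sets borel" and "B j \<subseteq> {..b}"
  shows "tame \<Lambda> \<Longrightarrow> j \<in> set is \<Longrightarrow> nonneg_weight (cutoffs is B \<Lambda>) (cst b - var j)"
proof (induction "is" arbitrary: \<Lambda>)
  case (Cons i "is")
  show ?case
  proof (cases "i = j")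
    case True
    then show ?thesis using assms Cons.prems by (auto intro!: cutoffs_weight_nonneg cutoff_upper tame_cutoff)
  next
    case False
    then show ?thesis using Cons by (simp add: tame_cutoff B)
  qed
qed simp

text \<open>Each coordinate loses at most its Chebyshev bound, and restriction does not increase the
  second moments of the coordinates still to come, so the losses add up to a bound in terms of the
  original form.\<close>

lemma cutoffs_exhaust:
  assumes R: "R > 0"
  shows "tame \<Lambda> \<Longrightarrow> \<Lambda> (h\<^sup>2) - cutoffs is (\<lambda>_. {-R<..R}) \<Lambda> (h\<^sup>2) \<le> (\<Sum>i\<leftarrow>is. \<Lambda> ((var i)\<^sup>2 * h\<^sup>2)) / R\<^sup>2"
proof (induction "is" arbitrary: \<Lambda>)
  case (Cons i "is")
  define I where "I = {-R<..R}"
  have I: "I \<in> sets borel" "- I \<in> sets borel" by (auto simp: I_def)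
  define \<Gamma> where "\<Gamma> = cutoff i I \<Lambda>"
  have t\<Gamma>: "tame \<Gamma>" unfolding \<Gamma>_def by (intro tame_cutoff Cons.prems I)
  have "\<Lambda> (h\<^sup>2) = \<Gamma> (h\<^sup>2) + cutoff i (- I) \<Lambda> (h\<^sup>2)"
    unfolding \<Gamma>_def using cutoff_Un[OF Cons.prems I, of i "h\<^sup>2"] cutoff_UNIV[OF Cons.prems, of i]
    by (simp add: Compl_partition)
  moreover have "R\<^sup>2 * cutoff i (- I) \<Lambda> (h\<^sup>2) \<le> \<Lambda> ((var i)\<^sup>2 * h\<^sup>2)"
    by (rule cutoff_chebyshev[OF Cons.prems I(2)]) (use R in \<open>auto simp: I_def\<close>)
  then have "cutoff i (- I) \<Lambda> (h\<^sup>2) \<le> \<Lambda> ((var i)\<^sup>2 * h\<^sup>2) / R\<^sup>2"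
    using R by (simp add: field_simps)
  moreover have "\<Gamma> (h\<^sup>2) - cutoffs is (\<lambda>_. I) \<Gamma> (h\<^sup>2) \<le> (\<Sum>i\<leftarrow>is. \<Gamma> ((var i)\<^sup>2 * h\<^sup>2)) / R\<^sup>2"
    unfolding I_def by (rule Cons.IH[OF t\<Gamma>])
  moreover have "(\<Sum>i\<leftarrow>is. \<Gamma> ((var i)\<^sup>2 * h\<^sup>2)) \<le> (\<Sum>i\<leftarrow>is. \<Lambda> ((var i)\<^sup>2 * h\<^sup>2))"
    unfolding \<Gamma>_def
    by (intro sum_list_mono cutoff_weight_le Cons.prems I nonneg_weight_times_square nonneg_weight_square tame_psd)
  then have "(\<Sum>i\<leftarrow>is. \<Gamma> ((var i)\<^sup>2 * h\<^sup>2)) / R\<^sup>2 \<le> (\<Sum>i\<leftarrow>is. \<Lambda> ((var i)\<^sup>2 * h\<^sup>2)) / R\<^sup>2"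
    by (intro divide_right_mono) auto
  ultimately show ?case by (simp add: \<Gamma>_def I_def add_divide_distrib)
qed simp

section \<open>Existence of the representing measure\<close>

definition coords :: "'n list"
  where "coords = (SOME xs. distinct xs \<and> set xs = UNIV)"

lemma coords: "distinct coords" "set coords = UNIV"
proof -
  have "\<exists>xs :: 'n list. distinct xs \<and> set xs = UNIV"
    using finite_distinct_list[of "UNIV :: 'n set"] by auto
  from someI_ex[OF this, folded coords_def] show "distinct coords" "set coords = UNIV" by auto
qed

definition restricted :: "('n \<Rightarrow> real set) \<Rightarrow> 'n rpoly \<Rightarrow> real"
  where "restricted B = cutoffs coords B L"

lemma tame_restricted: "(\<And>i. B i \<in> sets borel) \<Longrightarrow> tame (restricted B)"
  unfolding restricted_def by (intro tame_cutoffs tame_L)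

lemma restricted_Un:
  assumes "\<And>i. B i \<in> sets borel" "C \<in> sets borel" "D \<in> sets borel" "C \<inter> D = {}" "B j = C \<union> D"
  shows "restricted B p = restricted (B(j := C)) p + restricted (B(j := D)) p"
  unfolding restricted_def
  by (rule cutoffs_Un) (simp_all add: assms tame_L coords)

lemma restricted_UNIV: "restricted (\<lambda>_. UNIV) = L"
  unfolding restricted_def by (rule cutoffs_UNIV[OF tame_L]) simp

lemma restricted_one:
  assumes "B j \<in> sets borel" "\<And>i. i \<noteq> j \<Longrightarrow> B i = UNIV"
  shows "restricted B 1 = measure (slice_measure j L (1\<^sup>2)) (B j)"
proof -
  have "restricted B = cutoff j (B j) L"
    unfolding restricted_def
    by (rule cutoffs_one[where j = j]) (simp_all add: assms tame_L coords)
  then show ?thesis using cutoff_square[OF tame_L assms(1), of j 1] by simp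
qed

section \<open>Finite-dimensional distributions of the threshold events\<close>

text \<open>Index \<open>(i, q)\<close> stands for the event \<open>x $ i \<le> q\<close>, and
  \<open>c\<close> prescribes its truth value. Contradictory prescriptions give an empty side, so
  the thresholds need not be sorted.\<close>

definition cyl :: "('n \<times> rat) set \<Rightarrow> ('n \<times> rat \<Rightarrow> bool) \<Rightarrow> 'n \<Rightarrow> real set"
  where "cyl J c i = {x. \<forall>q. (i, q) \<in> J \<longrightarrow> (x \<le> of_rat q \<longleftrightarrow> c (i, q))}"

lemma sets_cyl [measurable]:
  assumes "finite J" shows "cyl J c i \<in> sets borel"
proof -
  define S :: "rat \<Rightarrow> real set" where "S q = (if c (i, q) then {..of_rat q} else {of_rat q<..})" for q
  define Q where "Q = {q. (i, q) \<in> J}"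
  have S: "S q \<in> sets borel" for q by (simp add: S_def)
  have "finite Q"
    unfolding Q_def by (rule finite_surj[OF assms, of _ snd]) force
  then have "(\<Inter>q\<in>Q. S q) \<in> sets borel"
    by (cases "Q = {}") (auto intro!: sets.finite_INT S)
  moreover have "x \<in> S q \<longleftrightarrow> (x \<le> of_rat q \<longleftrightarrow> c (i, q))" for x q by (auto simp: S_def)
  then have "cyl J c i = (\<Inter>q\<in>Q. S q)"
    unfolding cyl_def Q_def by blast
  ultimately show ?thesis by simp
qed

text \<open>The germ of Kolmogorov consistency: a further threshold cuts a single side into two
  pieces.\<close>

lemma restricted_cyl_insert:
  assumes J: "finite J" and z: "z \<notin> J"
  shows "restricted (cyl J c) p = restricted (cyl (insert z J) (c(z := True))) p + restricted (cyl (insert z J) (c(z := False))) p"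
proof -
  obtain j q where zjq: "z = (j, q)" by (cases z)
  have "restricted (cyl J c) p = restricted ((cyl J c)(j := cyl J c j \<inter> {..of_rat q})) p + restricted ((cyl J c)(j := cyl J c j \<inter> {of_rat q<..})) p"
    by (rule restricted_Un) (use J in auto)
  moreover have "(cyl J c)(j := cyl J c j \<inter> {..of_rat q}) = cyl (insert z J) (c(z := True))"
    using z by (auto simp: fun_eq_iff cyl_def zjq)
  moreover have "(cyl J c)(j := cyl J c j \<inter> {of_rat q<..}) = cyl (insert z J) (c(z := False))"
    using z by (auto simp: fun_eq_iff cyl_def zjq)
  ultimately show ?thesis by simp
qed

definition weight :: "('n \<times> rat) set \<Rightarrow> ('n \<times> rat \<Rightarrow> real) \<Rightarrow> real"
  where "weight J b = restricted (cyl J (\<lambda>z. b z = 1)) 1 / L 1"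

text \<open>Truth values are coded by the reals \<open>0\<close> and \<open>1\<close>, so that the
  extension theorem for the Polish space of reals applies.\<close>

definition patterns :: "('n \<times> rat) set \<Rightarrow> ('n \<times> rat \<Rightarrow> real) set"
  where "patterns J = PiE J (\<lambda>_. {0, 1})"

text \<open>The underlying map is the identity; \<open>distr\<close> only exchanges the power set of
  the patterns for the product Borel algebra.\<close>

definition fidi :: "('n \<times> rat) set \<Rightarrow> ('n \<times> rat \<Rightarrow> real) measure"
  where "fidi J = distr (point_measure (patterns J) (\<lambda>b. ennreal (weight J b))) (PiM J (\<lambda>_. borel)) (\<lambda>b. b)"

lemma finite_patterns: "finite J \<Longrightarrow> finite (patterns J)"
  unfolding patterns_def by (rule finite_PiE) auto

lemma L1_nonneg: "L 1 \<ge> 0"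
  using psd_form_nonneg[OF psd, of 1] by simp

lemma weight_nonneg: "finite J \<Longrightarrow> weight J b \<ge> 0"
  using psd_form_nonneg[OF tame_psd[OF tame_restricted], of "cyl J (\<lambda>z. b z = 1)" 1] L1_nonneg
  by (simp add: weight_def)

lemma cyl_cong: "(\<And>z. z \<in> J \<Longrightarrow> c z = d z) \<Longrightarrow> cyl J c = cyl J d"
  by (auto simp: cyl_def fun_eq_iff)

lemma weight_insert:
  assumes J: "finite J" and z: "z \<notin> J"
  shows "(\<Sum>b\<in>patterns (insert z J). weight (insert z J) b * \<phi> (restrict b J)) = (\<Sum>b\<in>patterns J. weight J b * \<phi> b)"
proof -
  let ?f = "\<lambda>(y, g). g(z := y)"
  have inj: "inj_on ?f ({0, 1} \<times> patterns J)"
    unfolding patterns_def using inj_combinator[OF z, of "\<lambda>_. {0,1::real}"] by simp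
  have "patterns (insert z J) = ?f ` ({0, 1} \<times> patterns J)"
    unfolding patterns_def by (rule PiE_insert_eq)
  then have "(\<Sum>b\<in>patterns (insert z J). weight (insert z J) b * \<phi> (restrict b J))
     = (\<Sum>q\<in>{0, 1} \<times> patterns J. weight (insert z J) (?f q) * \<phi> (restrict (?f q) J))"
    using sum.reindex[OF inj, of "\<lambda>b. weight (insert z J) b * \<phi> (restrict b J)"] by simp
  also have "\<dots> = (\<Sum>y\<in>{0, 1}. \<Sum>g\<in>patterns J. weight (insert z J) (g(z := y)) * \<phi> (restrict (g(z := y)) J))"
    unfolding sum.cartesian_product' by simp
  also have "\<dots> = (\<Sum>g\<in>patterns J. weight (insert z J) (g(z := 0)) * \<phi> g) + (\<Sum>g\<in>patterns J. weight (insert z J) (g(z := 1)) * \<phi> g)"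
  proof -
    have "restrict (g(z := y)) J = g" if "g \<in> patterns J" for g y
      using that z by (auto simp: patterns_def restrict_def PiE_def extensional_def fun_eq_iff)
    then show ?thesis by simp
  qed
  also have "\<dots> = (\<Sum>g\<in>patterns J. weight J g * \<phi> g)"
    unfolding sum.distrib[symmetric]
  proof (rule sum.cong)
    fix g assume "g \<in> patterns J"
    have "cyl (insert z J) (\<lambda>w. (g(z := y)) w = 1) = cyl (insert z J) ((\<lambda>w. g w = 1)(z := (y = 1)))" for y
      by (rule cyl_cong) auto
    then have "weight J g = weight (insert z J) (g(z := 0)) + weight (insert z J) (g(z := 1))"
      unfolding weight_def restricted_cyl_insert[OF J z, of "\<lambda>w. g w = 1"]
      by (simp add: add_divide_distrib)
    then show "weight (insert z J) (g(z := 0)) * \<phi> g + weight (insert z J) (g(z := 1)) * \<phi> g = weight J g * \<phi> g"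
      by (simp add: distrib_right)
  qed simp
  finally show ?thesis .
qed

text \<open>Thresholds are removed one at a time; the arbitrary test function \<open>\<phi>\<close>
  lets the restriction to \<open>J\<close> pass through the intermediate index sets.\<close>

lemma weight_project:
  assumes J: "finite J" and F: "finite F" "F \<inter> J = {}"
  shows "(\<Sum>b\<in>patterns (F \<union> J). weight (F \<union> J) b * \<phi> (restrict b J)) = (\<Sum>b\<in>patterns J. weight J b * \<phi> b)"
  using F
proof (induction F)
  case empty
  have "restrict b J = b" if "b \<in> patterns J" for b
    using that by (auto simp: patterns_def PiE_def extensional_restrict)
  then show ?case by simp
next
  case (insert z F)
  have "restrict (restrict b (F \<union> J)) J = restrict b J" for b :: "'n \<times> rat \<Rightarrow> real"
    by (auto simp: restrict_def)
  then have "(\<Sum>b\<in>patterns (insert z (F \<union> J)). weight (insert z (F \<union> J)) b * \<phi> (restrict b J))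
    = (\<Sum>b\<in>patterns (insert z (F \<union> J)). weight (insert z (F \<union> J)) b * (\<phi> (restrict (restrict b (F \<union> J)) J)))"
    by simp
  also have "\<dots> = (\<Sum>b\<in>patterns (F \<union> J). weight (F \<union> J) b * \<phi> (restrict b J))"
    by (rule weight_insert) (use insert J in auto)
  also have "\<dots> = (\<Sum>b\<in>patterns J. weight J b * \<phi> b)"
    by (rule insert.IH) (use insert.prems in auto)
  finally show ?case by (simp add: restrict_def)
qed

lemma emeasure_fidi:
  assumes J: "finite J" and X: "X \<in> sets (PiM J (\<lambda>_. borel))"
  shows "emeasure (fidi J) X = ennreal (\<Sum>b\<in>patterns J. weight J b * indicator X b)"
proof -
  have meas: "(\<lambda>b. b) \<in> measurable (point_measure (patterns J) (\<lambda>b. ennreal (weight J b))) (PiM J (\<lambda>_. borel))"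
    by (auto simp: measurable_point_measure_eq1 patterns_def space_PiM PiE_def)
  have "emeasure (fidi J) X = emeasure (point_measure (patterns J) (\<lambda>b. ennreal (weight J b))) (X \<inter> patterns J)"
    unfolding fidi_def by (subst emeasure_distr[OF meas X]) (simp add: space_point_measure)
  also have "\<dots> = (\<Sum>b\<in>X \<inter> patterns J. ennreal (weight J b))"
    by (rule emeasure_point_measure_finite) (use finite_patterns[OF J] in auto)
  also have "\<dots> = ennreal (\<Sum>b\<in>X \<inter> patterns J. weight J b)"
    by (rule sum_ennreal) (simp add: weight_nonneg J)
  also have "(\<Sum>b\<in>X \<inter> patterns J. weight J b) = (\<Sum>b\<in>patterns J. weight J b * indicator X b)"
    by (rule sum.mono_neutral_cong_left) (auto simp: finite_patterns J indicator_def)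
  finally show ?thesis .
qed

lemma sets_fidi [simp]: "sets (fidi J) = sets (PiM J (\<lambda>_. borel))"
  by (simp add: fidi_def)

lemma polish_projective_fidi:
  assumes L1: "L 1 > 0"
  shows "polish_projective UNIV fidi"
proof (intro polish_projective.intro projective_family.intro)
  fix J H :: "('n \<times> rat) set"
  assume JH: "J \<subseteq> H" "finite H"
  then have J: "finite J" by (rule finite_subset)
  have res: "(\<lambda>f. restrict f J) \<in> measurable (fidi H) (PiM J (\<lambda>_. borel))"
    using measurable_restrict_subset[OF JH(1), of "\<lambda>_. borel"] by (simp add: measurable_cong_sets[OF sets_fidi refl])
  show "fidi J = distr (fidi H) (PiM J (\<lambda>_. borel)) (\<lambda>f. restrict f J)"
  proof (rule measure_eqI)
    fix X assume "X \<in> sets (fidi J)"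
    then have X: "X \<in> sets (PiM J (\<lambda>_. borel))" by simp
    have "emeasure (distr (fidi H) (PiM J (\<lambda>_. borel)) (\<lambda>f. restrict f J)) X = emeasure (fidi H) ((\<lambda>f. restrict f J) -` X \<inter> space (fidi H))"
      by (rule emeasure_distr[OF res X])
    also have "\<dots> = ennreal (\<Sum>b\<in>patterns H. weight H b * indicator ((\<lambda>f. restrict f J) -` X \<inter> space (fidi H)) b)"
      using measurable_sets[OF res X] JH(2) by (intro emeasure_fidi) auto
    also have "(\<Sum>b\<in>patterns H. weight H b * indicator ((\<lambda>f. restrict f J) -` X \<inter> space (fidi H)) b) = (\<Sum>b\<in>patterns H. weight H b * indicator X (restrict b J))"
    proof (rule sum.cong)
      fix b assume "b \<in> patterns H"
      then have "b \<in> space (fidi H)" by (auto simp: patterns_def fidi_def space_PiM PiE_def)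
      then show "weight H b * indicator ((\<lambda>f. restrict f J) -` X \<inter> space (fidi H)) b = weight H b * indicator X (restrict b J)"
        by (simp add: indicator_def)
    qed simp
    also have "\<dots> = (\<Sum>b\<in>patterns J. weight J b * indicator X b)"
    proof -
      have "H = (H - J) \<union> J" using JH by auto
      then show ?thesis using weight_project[OF J, of "H - J" "indicator X"] JH by auto
    qed
    also have "ennreal \<dots> = emeasure (fidi J) X" by (rule emeasure_fidi[OF J X, symmetric])
    finally show "emeasure (fidi J) X = emeasure (distr (fidi H) (PiM J (\<lambda>_. borel)) (\<lambda>f. restrict f J)) X" ..
  qed simp
next
  fix J :: "('n \<times> rat) set" assume J: "finite J"
  \<comment> \<open>The total mass follows by projecting to the empty index set, where the weight is
    \<open>L 1 / L 1\<close>.\<close>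
  have "(\<Sum>b\<in>patterns J. weight J b * 1) = (\<Sum>b\<in>patterns {}. weight {} b * 1)"
    using weight_project[of "{}" J "\<lambda>_. 1"] J by simp
  also have "\<dots> = 1"
  proof -
    have "cyl {} c = (\<lambda>_. UNIV)" for c by (auto simp: cyl_def)
    then show ?thesis using L1 by (simp add: patterns_def weight_def restricted_UNIV)
  qed
  finally have total: "(\<Sum>b\<in>patterns J. weight J b) = 1" by simp
  show "prob_space (fidi J)"
  proof
    have "space (fidi J) = space (PiM J (\<lambda>_. borel))" by (simp add: fidi_def)
    then have "emeasure (fidi J) (space (fidi J)) = ennreal (\<Sum>b\<in>patterns J. weight J b * indicator (space (PiM J (\<lambda>_. borel))) b)"
      using J by (simp add: emeasure_fidi del: space_PiM)
    also have "(\<Sum>b\<in>patterns J. weight J b * indicator (space (PiM J (\<lambda>_. borel :: real measure))) b) = 1"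
      unfolding total[symmetric] by (intro sum.cong) (auto simp: patterns_def space_PiM PiE_def indicator_def)
    finally show "emeasure (fidi J) (space (fidi J)) = 1" by simp
  qed
qed

text \<open>The extension theorem delivers only abstract events \<open>e i q\<close>. Almost surely
  they have to be the events \<open>X i \<le> q\<close> of a random vector. The conditions for this
  are countably many and each involves one coordinate, so they can be checked with the slice measure
  of the weight \<open>1\<close>.\<close>

lemma box_measure_exists_pos:
  assumes L1: "L 1 > 0"
  shows "\<exists>\<mu> :: (real ^ 'n) measure. sets \<mu> = sets borel \<and> finite_measure \<mu> \<and>
    (\<forall>a b. (\<forall>i. a i < b i) \<longrightarrow>
      measure \<mu> {x. \<forall>i. of_rat (a i) < x $ i \<and> x $ i \<le> of_rat (b i)}
        = restricted (\<lambda>i. {of_rat (a i)<..of_rat (b i)}) 1)"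
proof -
  interpret polish_projective UNIV fidi by (rule polish_projective_fidi[OF L1])
  have sets_lim: "sets lim = sets (PiM UNIV (\<lambda>_. borel :: real measure))" by simp
  have space_lim: "space lim = UNIV" by (simp add: space_PiM)
  define e where "e i q \<omega> \<longleftrightarrow> \<omega> (i, q) = (1::real)" for i :: 'n and q :: rat and \<omega>
  have "(\<lambda>\<omega>. \<omega> z) \<in> borel_measurable lim" for z :: "'n \<times> rat"
    by (simp add: measurable_cong_sets[OF sets_lim refl])
  then have e_meas [measurable]: "Measurable.pred lim (e i q)" for i q
    unfolding e_def pred_def by (intro borel_measurable_eq) auto
  have pattern: "P.prob {\<omega>. \<forall>i q. (i, q) \<in> J \<longrightarrow> e i q \<omega> = c (i, q)} = restricted (cyl J c) 1 / L 1"
    if J: "finite J" for J c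
  proof -
    define X where "X = PiE J (\<lambda>z. if c z then {1::real} else - {1})"
    have X: "X \<in> sets (PiM J (\<lambda>_. borel))"
      unfolding X_def using J by (intro sets_PiM_I_finite) auto
    have eq: "prod_emb UNIV (\<lambda>_. borel) J X = {\<omega>. \<forall>i q. (i, q) \<in> J \<longrightarrow> e i q \<omega> = c (i, q)}"
      by (auto simp: prod_emb_def X_def space_PiM e_def PiE_iff split: if_splits)
    have "emeasure lim (prod_emb UNIV (\<lambda>_. borel) J X) = emeasure (fidi J) X"
      by (rule emeasure_lim_emb) (use J X in auto)
    also have "\<dots> = ennreal (\<Sum>b\<in>patterns J. weight J b * indicator X b)"
      by (rule emeasure_fidi[OF J X])
    also have "(\<Sum>b\<in>patterns J. weight J b * indicator X b) = (\<Sum>b\<in>{\<lambda>z\<in>J. of_bool (c z)}. weight J b)"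
    proof (rule sum.mono_neutral_cong_right)
      show "{\<lambda>z\<in>J. of_bool (c z)} \<subseteq> patterns J" by (auto simp: patterns_def)
      show "\<forall>b\<in>patterns J - {\<lambda>z\<in>J. of_bool (c z)}. weight J b * indicator X b = 0"
      proof
        fix b assume b: "b \<in> patterns J - {\<lambda>z\<in>J. of_bool (c z)}"
        have "b \<notin> X"
        proof
          assume "b \<in> X"
          with b have "b = (\<lambda>z\<in>J. of_bool (c z))"
            by (auto simp: X_def patterns_def PiE_iff fun_eq_iff extensional_def split: if_splits)
          with b show False by simp
        qed
        then show "weight J b * indicator X b = 0" by simp
      qed
    qed (auto simp: X_def finite_patterns J)
    also have "\<dots> = restricted (cyl J c) 1 / L 1"
      unfolding weight_def by (simp cong: cyl_cong)
    finally have "P.prob (prod_emb UNIV (\<lambda>_. borel) J X) = restricted (cyl J c) 1 / L 1"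
      using weight_nonneg[OF J, of "\<lambda>z. of_bool (c z)"] by (simp add: measure_def weight_def)
    then show ?thesis by (simp add: eq)
  qed
  define M where "M i = slice_measure i L (1\<^sup>2)" for i
  have mm: "moment_measure (M i)" for i unfolding M_def by (rule slice_square[OF tame_L])
  \<comment> \<open>Both thresholds belong to coordinate \<open>i\<close>; the other sides are the
    whole line, so the restricted form at \<open>1\<close> is a mass of one slice measure.\<close>
  have pair: "P.prob {\<omega>. e i q \<omega> = c \<and> e i r \<omega> = d} = measure (M i) {x. (x \<le> of_rat q) = c \<and> (x \<le> of_rat r) = d} / L 1"
    if qr: "q \<noteq> r" for i q r c d
  proof -
    define J where "J = {(i, q), (i, r)}"
    define c' where "c' = (\<lambda>(j :: 'n, s). if s = q then c else d)"
    have "restricted (cyl J c') 1 = measure (M i) (cyl J c' i)"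
      unfolding M_def by (rule restricted_one) (auto simp: sets_cyl J_def, auto simp: cyl_def)
    moreover have "cyl J c' i = {x. (x \<le> of_rat q) = c \<and> (x \<le> of_rat r) = d}"
      using qr by (auto simp: cyl_def J_def c'_def)
    moreover have "{\<omega>. \<forall>i q. (i, q) \<in> J \<longrightarrow> e i q \<omega> = c' (i, q)} = {\<omega>. e i q \<omega> = c \<and> e i r \<omega> = d}"
      using qr by (auto simp: J_def c'_def)
    ultimately show ?thesis using pattern[of J c'] by (simp add: J_def)
  qed
  have single: "P.prob {\<omega>. e i q \<omega> = c} = measure (M i) {x. (x \<le> of_rat q) = c} / L 1" for i q c
  proof -
    define J where "J = {(i, q)}"
    define c' where "c' = (\<lambda>_ :: 'n \<times> rat. c)"
    have "restricted (cyl J c') 1 = measure (M i) (cyl J c' i)"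
      unfolding M_def by (rule restricted_one) (auto simp: sets_cyl J_def, auto simp: cyl_def)
    moreover have "cyl J c' i = {x. (x \<le> of_rat q) = c}"
      by (auto simp: cyl_def J_def c'_def)
    moreover have "{\<omega>. \<forall>i q. (i, q) \<in> J \<longrightarrow> e i q \<omega> = c' (i, q)} = {\<omega>. e i q \<omega> = c}"
      by (auto simp: J_def c'_def)
    ultimately show ?thesis using pattern[of J c'] by (simp add: J_def)
  qed
  have null: "AE \<omega> in lim. \<exists>n. \<not> F n \<omega>"
    if lim0: "(\<lambda>n. P.prob {\<omega>. F n \<omega>}) \<longlonglongrightarrow> 0" and F [measurable]: "\<And>n. Measurable.pred lim (F n)" for F :: "nat \<Rightarrow> _ \<Rightarrow> bool"
  proof -
    have sets: "{\<omega>. F n \<omega>} \<in> sets lim" for n using predE[OF F[of n]] unfolding space_lim by simp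
    have "{\<omega>. \<forall>n. F n \<omega>} = (\<Inter>n. {\<omega>. F n \<omega>})" by auto
    then have sets': "{\<omega>. \<forall>n. F n \<omega>} \<in> sets lim" using sets by auto
    have "P.prob {\<omega>. \<forall>n. F n \<omega>} \<le> P.prob {\<omega>. F n \<omega>}" for n
      by (rule P.finite_measure_mono[OF _ sets]) auto
    then have "P.prob {\<omega>. \<forall>n. F n \<omega>} \<le> 0"
      by (intro LIMSEQ_le_const[OF lim0]) auto
    then have "P.prob {\<omega>. \<forall>n. F n \<omega>} = 0" using measure_nonneg[of lim] by (simp add: antisym)
    then have "{\<omega>. \<forall>n. F n \<omega>} \<in> null_sets lim" using sets' by (auto simp: P.emeasure_eq_measure)
    then show ?thesis by (rule AE_I') auto
  qed
  have dec: "(\<lambda>n. measure (M i) (K n) / L 1) \<longlonglongrightarrow> 0"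
    if K: "\<And>n. K n \<in> sets borel" "decseq K" "(\<Inter>n. K n) = {}" for K i
  proof -
    interpret M: moment_measure "M i" by (rule mm)
    have "(\<lambda>n. measure (M i) (K n)) \<longlonglongrightarrow> measure (M i) (\<Inter>n. K n)"
      using K by (intro M.finite_Lim_measure_decseq) (auto simp: M.sets_M)
    then show ?thesis using K(3) tendsto_divide[OF _ tendsto_const] L1 by fastforce
  qed
  \<comment> \<open>The following four facts make \<open>q \<mapsto> e i q \<omega>\<close> the
    indicator of a closed upper half line: \<open>A\<close> is monotonicity, \<open>B\<close>
    right-continuity, and \<open>C\<close> and \<open>D\<close> keep the threshold away from plus
    and minus infinity.\<close>
  have A: "AE \<omega> in lim. e i q \<omega> \<longrightarrow> e i r \<omega>" if qr: "q < r" for i q r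
  proof -
    have "real_of_rat q < real_of_rat r" using qr by (simp add: of_rat_less)
    then have eq: "{} = {x. (x \<le> real_of_rat q) = True \<and> (x \<le> real_of_rat r) = False}" by auto
    have "P.prob {\<omega>. e i q \<omega> = True \<and> e i r \<omega> = False} = measure (M i) {} / L 1"
      unfolding eq by (rule pair) (use qr in simp)
    then have "AE \<omega> in lim. \<exists>n::nat. \<not> (e i q \<omega> \<and> \<not> e i r \<omega>)"
      by (intro null) auto
    then show ?thesis by eventually_elim auto
  qed
  have B: "AE \<omega> in lim. \<exists>n. \<not> (\<not> e i q \<omega> \<and> e i (q + 1 / of_nat (Suc n)) \<omega>)" for i q
  proof (rule null)
    define K where "K n = {x :: real. (x \<le> of_rat q) = False \<and> (x \<le> of_rat (q + 1 / of_nat (Suc n))) = True}" for n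
    have K_eq: "K n = {of_rat q <.. of_rat q + 1 / real (Suc n)}" for n
      by (auto simp: K_def of_rat_add of_rat_divide not_le)
    have "(\<lambda>n. measure (M i) (K n) / L 1) \<longlonglongrightarrow> 0"
    proof (rule dec)
      show "K n \<in> sets borel" for n by (simp add: K_eq)
      show "decseq K"
        by (auto simp: decseq_def K_eq elim!: order_trans intro!: divide_left_mono)
      show "(\<Inter>n. K n) = {}"
      proof (rule equals0I)
        fix x assume x: "x \<in> (\<Inter>n. K n)"
        then have "x - of_rat q > 0" by (auto simp: K_eq)
        then obtain n where "inverse (real (Suc n)) < x - of_rat q" using reals_Archimedean by blast
        moreover have "x \<in> K n" using x by auto
        ultimately show False by (simp add: K_eq inverse_eq_divide)
      qed
    qed
    moreover have "P.prob {\<omega>. \<not> e i q \<omega> \<and> e i (q + 1 / of_nat (Suc n)) \<omega>} = measure (M i) (K n) / L 1" for n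
      using pair[of q "q + 1 / of_nat (Suc n)" i False True] by (simp add: K_def)
    ultimately show "(\<lambda>n. P.prob {\<omega>. \<not> e i q \<omega> \<and> e i (q + 1 / of_nat (Suc n)) \<omega>}) \<longlonglongrightarrow> 0" by simp
  qed measurable
  have C: "AE \<omega> in lim. \<exists>n. \<not> \<not> e i (of_nat n) \<omega>" for i
  proof (rule null)
    have "(\<lambda>n. measure (M i) {x :: real. (x \<le> of_rat (of_nat n)) = False} / L 1) \<longlonglongrightarrow> 0"
    proof (rule dec)
      show "(\<Inter>n. {x. (x \<le> of_rat (of_nat n)) = False}) = ({} :: real set)"
      proof (rule equals0I)
        fix x :: real assume x: "x \<in> (\<Inter>n. {x. (x \<le> of_rat (of_nat n)) = False})"
        obtain n where "x < real n" using reals_Archimedean2 by blast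
        moreover have "\<not> x \<le> real n" using x by auto
        ultimately show False by linarith
      qed
      show "decseq (\<lambda>n. {x. (x \<le> real_of_rat (of_nat n)) = False})"
        by (auto simp: decseq_def)
    qed auto
    then show "(\<lambda>n. P.prob {\<omega>. \<not> e i (of_nat n) \<omega>}) \<longlonglongrightarrow> 0"
      using single[of i _ False] by simp
  qed measurable
  have D: "AE \<omega> in lim. \<exists>n. \<not> e i (- of_nat n) \<omega>" for i
  proof (rule null)
    have "(\<lambda>n. measure (M i) {x. (x \<le> of_rat (- of_nat n)) = True} / L 1) \<longlonglongrightarrow> 0"
    proof (rule dec)
      show "(\<Inter>n. {x. (x \<le> of_rat (- of_nat n)) = True}) = ({} :: real set)"
      proof (rule equals0I)
        fix x :: real assume x: "x \<in> (\<Inter>n. {x. (x \<le> of_rat (- of_nat n)) = True})"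
        obtain n where "- x < real n" using reals_Archimedean2 by blast
        moreover have "x \<le> - real n" using x by (auto simp: of_rat_minus)
        ultimately show False by linarith
      qed
      show "decseq (\<lambda>n. {x. (x \<le> real_of_rat (- of_nat n)) = True})"
        by (auto simp: decseq_def of_rat_minus)
    qed auto
    then show "(\<lambda>n. P.prob {\<omega>. e i (- of_nat n) \<omega>}) \<longlonglongrightarrow> 0"
      using single[of i _ True] by simp
  qed measurable
  \<comment> \<open>The least threshold that is met. Extended reals make the countable infimum
    measurable at once; it is finite outside a null set.\<close>
  define Y where "Y i \<omega> = (INF q. if e i q \<omega> then ereal (of_rat q) else \<infinity>)" for i \<omega>
  define X where "X i \<omega> = real_of_ereal (Y i \<omega>)" for i \<omega>
  have X_meas [measurable]: "X i \<in> borel_measurable lim" for i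
    unfolding X_def Y_def by measurable
  have AE_all: "AE \<omega> in lim. \<forall>i q. e i q \<omega> \<longleftrightarrow> X i \<omega> \<le> of_rat q"
  proof -
    have "AE \<omega> in lim. \<forall>i q r. q < r \<longrightarrow> e i q \<omega> \<longrightarrow> e i r \<omega>"
      unfolding AE_all_countable using A by auto
    moreover have "AE \<omega> in lim. \<forall>i q. \<exists>n. \<not> (\<not> e i q \<omega> \<and> e i (q + 1 / of_nat (Suc n)) \<omega>)"
      unfolding AE_all_countable using B by auto
    moreover have "AE \<omega> in lim. \<forall>i. \<exists>n. \<not> \<not> e i (of_nat n) \<omega>"
      unfolding AE_all_countable using C by auto
    moreover have "AE \<omega> in lim. \<forall>i. \<exists>n. \<not> e i (- of_nat n) \<omega>"
      unfolding AE_all_countable using D by auto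
    ultimately show ?thesis
    proof eventually_elim
      case (elim \<omega>)
      show ?case
      proof (intro allI)
        fix i q
        have mono: "e i r \<omega>" if "e i q \<omega>" "q \<le> r" for q r
          using elim(1) that by (metis order_le_less)
        have below: "ereal (of_rat r) \<le> Y i \<omega>" if "\<not> e i r \<omega>" for r
          unfolding Y_def
        proof (rule INF_greatest)
          fix q
          show "ereal (of_rat r) \<le> (if e i q \<omega> then ereal (of_rat q) else \<infinity>)"
            using mono[of q r] that by (cases "q \<le> r") (auto simp: of_rat_less_eq)
        qed
        have above: "Y i \<omega> \<le> ereal (of_rat r)" if "e i r \<omega>" for r
          unfolding Y_def using that by (intro INF_lower2[of r]) auto
        obtain m where "\<not> e i (- of_nat m) \<omega>" using elim(4) by blast
        moreover obtain n where "e i (of_nat n) \<omega>" using elim(3) by blast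
        ultimately obtain y where y: "Y i \<omega> = ereal y"
          using below above by (cases "Y i \<omega>") (metis ereal_infty_less_eq(1) PInfty_neq_ereal(1), fastforce+)
        then have Xy: "X i \<omega> = y" by (simp add: X_def)
        show "e i q \<omega> \<longleftrightarrow> X i \<omega> \<le> of_rat q"
        proof
          assume "e i q \<omega>"
          then show "X i \<omega> \<le> of_rat q" using above[of q] y Xy by simp
        next
          assume le: "X i \<omega> \<le> of_rat q"
          show "e i q \<omega>"
          proof (rule ccontr)
            assume nq: "\<not> e i q \<omega>"
            then obtain n where "\<not> e i (q + 1 / of_nat (Suc n)) \<omega>" using elim(2) by blast
            then have "of_rat (q + 1 / of_nat (Suc n)) \<le> y" using below y by fastforce
            moreover have "real_of_rat q < of_rat (q + 1 / of_nat (Suc n))"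
              unfolding of_rat_less by simp
            ultimately show False using le Xy by linarith
          qed
        qed
      qed
    qed
  qed
  define V where "V \<omega> = (\<chi> i. X i \<omega>)" for \<omega>
  have V_meas: "V \<in> borel_measurable lim"
  proof (rule borel_measurable_euclidean_space[THEN iffD2], rule ballI)
    fix k :: "real ^ 'n" assume "k \<in> Basis"
    then obtain i where "k = axis i 1" by (auto simp: Basis_vec_def)
    then have "(\<lambda>\<omega>. V \<omega> \<bullet> k) = X i" by (simp add: V_def inner_axis fun_eq_iff)
    then show "(\<lambda>\<omega>. V \<omega> \<bullet> k) \<in> borel_measurable lim" by (simp only: X_meas)
  qed
  \<comment> \<open>The density undoes the normalisation by \<open>L 1\<close>.\<close>
  define \<mu> where "\<mu> = density (distr lim borel V) (\<lambda>_. ennreal (L 1))"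
  have V_lim: "V \<in> measurable lim borel" by (rule V_meas)
  have em_\<mu>: "emeasure \<mu> A = ennreal (L 1 * P.prob (V -` A \<inter> space lim))" if A: "A \<in> sets borel" for A
  proof -
    have "emeasure \<mu> A = ennreal (L 1) * emeasure lim (V -` A \<inter> space lim)"
      unfolding \<mu>_def using A by (simp only: emeasure_density_const sets_distr emeasure_distr[OF V_lim])
    then show ?thesis using L1 by (simp only: P.emeasure_eq_measure ennreal_mult measure_nonneg less_imp_le)
  qed
  have sets_\<mu>: "sets \<mu> = sets borel" by (simp add: \<mu>_def)
  have "finite_measure \<mu>"
  proof (rule finite_measureI)
    have "space \<mu> = UNIV" by (simp add: \<mu>_def)
    then show "emeasure \<mu> (space \<mu>) \<noteq> \<infinity>" using em_\<mu>[of UNIV] by simp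
  qed
  moreover have "measure \<mu> {x. \<forall>i. of_rat (a i) < x $ i \<and> x $ i \<le> of_rat (b i)} = restricted (\<lambda>i. {of_rat (a i)<..of_rat (b i)}) 1"
    if ab: "\<And>i. a i < b i" for a b :: "'n \<Rightarrow> rat"
  proof -
    define Box where "Box = {x :: real ^ 'n. \<forall>i. of_rat (a i) < x $ i \<and> x $ i \<le> of_rat (b i)}"
    have Box: "Box \<in> sets borel" unfolding Box_def by measurable
    define J where "J = range (\<lambda>i. (i, a i)) \<union> range (\<lambda>i. (i, b i))"
    \<comment> \<open>False at the lower ends and true at the upper ends, which describes half-open
      sides; \<open>a i < b i\<close> keeps the two prescriptions apart.\<close>
    define c where "c = (\<lambda>(i, q). q = b i)"
    have J: "(i, q) \<in> J \<longleftrightarrow> q = a i \<or> q = b i" for i q by (auto simp: J_def)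
    have "P.prob (V -` Box \<inter> space lim) = P.prob {\<omega>. \<forall>i q. (i, q) \<in> J \<longrightarrow> e i q \<omega> = c (i, q)}"
    proof (rule P.finite_measure_eq_AE)
      show "AE \<omega> in lim. (\<omega> \<in> V -` Box \<inter> space lim) = (\<omega> \<in> {\<omega>. \<forall>i q. (i, q) \<in> J \<longrightarrow> e i q \<omega> = c (i, q)})"
        using AE_all
      proof eventually_elim
        case (elim \<omega>)
        have "a i \<noteq> b i" for i using ab[of i] by simp
        then have "(\<forall>i q. (i, q) \<in> J \<longrightarrow> e i q \<omega> = c (i, q)) \<longleftrightarrow> (\<forall>i. \<not> e i (a i) \<omega> \<and> e i (b i) \<omega>)"
          by (auto simp: J c_def)
        also have "\<dots> \<longleftrightarrow> V \<omega> \<in> Box"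
          using elim by (auto simp: V_def Box_def not_le)
        finally show ?case by (simp add: space_PiM)
      qed
      show "V -` Box \<inter> space lim \<in> P.events" by (rule measurable_sets[OF V_lim Box])
      have "Measurable.pred lim (\<lambda>\<omega>. \<forall>i q. (i, q) \<in> J \<longrightarrow> e i q \<omega> = c (i, q))"
        by measurable
      from predE[OF this] show "{\<omega>. \<forall>i q. (i, q) \<in> J \<longrightarrow> e i q \<omega> = c (i, q)} \<in> P.events"
        unfolding space_lim by simp
    qed
    also have "\<dots> = restricted (cyl J c) 1 / L 1"
      by (rule pattern) (auto simp: J_def)
    also have "cyl J c = (\<lambda>i. {of_rat (a i)<..of_rat (b i)})"
    proof
      fix i
      have "a i \<noteq> b i" using ab[of i] by simp
      then show "cyl J c i = {of_rat (a i)<..of_rat (b i)}"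
        unfolding cyl_def J c_def by (auto simp: not_le)
    qed
    finally have prob: "P.prob (V -` Box \<inter> space lim) = restricted (\<lambda>i. {of_rat (a i)<..of_rat (b i)}) 1 / L 1" .
    have "measure \<mu> Box = L 1 * P.prob (V -` Box \<inter> space lim)"
      unfolding measure_def[of \<mu>] em_\<mu>[OF Box] using L1 by (intro enn2real_ennreal mult_nonneg_nonneg) auto
    also have "\<dots> = restricted (\<lambda>i. {of_rat (a i)<..of_rat (b i)}) 1"
      unfolding prob using L1 by simp
    finally show ?thesis unfolding Box_def .
  qed
  ultimately show ?thesis using sets_\<mu> by blast
qed

text \<open>For \<open>L 1 = 0\<close> normalisation is impossible, but restriction lowers values on
  squares, so all box masses vanish and the zero measure serves.\<close>

lemma box_measure_exists:
  obtains \<mu> :: "(real ^ 'n) measure" where "sets \<mu> = sets borel" "finite_measure \<mu>"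
    "\<And>a b. (\<And>i. a i < b i) \<Longrightarrow>
      measure \<mu> {x. \<forall>i. of_rat (a i) < x $ i \<and> x $ i \<le> of_rat (b i)}
        = restricted (\<lambda>i. {of_rat (a i)<..of_rat (b i)}) 1"
proof (cases "L 1 = 0")
  case True
  have "restricted (\<lambda>i. {of_rat (a i)<..of_rat (b i)}) 1 = 0" for a b :: "'n \<Rightarrow> rat"
  proof (rule antisym)
    show "restricted (\<lambda>i. {of_rat (a i)<..of_rat (b i)}) 1 \<le> 0"
      using cutoffs_square_le[OF _ tame_L, of "\<lambda>i. {of_rat (a i)<..of_rat (b i)}" coords 1] True
      by (simp add: restricted_def)
    show "0 \<le> restricted (\<lambda>i. {of_rat (a i)<..of_rat (b i)}) 1"
      using psd_form_nonneg[OF tame_psd[OF tame_restricted], of "\<lambda>i. {of_rat (a i)<..of_rat (b i)}" 1] by simp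
  qed
  then show ?thesis
    by (intro that[of "null_measure borel"]) (auto simp: measure_def intro!: finite_measureI)
next
  case False
  then have "L 1 > 0" using L1_nonneg by simp
  from box_measure_exists_pos[OF this] that show ?thesis by blast
qed

end

section \<open>Forms confined to a small box are close to point evaluations\<close>

text \<open>A substitute for a supremum bound on \<open>u\<close> over the support of
  \<open>\<Gamma>\<close>: multiplication by \<open>u\<close> is bounded for the semi-inner product
  \<open>\<Gamma> (p * q)\<close>. Strict positivity of \<open>C\<close> permits division by
  it.\<close>

definition form_bound :: "('n::finite rpoly \<Rightarrow> real) \<Rightarrow> real \<Rightarrow> 'n rpoly \<Rightarrow> bool"
  where "form_bound \<Gamma> C u \<longleftrightarrow> C > 0 \<and> (\<forall>h. \<bar>\<Gamma> (u * h\<^sup>2)\<bar> \<le> C * \<Gamma> (h\<^sup>2))"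

lemma form_bound_mono:
  assumes "psd_form \<Gamma>" "form_bound \<Gamma> C u" "C \<le> D"
  shows "form_bound \<Gamma> D u"
proof -
  have "C * \<Gamma> (h\<^sup>2) \<le> D * \<Gamma> (h\<^sup>2)" for h
    using assms(3) psd_form_nonneg[OF assms(1)] by (intro mult_right_mono) auto
  then show ?thesis using assms(2,3) unfolding form_bound_def by (meson order_trans less_le_trans)
qed

lemma form_bound_add:
  assumes "psd_form \<Gamma>" "form_bound \<Gamma> C u" "form_bound \<Gamma> D v"
  shows "form_bound \<Gamma> (C + D) (u + v)"
  unfolding form_bound_def
proof (intro conjI allI)
  fix h
  have "\<bar>\<Gamma> (u * h\<^sup>2)\<bar> \<le> C * \<Gamma> (h\<^sup>2)" "\<bar>\<Gamma> (v * h\<^sup>2)\<bar> \<le> D * \<Gamma> (h\<^sup>2)"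
    using assms by (auto simp: form_bound_def)
  then show "\<bar>\<Gamma> ((u + v) * h\<^sup>2)\<bar> \<le> (C + D) * \<Gamma> (h\<^sup>2)"
    by (simp add: distrib_right linear_form_add[OF psd_form_linear[OF assms(1)]])
qed (use assms in \<open>auto simp: form_bound_def\<close>)

lemma form_bound_scale:
  assumes "psd_form \<Gamma>" "form_bound \<Gamma> C u" "K > 0" "\<bar>c\<bar> \<le> K"
  shows "form_bound \<Gamma> (K * C) (cst c * u)"
  unfolding form_bound_def
proof (intro conjI allI)
  fix h
  have "\<bar>\<Gamma> (cst c * u * h\<^sup>2)\<bar> = \<bar>c\<bar> * \<bar>\<Gamma> (u * h\<^sup>2)\<bar>"
    by (simp add: mult.assoc linear_form_cst[OF psd_form_linear[OF assms(1)]] abs_mult)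
  also have "\<dots> \<le> K * (C * \<Gamma> (h\<^sup>2))"
    using assms by (intro mult_mono) (auto simp: form_bound_def)
  finally show "\<bar>\<Gamma> (cst c * u * h\<^sup>2)\<bar> \<le> K * C * \<Gamma> (h\<^sup>2)" by (simp add: mult.assoc)
qed (use assms in \<open>auto simp: form_bound_def\<close>)

text \<open>\<open>2 C (C\<^sup>2 - u\<^sup>2) = (C + u) (C - u)\<^sup>2 + (C - u) (C + u)\<^sup>2\<close>.\<close>

lemma form_bound_square:
  assumes psd: "psd_form \<Gamma>" and u: "form_bound \<Gamma> C u"
  shows "\<Gamma> (u\<^sup>2 * h\<^sup>2) \<le> C\<^sup>2 * \<Gamma> (h\<^sup>2)"
proof -
  note lin = psd_form_linear[OF psd]
  have C: "C > 0" using u by (simp add: form_bound_def)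
  have "\<bar>\<Gamma> (u * g\<^sup>2)\<bar> \<le> C * \<Gamma> (g\<^sup>2)" for g using u by (simp add: form_bound_def)
  then have "\<Gamma> (u * g\<^sup>2) \<le> C * \<Gamma> (g\<^sup>2)" "- \<Gamma> (u * g\<^sup>2) \<le> C * \<Gamma> (g\<^sup>2)" for g
    unfolding abs_le_iff by blast+
  moreover have "\<Gamma> ((cst C + u) * g\<^sup>2) = C * \<Gamma> (g\<^sup>2) + \<Gamma> (u * g\<^sup>2)" "\<Gamma> ((cst C - u) * g\<^sup>2) = C * \<Gamma> (g\<^sup>2) - \<Gamma> (u * g\<^sup>2)" for g
    by (simp_all add: distrib_right left_diff_distrib linear_form_add[OF lin] linear_form_diff[OF lin] linear_form_cst[OF lin])
  ultimately have pos: "\<Gamma> ((cst C + u) * g\<^sup>2) \<ge> 0" "\<Gamma> ((cst C - u) * g\<^sup>2) \<ge> 0" for g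
    by (metis add.commute diff_ge_0_iff_ge minus_le_iff add_uminus_conv_diff diff_minus_eq_add)+
  have "(cst C + u) * ((cst C - u) * h)\<^sup>2 + (cst C - u) * ((cst C + u) * h)\<^sup>2
      = cst (2 * C) * (cst (C\<^sup>2) * h\<^sup>2 - u\<^sup>2 * h\<^sup>2)"
    by (simp add: cst_mult power2_eq_square algebra_simps)
  then have "2 * C * (C\<^sup>2 * \<Gamma> (h\<^sup>2) - \<Gamma> (u\<^sup>2 * h\<^sup>2)) \<ge> 0"
    using pos(1)[of "(cst C - u) * h"] pos(2)[of "(cst C + u) * h"]
    by (metis add_nonneg_nonneg linear_form_add[OF lin] linear_form_cst[OF lin] linear_form_diff[OF lin])
  then show ?thesis using C by (simp add: zero_le_mult_iff)
qed

text \<open>Cauchy-Schwarz is applied to \<open>(u * h) * (v * h)\<close>, so bounds multiply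
  although neither factor has a sign.\<close>

lemma form_bound_mult:
  assumes psd: "psd_form \<Gamma>" and u: "form_bound \<Gamma> C u" and v: "form_bound \<Gamma> D v"
  shows "form_bound \<Gamma> (C * D) (u * v)"
  unfolding form_bound_def
proof (intro conjI allI)
  have C: "C > 0" "D > 0" using u v by (simp_all add: form_bound_def)
  then show "C * D > 0" by simp
  fix h
  have h: "\<Gamma> (h\<^sup>2) \<ge> 0" by (rule psd_form_nonneg[OF psd])
  have "(\<Gamma> (u * v * h\<^sup>2))\<^sup>2 = (\<Gamma> ((u * h) * (v * h)))\<^sup>2"
    by (simp add: power2_eq_square mult_ac)
  also have "\<dots> \<le> \<Gamma> ((u * h)\<^sup>2) * \<Gamma> ((v * h)\<^sup>2)"
    by (rule psd_form_cauchy_schwarz[OF psd])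
  also have "\<dots> \<le> (C\<^sup>2 * \<Gamma> (h\<^sup>2)) * (D\<^sup>2 * \<Gamma> (h\<^sup>2))"
    using form_bound_square[OF psd u] form_bound_square[OF psd v] h psd_form_nonneg[OF psd, of "v * h"]
    by (intro mult_mono) (auto simp: power_mult_distrib)
  also have "\<dots> = (C * D * \<Gamma> (h\<^sup>2))\<^sup>2" by (simp add: power2_eq_square)
  finally show "\<bar>\<Gamma> (u * v * h\<^sup>2)\<bar> \<le> C * D * \<Gamma> (h\<^sup>2)"
    using C h by (intro power2_le_imp_le[of "\<bar>_\<bar>"]) auto
qed

lemma eval_poly_bounded:
  fixes p :: "'n::finite rpoly"
  shows "\<exists>K>0. \<forall>x. (\<forall>i. \<bar>x $ i\<bar> \<le> R) \<longrightarrow> \<bar>eval_poly p x\<bar> \<le> K"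
proof (induction p rule: rpoly_induct)
  case (cst c)
  show ?case by (intro exI[of _ "\<bar>c\<bar> + 1"]) auto
next
  case (var i)
  show ?case by (intro exI[of _ "\<bar>R\<bar> + 1"]) (auto intro: order_trans)
next
  case (add p q)
  then obtain K K' where "K > 0" "K' > 0" "\<And>x. (\<forall>i. \<bar>x $ i\<bar> \<le> R) \<Longrightarrow> \<bar>eval_poly p x\<bar> \<le> K" "\<And>x. (\<forall>i. \<bar>x $ i\<bar> \<le> R) \<Longrightarrow> \<bar>eval_poly q x\<bar> \<le> K'"
    by blast
  then show ?case
    by (intro exI[of _ "K + K'"]) (auto intro: order_trans[OF abs_triangle_ineq] add_mono)
next
  case (mult p q)
  then obtain K K' where "K > 0" "K' > 0" "\<And>x. (\<forall>i. \<bar>x $ i\<bar> \<le> R) \<Longrightarrow> \<bar>eval_poly p x\<bar> \<le> K" "\<And>x. (\<forall>i. \<bar>x $ i\<bar> \<le> R) \<Longrightarrow> \<bar>eval_poly q x\<bar> \<le> K'"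
    by blast
  then show ?case
    by (intro exI[of _ "K * K'"]) (auto simp: abs_mult intro!: mult_mono)
qed

text \<open>The essential point is the order of quantifiers: \<open>\<delta>\<close> depends neither
  on the form nor on the point, so one mesh width works for all small boxes at once.\<close>

lemma form_bound_eval:
  fixes p :: "'n::finite rpoly"
  assumes "e > 0"
  shows "\<exists>\<delta>>0. \<forall>\<Gamma> x. psd_form \<Gamma> \<longrightarrow> (\<forall>i. \<bar>x $ i\<bar> \<le> R) \<longrightarrow> (\<forall>i. form_bound \<Gamma> \<delta> (var i - cst (x $ i))) \<longrightarrow>
    form_bound \<Gamma> e (p - cst (eval_poly p x))"
  using assms
proof (induction p arbitrary: e rule: rpoly_induct)
  case (cst c)
  have "form_bound \<Gamma> e (cst c - cst (eval_poly (cst c) x))" if "psd_form \<Gamma>" for \<Gamma> and x :: "real ^ 'n"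
    using that cst by (auto simp: form_bound_def linear_form_0[OF psd_form_linear] psd_form_nonneg)
  then show ?case by (intro exI[of _ 1] conjI allI impI) auto
next
  case (var i)
  then show ?case by (intro exI[of _ e]) auto
next
  case (add p q)
  from add.IH(1)[of "e / 2"] obtain d1 where d1: "d1 > 0"
    "\<And>\<Gamma> x. psd_form \<Gamma> \<Longrightarrow> \<forall>i. \<bar>x $ i\<bar> \<le> R \<Longrightarrow> \<forall>i. form_bound \<Gamma> d1 (var i - cst (x $ i)) \<Longrightarrow> form_bound \<Gamma> (e / 2) (p - cst (eval_poly p x))"
    using add.prems by auto
  from add.IH(2)[of "e / 2"] obtain d2 where d2: "d2 > 0"
    "\<And>\<Gamma> x. psd_form \<Gamma> \<Longrightarrow> \<forall>i. \<bar>x $ i\<bar> \<le> R \<Longrightarrow> \<forall>i. form_bound \<Gamma> d2 (var i - cst (x $ i)) \<Longrightarrow> form_bound \<Gamma> (e / 2) (q - cst (eval_poly q x))"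
    using add.prems by auto
  show ?case
  proof (intro exI[of _ "min d1 d2"] conjI allI impI)
    fix \<Gamma> and x :: "real ^ 'n"
    assume \<Gamma>: "psd_form \<Gamma>" and x: "\<forall>i. \<bar>x $ i\<bar> \<le> R" and b: "\<forall>i. form_bound \<Gamma> (min d1 d2) (var i - cst (x $ i))"
    have "form_bound \<Gamma> (e / 2) (p - cst (eval_poly p x))"
      using b form_bound_mono[OF \<Gamma>, of "min d1 d2" _ d1] by (intro d1 \<Gamma> x) auto
    moreover have "form_bound \<Gamma> (e / 2) (q - cst (eval_poly q x))"
      using b form_bound_mono[OF \<Gamma>, of "min d1 d2" _ d2] by (intro d2 \<Gamma> x) auto
    ultimately have "form_bound \<Gamma> (e / 2 + e / 2) ((p - cst (eval_poly p x)) + (q - cst (eval_poly q x)))"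
      by (rule form_bound_add[OF \<Gamma>])
    moreover have "(p - cst (eval_poly p x)) + (q - cst (eval_poly q x)) = p + q - cst (eval_poly (p + q) x)"
      by (simp add: cst_add)
    ultimately show "form_bound \<Gamma> e (p + q - cst (eval_poly (p + q) x))" by simp
  qed (use d1 d2 in auto)
next
  case (mult p q)
  obtain K1 where K1: "K1 > 0" "\<And>x. \<forall>i. \<bar>x $ i\<bar> \<le> R \<Longrightarrow> \<bar>eval_poly p x\<bar> \<le> K1"
    using eval_poly_bounded[of R p] by blast
  obtain K2 where K2: "K2 > 0" "\<And>x. \<forall>i. \<bar>x $ i\<bar> \<le> R \<Longrightarrow> \<bar>eval_poly q x\<bar> \<le> K2"
    using eval_poly_bounded[of R q] by blast
  \<comment> \<open>Writing the product error as the product of the errors plus two cross terms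
    costs \<open>s * s + (K1 + K2) * s\<close>; as \<open>s \<le> 1\<close>, this is at most
    \<open>s * (1 + K1 + K2)\<close>.\<close>
  define s where "s = min 1 (e / (1 + K1 + K2))"
  have s: "s > 0" "s \<le> 1" using mult.prems K1 K2 by (simp_all add: s_def)
  have "s * (1 + K1 + K2) \<le> e / (1 + K1 + K2) * (1 + K1 + K2)"
    using K1(1) K2(1) by (intro mult_right_mono) (auto simp: s_def)
  also have "\<dots> = e" using K1(1) K2(1) by simp
  finally have "s * 1 + (K1 * s + K2 * s) \<le> e" by (simp add: algebra_simps)
  moreover have "s * s \<le> s * 1" using s by (intro mult_left_mono) auto
  ultimately have se: "s * s + (K1 * s + K2 * s) \<le> e" by linarith
  from mult.IH(1)[OF s(1)] obtain d1 where d1: "d1 > 0"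
    "\<And>\<Gamma> x. psd_form \<Gamma> \<Longrightarrow> \<forall>i. \<bar>x $ i\<bar> \<le> R \<Longrightarrow> \<forall>i. form_bound \<Gamma> d1 (var i - cst (x $ i)) \<Longrightarrow> form_bound \<Gamma> s (p - cst (eval_poly p x))"
    by auto
  from mult.IH(2)[OF s(1)] obtain d2 where d2: "d2 > 0"
    "\<And>\<Gamma> x. psd_form \<Gamma> \<Longrightarrow> \<forall>i. \<bar>x $ i\<bar> \<le> R \<Longrightarrow> \<forall>i. form_bound \<Gamma> d2 (var i - cst (x $ i)) \<Longrightarrow> form_bound \<Gamma> s (q - cst (eval_poly q x))"
    by auto
  show ?case
  proof (intro exI[of _ "min d1 d2"] conjI allI impI)
    fix \<Gamma> and x :: "real ^ 'n"
    assume \<Gamma>: "psd_form \<Gamma>" and x: "\<forall>i. \<bar>x $ i\<bar> \<le> R" and b: "\<forall>i. form_bound \<Gamma> (min d1 d2) (var i - cst (x $ i))"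
    have p: "form_bound \<Gamma> s (p - cst (eval_poly p x))"
      using b form_bound_mono[OF \<Gamma>, of "min d1 d2" _ d1] by (intro d1 \<Gamma> x) auto
    have q: "form_bound \<Gamma> s (q - cst (eval_poly q x))"
      using b form_bound_mono[OF \<Gamma>, of "min d1 d2" _ d2] by (intro d2 \<Gamma> x) auto
    have "form_bound \<Gamma> (s * s + (K1 * s + K2 * s)) ((p - cst (eval_poly p x)) * (q - cst (eval_poly q x)) +
        (cst (eval_poly p x) * (q - cst (eval_poly q x)) + cst (eval_poly q x) * (p - cst (eval_poly p x))))"
      by (intro form_bound_add form_bound_mult form_bound_scale \<Gamma> p q K1 K2 x)
    moreover have "(p - cst (eval_poly p x)) * (q - cst (eval_poly q x)) +
        (cst (eval_poly p x) * (q - cst (eval_poly q x)) + cst (eval_poly q x) * (p - cst (eval_poly p x)))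
        = p * q - cst (eval_poly (p * q) x)"
      by (simp add: cst_mult algebra_simps)
    ultimately show "form_bound \<Gamma> e (p * q - cst (eval_poly (p * q) x))"
      using form_bound_mono[OF \<Gamma> _ se] by simp
  qed (use d1 d2 in auto)
qed

lemma form_bound_var:
  assumes psd: "psd_form \<Gamma>" and ab: "nonneg_weight \<Gamma> (var i - cst a)" "nonneg_weight \<Gamma> (cst b - var i)"
    and d: "b - a \<le> d" "d > 0"
  shows "form_bound \<Gamma> d (var i - cst b)"
  unfolding form_bound_def
proof (intro conjI d(2) allI)
  fix h
  note lin = psd_form_linear[OF psd]
  have h: "\<Gamma> (h\<^sup>2) \<ge> 0" by (rule psd_form_nonneg[OF psd])
  have "\<Gamma> ((var i - cst a) * h\<^sup>2) \<ge> 0" "\<Gamma> ((cst b - var i) * h\<^sup>2) \<ge> 0"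
    using ab by (auto simp: nonneg_weight_def)
  moreover have "(b - a) * \<Gamma> (h\<^sup>2) \<le> d * \<Gamma> (h\<^sup>2)" using d h by (intro mult_right_mono)
  moreover have "0 \<le> d * \<Gamma> (h\<^sup>2)" using d h by simp
  ultimately show "\<bar>\<Gamma> ((var i - cst b) * h\<^sup>2)\<bar> \<le> d * \<Gamma> (h\<^sup>2)"
    by (simp add: left_diff_distrib linear_form_diff[OF lin] linear_form_cst[OF lin] abs_le_iff)
qed

text \<open>Taking \<open>h = 1\<close> compares \<open>\<Gamma> p\<close> with the value of
  \<open>p\<close> at the upper corner. It is used for the restricted form and for the box integral
  alike; both have the same mass at \<open>1\<close>, so they are close to each other.\<close>

lemma form_near_eval:
  fixes p :: "'n::finite rpoly"
  assumes "e > 0"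
  obtains \<delta> where "\<delta> > 0" "\<And>\<Gamma> a b. psd_form \<Gamma> \<Longrightarrow> (\<And>i. \<bar>b $ i\<bar> \<le> R) \<Longrightarrow> (\<And>i. b $ i - a $ i \<le> \<delta>) \<Longrightarrow>
    (\<And>i. nonneg_weight \<Gamma> (var i - cst (a $ i))) \<Longrightarrow> (\<And>i. nonneg_weight \<Gamma> (cst (b $ i) - var i)) \<Longrightarrow>
    \<bar>\<Gamma> p - eval_poly p b * \<Gamma> 1\<bar> \<le> e * \<Gamma> 1"
proof -
  obtain \<delta> where \<delta>: "\<delta> > 0" "\<And>\<Gamma> x. psd_form \<Gamma> \<Longrightarrow> \<forall>i. \<bar>x $ i\<bar> \<le> R \<Longrightarrow> \<forall>i. form_bound \<Gamma> \<delta> (var i - cst (x $ i)) \<Longrightarrow> form_bound \<Gamma> e (p - cst (eval_poly p x))"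
    using form_bound_eval[OF assms, of R p] by blast
  have "\<bar>\<Gamma> p - eval_poly p b * \<Gamma> 1\<bar> \<le> e * \<Gamma> 1"
    if \<Gamma>: "psd_form \<Gamma>" and R: "\<And>i. \<bar>b $ i\<bar> \<le> R" and ba: "\<And>i. b $ i - a $ i \<le> \<delta>"
      and w: "\<And>i. nonneg_weight \<Gamma> (var i - cst (a $ i))" "\<And>i. nonneg_weight \<Gamma> (cst (b $ i) - var i)" for \<Gamma> a b
  proof -
    note lin = psd_form_linear[OF \<Gamma>]
    have "form_bound \<Gamma> e (p - cst (eval_poly p b))"
      using form_bound_var[OF \<Gamma> w ba \<delta>(1)] R by (intro \<delta> \<Gamma>) auto
    then have "\<bar>\<Gamma> ((p - cst (eval_poly p b)) * 1\<^sup>2)\<bar> \<le> e * \<Gamma> (1\<^sup>2)"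
      unfolding form_bound_def by blast
    then show ?thesis
      using linear_form_cst[OF lin, of "eval_poly p b" 1] by (simp add: linear_form_diff[OF lin])
  qed
  with \<delta>(1) show ?thesis by (rule that)
qed

lemma box_halving:
  fixes D w :: "('n::finite \<Rightarrow> rat) \<Rightarrow> ('n \<Rightarrow> rat) \<Rightarrow> real"
  assumes D_split: "\<And>a b j. (\<And>i. a i < b i) \<Longrightarrow> D a b = D a (b(j := (a j + b j) / 2)) + D (a(j := (a j + b j) / 2)) b"
    and w_split: "\<And>a b j. (\<And>i. a i < b i) \<Longrightarrow> w a b = w a (b(j := (a j + b j) / 2)) + w (a(j := (a j + b j) / 2)) b"
    and small: "\<And>a b. (\<And>i. a i < b i) \<Longrightarrow> (\<And>i. - R \<le> a i) \<Longrightarrow> (\<And>i. b i \<le> R) \<Longrightarrow> (\<And>i. b i - a i \<le> d) \<Longrightarrow> \<bar>D a b\<bar> \<le> e * w a b"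
    and d: "d > 0" and ab: "\<And>i. a i < b i" "\<And>i. - R \<le> a i" "\<And>i. b i \<le> R"
  shows "\<bar>D a b\<bar> \<le> e * w a b"
proof -
  define P where "P s \<longleftrightarrow> (\<forall>a b. (\<forall>i. a i < b i) \<longrightarrow> (\<forall>i. - R \<le> a i) \<longrightarrow> (\<forall>i. b i \<le> R) \<longrightarrow> (\<forall>i. b i - a i \<le> s) \<longrightarrow> \<bar>D a b\<bar> \<le> e * w a b)" for s
  have P_double: "P (2 * s)" if Ps: "P s" for s
  proof -
    \<comment> \<open>Coordinates in \<open>F\<close> may already have length up to
      \<open>2 * s\<close>, the others at most \<open>s\<close>; one bisection moves a coordinate
      into \<open>F\<close>.\<close>
    have "\<forall>a b. (\<forall>i. a i < b i) \<longrightarrow> (\<forall>i. - R \<le> a i) \<longrightarrow> (\<forall>i. b i \<le> R) \<longrightarrow> (\<forall>i\<in>F. b i - a i \<le> 2 * s) \<longrightarrow> (\<forall>i\<in>-F. b i - a i \<le> s) \<longrightarrow> \<bar>D a b\<bar> \<le> e * w a b"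
      if "finite F" for F
      using that
    proof (induction F)
      case empty
      then show ?case using Ps by (auto simp: P_def)
    next
      case (insert j F)
      show ?case
      proof (intro allI impI)
        fix a b
        assume a: "\<forall>i. a i < b i" "\<forall>i. - R \<le> a i" "\<forall>i. b i \<le> R" "\<forall>i\<in>insert j F. b i - a i \<le> 2 * s" "\<forall>i\<in>- insert j F. b i - a i \<le> s"
        define m where "m = (a j + b j) / 2"
        have mid: "a j < m" "m < b j" "m - a j \<le> s" "b j - m \<le> s"
          using a(1)[rule_format, of j] a(4) by (auto simp: m_def field_simps)
        have mR: "m \<le> R" "- R \<le> m"
          using mid(1,2) a(2)[rule_format, of j] a(3)[rule_format, of j] by linarith+
        have 1: "\<bar>D a (b(j := m))\<bar> \<le> e * w a (b(j := m))"
          using a mid mR insert.hyps by (intro insert.IH[rule_format]) auto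
        have 2: "\<bar>D (a(j := m)) b\<bar> \<le> e * w (a(j := m)) b"
          using a mid mR insert.hyps by (intro insert.IH[rule_format]) auto
        have "D a b = D a (b(j := m)) + D (a(j := m)) b" "w a b = w a (b(j := m)) + w (a(j := m)) b"
          unfolding m_def using a(1) D_split w_split by auto
        with 1 2 show "\<bar>D a b\<bar> \<le> e * w a b" by (simp add: distrib_left)
      qed
    qed
    from this[of UNIV] show ?thesis by (simp add: P_def)
  qed
  have Pn: "P (2 ^ n * d)" for n
  proof (induction n)
    case 0
    show ?case using small by (auto simp: P_def)
  next
    case (Suc n)
    then show ?case using P_double[OF Suc] by (simp add: mult.assoc)
  qed
  obtain n where n: "2 * R / d < of_nat n" using reals_Archimedean2 by blast
  have "of_nat n \<le> (2 :: rat) ^ n"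
    by (metis less_exp less_imp_le of_nat_le_iff of_nat_numeral of_nat_power)
  then have "of_nat n * d \<le> 2 ^ n * d" using d by (intro mult_right_mono) auto
  moreover have "2 * R < of_nat n * d" using n d by (simp add: field_simps)
  ultimately have "2 * R \<le> 2 ^ n * d" by linarith
  then have "b i - a i \<le> 2 ^ n * d" for i using ab(2)[of i] ab(3)[of i] by linarith
  then show ?thesis using Pn[of n] ab by (simp add: P_def)
qed

section \<open>Recovering the moments and the support\<close>

text \<open>Half-open sides make bisection an exact partition, and rational corners make the family
  countable.\<close>

definition rat_box :: "('n::finite \<Rightarrow> rat) \<Rightarrow> ('n \<Rightarrow> rat) \<Rightarrow> (real ^ 'n) set"
  where "rat_box a b = {x. \<forall>i. of_rat (a i) < x $ i \<and> x $ i \<le> of_rat (b i)}"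

lemma sets_rat_box [measurable]: "rat_box a b \<in> sets borel"
  unfolding rat_box_def by measurable

lemma rat_box_split:
  assumes "a j < m" "m < b j"
  shows "rat_box a b = rat_box a (b(j := m)) \<union> rat_box (a(j := m)) b"
    and "rat_box a (b(j := m)) \<inter> rat_box (a(j := m)) b = {}"
proof -
  have m: "real_of_rat (a j) < of_rat m" "real_of_rat m < of_rat (b j)" using assms by (simp_all add: of_rat_less)
  show "rat_box a b = rat_box a (b(j := m)) \<union> rat_box (a(j := m)) b"
  proof (intro set_eqI iffI)
    fix x assume "x \<in> rat_box a b"
    then show "x \<in> rat_box a (b(j := m)) \<union> rat_box (a(j := m)) b"
      by (cases "x $ j \<le> of_rat m") (auto simp: rat_box_def)
  next
    fix x assume x: "x \<in> rat_box a (b(j := m)) \<union> rat_box (a(j := m)) b"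
    show "x \<in> rat_box a b"
      unfolding rat_box_def
    proof (intro CollectI allI)
      fix i show "of_rat (a i) < x $ i \<and> x $ i \<le> of_rat (b i)"
        using x m unfolding rat_box_def by (cases "i = j") (auto dest!: spec[of _ i])
    qed
  qed
  show "rat_box a (b(j := m)) \<inter> rat_box (a(j := m)) b = {}"
    by (auto simp: rat_box_def dest!: spec[of _ j])
qed

lemma rat_box_near:
  fixes x :: "real ^ 'n::finite"
  assumes "open U" "x \<in> U"
  obtains a b where "\<And>i. a i < b i" "x \<in> rat_box a b" "rat_box a b \<subseteq> U"
proof -
  obtain e where e: "e > 0" "\<And>y. dist y x < e \<Longrightarrow> y \<in> U"
    using assms by (auto simp: open_dist)
  \<comment> \<open>The distance is bounded by the sum of the coordinate differences, each at most
    \<open>d\<close>; this leaves a total of \<open>e / 2\<close>.\<close>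
  define d where "d = e / (2 * real CARD('n))"
  have d: "d > 0" using e by (simp add: d_def)
  have "\<exists>q. x $ i - d < of_rat q \<and> of_rat q < x $ i" for i
    using of_rat_dense[of "x $ i - d" "x $ i"] d by auto
  then obtain a where a: "\<And>i. x $ i - d < of_rat (a i)" "\<And>i. of_rat (a i) < x $ i" by metis
  have "\<exists>q. x $ i < of_rat q \<and> of_rat q < x $ i + d" for i
    using of_rat_dense[of "x $ i" "x $ i + d"] d by auto
  then obtain b where b: "\<And>i. x $ i < of_rat (b i)" "\<And>i. of_rat (b i) < x $ i + d" by metis
  show ?thesis
  proof (rule that[of a b])
    show "a i < b i" for i
      using a(2)[of i] b(1)[of i] by (metis of_rat_less order_less_trans)
    show "x \<in> rat_box a b" using a b by (auto simp: rat_box_def intro: less_imp_le)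
    show "rat_box a b \<subseteq> U"
    proof
      fix y assume y: "y \<in> rat_box a b"
      have "dist y x \<le> (\<Sum>i\<in>UNIV. \<bar>(y - x) $ i\<bar>)" unfolding dist_norm by (rule norm_le_l1_cart)
      also have "\<dots> \<le> (\<Sum>i\<in>(UNIV :: 'n set). d)"
      proof (rule sum_mono)
        fix i
        have "of_rat (a i) < y $ i" "y $ i \<le> of_rat (b i)" using y by (auto simp: rat_box_def)
        then show "\<bar>(y - x) $ i\<bar> \<le> d" using a(1)[of i] b(2)[of i] by (simp add: abs_le_iff) 
      qed
      also have "\<dots> = e / 2" by (simp add: d_def)
      also have "\<dots> < e" using e by simp
      finally show "y \<in> U" by (rule e)
    qed
  qed
qed

context carleman_form
begin

definition sides :: "('n \<Rightarrow> rat) \<Rightarrow> ('n \<Rightarrow> rat) \<Rightarrow> 'n \<Rightarrow> real set"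
  where "sides a b i = {of_rat (a i)<..of_rat (b i)}"

lemma sets_sides [simp]: "sides a b i \<in> sets borel"
  by (simp add: sides_def)

lemma restricted_sides_split:
  assumes "a j < m" "m < b j"
  shows "restricted (sides a b) p = restricted (sides a (b(j := m))) p + restricted (sides (a(j := m)) b) p"
proof -
  have m: "real_of_rat (a j) < of_rat m" "real_of_rat m < of_rat (b j)" using assms by (simp_all add: of_rat_less)
  have "restricted (sides a b) p = restricted ((sides a b)(j := {of_rat (a j)<..of_rat m})) p + restricted ((sides a b)(j := {of_rat m<..of_rat (b j)})) p"
    by (rule restricted_Un) (use m in \<open>auto simp: sides_def\<close>)
  moreover have "(sides a b)(j := {of_rat (a j)<..of_rat m}) = sides a (b(j := m))"
    "(sides a b)(j := {of_rat m<..of_rat (b j)}) = sides (a(j := m)) b"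
    by (auto simp: sides_def fun_eq_iff)
  ultimately show ?thesis by simp
qed

lemma restricted_sides_weights:
  "nonneg_weight (restricted (sides a b)) (var i - cst (of_rat (a i)))"
  "nonneg_weight (restricted (sides a b)) (cst (of_rat (b i)) - var i)"
  unfolding restricted_def
  by (rule cutoffs_lower[OF _ _ tame_L] cutoffs_upper[OF _ _ tame_L]; (simp add: coords)?; auto simp: sides_def)+

end

locale box_measure = carleman_form L + finite_measure \<mu>
  for L :: "'n::finite rpoly \<Rightarrow> real" and \<mu> :: "(real ^ 'n) measure" +
  assumes sets_\<mu> [measurable_cong]: "sets \<mu> = sets borel"
    and box: "\<And>a b. (\<And>i. a i < b i) \<Longrightarrow> measure \<mu> (rat_box a b) = restricted (sides a b) 1"
begin

lemma space_\<mu> [simp]: "space \<mu> = UNIV"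
  using sets_\<mu> by (metis sets_eq_imp_space_eq space_borel)

lemma integrable_box: "integrable \<mu> (\<lambda>x. indicator (rat_box a b) x * eval_poly p x)"
proof -
  define R where "R = (\<Sum>i\<in>UNIV. \<bar>real_of_rat (a i)\<bar> + \<bar>real_of_rat (b i)\<bar>)"
  obtain K where K: "K > 0" "\<And>x. (\<forall>i. \<bar>x $ i\<bar> \<le> R) \<Longrightarrow> \<bar>eval_poly p x\<bar> \<le> K"
    using eval_poly_bounded[of R p] by blast
  have R: "\<bar>x $ i\<bar> \<le> R" if "x \<in> rat_box a b" for x i
  proof -
    have "\<bar>real_of_rat (a i)\<bar> + \<bar>real_of_rat (b i)\<bar> \<le> R"
      unfolding R_def by (rule member_le_sum) auto
    moreover have "of_rat (a i) < x $ i" "x $ i \<le> of_rat (b i)" using that by (auto simp: rat_box_def)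
    ultimately show ?thesis by linarith
  qed
  show ?thesis
  proof (rule integrable_const_bound[where B = K])
    show "AE x in \<mu>. norm (indicator (rat_box a b) x * eval_poly p x) \<le> K"
      using K R by (intro AE_I2) (auto simp: indicator_def)
  qed measurable
qed

text \<open>The competitor of \<open>restricted (sides a b)\<close>: it satisfies the same
  localising inequalities and has the same value at \<open>1\<close>.\<close>

definition box_form :: "('n \<Rightarrow> rat) \<Rightarrow> ('n \<Rightarrow> rat) \<Rightarrow> 'n rpoly \<Rightarrow> real"
  where "box_form a b p = (\<integral>x. indicator (rat_box a b) x * eval_poly p x \<partial>\<mu>)"

lemma psd_box_form: "psd_form (box_form a b)"
  unfolding psd_form_def linear_form_def
proof (intro conjI allI)
  show "box_form a b (p + q) = box_form a b p + box_form a b q" for p q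
    unfolding box_form_def by (simp add: distrib_left integrable_box)
  show "box_form a b (cst c * p) = c * box_form a b p" for c p
    unfolding box_form_def by (simp add: mult.left_commute)
  show "0 \<le> box_form a b (h\<^sup>2)" for h
    unfolding box_form_def by (intro Bochner_Integration.integral_nonneg) auto
qed

lemma box_form_one: "box_form a b 1 = measure \<mu> (rat_box a b)"
  by (simp add: box_form_def)

lemma box_form_weights:
  "nonneg_weight (box_form a b) (var i - cst (of_rat (a i)))"
  "nonneg_weight (box_form a b) (cst (of_rat (b i)) - var i)"
  unfolding nonneg_weight_def box_form_def
  by (auto intro!: Bochner_Integration.integral_nonneg simp: indicator_def rat_box_def less_imp_le)

lemma box_form_split:
  assumes "a j < m" "m < b j"
  shows "box_form a b p = box_form a (b(j := m)) p + box_form (a(j := m)) b p"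
proof -
  have "indicator (rat_box a b) x * eval_poly p x = indicator (rat_box a (b(j := m))) x * eval_poly p x + indicator (rat_box (a(j := m)) b) x * eval_poly p x" for x
    using rat_box_split[where a = a and b = b and j = j and m = m, OF assms] by (auto simp: indicator_def)
  then show ?thesis
    unfolding box_form_def by (simp add: integrable_box)
qed

text \<open>Only masses of boxes are prescribed for \<open>\<mu>\<close>. On small boxes both forms
  are within \<open>e / 2\<close> times the mass of the same corner value times the mass; by
  additivity the total error is at most \<open>e\<close> times the mass of the box, for every
  \<open>e > 0\<close>.\<close>

lemma restricted_eq_box_form:
  assumes ab: "\<And>i. a i < b i"
  shows "restricted (sides a b) p = box_form a b p"
proof -
  define w where "w a b = measure \<mu> (rat_box a b)" for a b :: "'n \<Rightarrow> rat"
  define D where "D a b = restricted (sides a b) p - box_form a b p" for a b :: "'n \<Rightarrow> rat"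
  define R where "R = (\<Sum>i\<in>UNIV. \<bar>a i\<bar> + \<bar>b i\<bar>)"
  have R: "- R \<le> a i" "b i \<le> R" for i
  proof -
    have "\<bar>a i\<bar> + \<bar>b i\<bar> \<le> R" unfolding R_def by (rule member_le_sum) auto
    then show "- R \<le> a i" "b i \<le> R" by linarith+
  qed
  have mid: "a j < (a j + b j) / 2" "(a j + b j) / 2 < b j" if "a j < b j" for a b :: "'n \<Rightarrow> rat" and j
    using that by (simp_all add: field_simps)
  have arith: "\<bar>u - v\<bar> \<le> e * z" if "\<bar>u - t\<bar> \<le> e / 2 * z" "\<bar>v - t\<bar> \<le> e / 2 * z" for u v t e z :: real
  proof -
    have "e * z = e / 2 * z + e / 2 * z" by simp
    then show ?thesis using that by linarith
  qed
  have small: "\<bar>D a b\<bar> \<le> e * w a b" if e: "e > 0" for e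
  proof -
    obtain \<delta> where \<delta>: "\<delta> > 0" "\<And>\<Gamma> a b. psd_form \<Gamma> \<Longrightarrow> (\<And>i. \<bar>b $ i\<bar> \<le> of_rat R) \<Longrightarrow> (\<And>i. b $ i - a $ i \<le> \<delta>) \<Longrightarrow>
      (\<And>i. nonneg_weight \<Gamma> (var i - cst (a $ i))) \<Longrightarrow> (\<And>i. nonneg_weight \<Gamma> (cst (b $ i) - var i)) \<Longrightarrow>
      \<bar>\<Gamma> p - eval_poly p b * \<Gamma> 1\<bar> \<le> e / 2 * \<Gamma> 1"
      using form_near_eval[of "e / 2" "of_rat R" p] e by (metis half_gt_zero)
    obtain d where d: "0 < real_of_rat d" "real_of_rat d < \<delta>" using of_rat_dense[OF \<delta>(1)] by auto
    show ?thesis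
    proof (rule box_halving[of D w R d e a b])
      show "d > 0" using d by simp
      fix a b :: "'n \<Rightarrow> rat" assume ab: "\<And>i. a i < b i"
      show "D a b = D a (b(j := (a j + b j) / 2)) + D (a(j := (a j + b j) / 2)) b" for j
        unfolding D_def restricted_sides_split[where a = a and b = b and j = j, OF mid[where a = a and b = b and j = j, OF ab[of j]]] box_form_split[where a = a and b = b and j = j, OF mid[where a = a and b = b and j = j, OF ab[of j]]] by simp
      show "w a b = w a (b(j := (a j + b j) / 2)) + w (a(j := (a j + b j) / 2)) b" for j
        unfolding w_def box_form_one[symmetric] box_form_split[where a = a and b = b and j = j, OF mid[where a = a and b = b and j = j, OF ab[of j]]] by simp
      assume Rab: "\<And>i. - R \<le> a i" "\<And>i. b i \<le> R" and dab: "\<And>i. b i - a i \<le> d"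
      define a' b' :: "real ^ 'n" where "a' = (\<chi> i. of_rat (a i))" and "b' = (\<chi> i. of_rat (b i))"
      have bR: "\<bar>b' $ i\<bar> \<le> of_rat R" for i
      proof -
        have "\<bar>b i\<bar> \<le> R" using Rab(1)[of i] Rab(2)[of i] ab[of i] by linarith
        then have "real_of_rat \<bar>b i\<bar> \<le> of_rat R" by (simp only: of_rat_less_eq)
        then show ?thesis by (simp add: b'_def)
      qed
      have ba: "b' $ i - a' $ i \<le> \<delta>" for i
      proof -
        have "real_of_rat (b i - a i) \<le> of_rat d" using dab[of i] by (simp only: of_rat_less_eq)
        then show ?thesis using d by (simp add: a'_def b'_def of_rat_diff)
      qed
      have "\<bar>restricted (sides a b) p - eval_poly p b' * restricted (sides a b) 1\<bar> \<le> e / 2 * restricted (sides a b) 1"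
        using restricted_sides_weights[of a b] ba bR
        by (intro \<delta>(2)[of _ b' a'] tame_psd tame_restricted) (simp_all add: a'_def b'_def)
      moreover have "\<bar>box_form a b p - eval_poly p b' * box_form a b 1\<bar> \<le> e / 2 * box_form a b 1"
        using box_form_weights[of a b] ba bR
        by (intro \<delta>(2)[of _ b' a'] psd_box_form) (simp_all add: a'_def b'_def)
      ultimately show "\<bar>D a b\<bar> \<le> e * w a b"
        unfolding D_def w_def box_form_one box[OF ab] by (rule arith)
    qed (use ab R in auto)
  qed
  have "D a b = 0"
  proof (rule ccontr)
    assume "D a b \<noteq> 0"
    then have D: "\<bar>D a b\<bar> > 0" by simp
    have w: "w a b \<ge> 0" by (simp add: w_def)
    \<comment> \<open>This makes \<open>e * w a b\<close> at most half of
      \<open>\<bar>D a b\<bar>\<close>; the added \<open>1\<close> keeps the quotient meaningful for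
      a box of mass zero.\<close>
    define e where "e = \<bar>D a b\<bar> / (2 * (w a b + 1))"
    have e: "e > 0" using D w by (simp add: e_def)
    have "e * w a b \<le> e * (w a b + 1)" using e by simp
    also have "\<dots> = \<bar>D a b\<bar> / 2" using w by (simp add: e_def field_simps)
    finally show False using small[OF e] D by simp
  qed
  then show ?thesis by (simp add: D_def)
qed

text \<open>Squares have nonnegative integrands, so monotone convergence along growing cubes gives
  integrability together with the value; the limit is squeezed by \<open>cutoffs_exhaust\<close> and
  domination on squares.\<close>

lemma integral_square:
  "integrable \<mu> (\<lambda>x. (eval_poly h x)\<^sup>2)" "(\<integral>x. (eval_poly h x)\<^sup>2 \<partial>\<mu>) = L (h\<^sup>2)"
proof -
  \<comment> \<open>The successor keeps the cube nondegenerate for \<open>n = 0\<close>.\<close>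
  define a b :: "nat \<Rightarrow> 'n \<Rightarrow> rat" where "a n = (\<lambda>_. - of_nat (Suc n))" and "b n = (\<lambda>_. of_nat (Suc n))" for n
  have sides_ab: "sides (a n) (b n) = (\<lambda>_. {- real (Suc n)<..real (Suc n)})" for n
    by (simp add: sides_def a_def b_def of_rat_minus of_rat_add of_rat_diff fun_eq_iff)
  have box_ab: "x \<in> rat_box (a n) (b n) \<longleftrightarrow> (\<forall>i. - real (Suc n) < x $ i \<and> x $ i \<le> real (Suc n))" for x n
    by (simp add: rat_box_def a_def b_def of_rat_minus of_rat_add of_rat_diff)
  have eq: "restricted (sides (a n) (b n)) p = box_form (a n) (b n) p" for n p
    by (rule restricted_eq_box_form) (simp add: a_def b_def)
  define C where "C = (\<Sum>i\<leftarrow>coords. L ((var i)\<^sup>2 * h\<^sup>2))"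
  have lower: "L (h\<^sup>2) - C / (real (Suc n))\<^sup>2 \<le> box_form (a n) (b n) (h\<^sup>2)" for n
    using cutoffs_exhaust[OF _ tame_L, of "real (Suc n)" h coords]
    unfolding eq[symmetric] sides_ab restricted_def C_def by simp
  have upper: "box_form (a n) (b n) (h\<^sup>2) \<le> L (h\<^sup>2)" for n
    unfolding eq[symmetric] restricted_def by (rule cutoffs_square_le[OF _ tame_L]) simp
  have lim: "(\<lambda>n. box_form (a n) (b n) (h\<^sup>2)) \<longlonglongrightarrow> L (h\<^sup>2)"
  proof (rule tendsto_sandwich)
    show "\<forall>\<^sub>F n in sequentially. L (h\<^sup>2) - C / (real (Suc n))\<^sup>2 \<le> box_form (a n) (b n) (h\<^sup>2)" using lower by simp
    show "\<forall>\<^sub>F n in sequentially. box_form (a n) (b n) (h\<^sup>2) \<le> L (h\<^sup>2)" using upper by simp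
    show "(\<lambda>n. L (h\<^sup>2) - C / (real (Suc n))\<^sup>2) \<longlonglongrightarrow> L (h\<^sup>2)" by real_asymp
  qed simp
  have mono: "AE x in \<mu>. incseq (\<lambda>n. indicator (rat_box (a n) (b n)) x * eval_poly (h\<^sup>2) x)"
  proof (intro AE_I2 incseq_SucI)
    fix x n
    have "rat_box (a n) (b n) \<subseteq> rat_box (a (Suc n)) (b (Suc n))"
    proof
      fix y assume "y \<in> rat_box (a n) (b n)"
      then have "- real (Suc n) < y $ i \<and> y $ i \<le> real (Suc n)" for i unfolding box_ab by blast
      then have "- real (Suc (Suc n)) < y $ i \<and> y $ i \<le> real (Suc (Suc n))" for i
        using of_nat_Suc[of "Suc n"] by (metis (no_types) less_add_one less_trans less_imp_le minus_less_iff neg_less_iff_less order_trans add.commute)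
      then show "y \<in> rat_box (a (Suc n)) (b (Suc n))" unfolding box_ab by blast
    qed
    then show "indicator (rat_box (a n) (b n)) x * eval_poly (h\<^sup>2) x \<le> indicator (rat_box (a (Suc n)) (b (Suc n))) x * eval_poly (h\<^sup>2) x"
      by (intro mult_right_mono) (auto simp: indicator_def)
  qed
  have conv: "AE x in \<mu>. (\<lambda>n. indicator (rat_box (a n) (b n)) x * eval_poly (h\<^sup>2) x) \<longlonglongrightarrow> (eval_poly h x)\<^sup>2"
  proof (intro AE_I2 tendsto_eventually)
    fix x :: "real ^ 'n"
    obtain N where N: "(\<Sum>i\<in>UNIV. \<bar>x $ i\<bar>) < real N" using reals_Archimedean2 by blast
    have "x \<in> rat_box (a n) (b n)" if "n \<ge> N" for n
      unfolding box_ab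
    proof
      fix i
      have "\<bar>x $ i\<bar> \<le> (\<Sum>i\<in>UNIV. \<bar>x $ i\<bar>)" by (rule member_le_sum) auto
      then show "- real (Suc n) < x $ i \<and> x $ i \<le> real (Suc n)" using N that by auto
    qed
    then show "\<forall>\<^sub>F n in sequentially. indicator (rat_box (a n) (b n)) x * eval_poly (h\<^sup>2) x = (eval_poly h x)\<^sup>2"
      by (auto simp: eventually_sequentially intro!: exI[of _ N])
  qed
  have "has_bochner_integral \<mu> (\<lambda>x. (eval_poly h x)\<^sup>2) (L (h\<^sup>2))"
    by (rule has_bochner_integral_monotone_convergence[OF integrable_box mono conv lim[unfolded box_form_def]]) measurable
  then show "integrable \<mu> (\<lambda>x. (eval_poly h x)\<^sup>2)" "(\<integral>x. (eval_poly h x)\<^sup>2 \<partial>\<mu>) = L (h\<^sup>2)"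
    by (auto simp: has_bochner_integral_iff)
qed

lemma integral_eval_poly:
  "integrable \<mu> (eval_poly p)" "(\<integral>x. eval_poly p x \<partial>\<mu>) = L p"
proof -
  have *: "eval_poly p = (\<lambda>x. ((eval_poly (p + 1) x)\<^sup>2 - (eval_poly (p - 1) x)\<^sup>2) / 4)"
    by (auto simp: power2_eq_square algebra_simps)
  show "integrable \<mu> (eval_poly p)"
    unfolding * by (intro integrable_divide Bochner_Integration.integrable_diff integral_square)
  have "(\<integral>x. eval_poly p x \<partial>\<mu>) = (L ((p + 1)\<^sup>2) - L ((p - 1)\<^sup>2)) / 4"
    by (subst *) (simp only: integral_divide_zero Bochner_Integration.integral_diff integral_square)
  then show "(\<integral>x. eval_poly p x \<partial>\<mu>) = L p"
    using linear_form_polarize[OF psd_form_linear[OF psd], of 1 p] by simp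
qed

text \<open>The localising inequality at \<open>h = 1\<close> survives restriction to the box and
  becomes a nonnegative integral of a function that is negative there.\<close>

lemma box_null:
  assumes w: "nonneg_weight L P" and ab: "\<And>i. a i < b i" and neg: "\<And>x. x \<in> rat_box a b \<Longrightarrow> eval_poly P x < 0"
  shows "rat_box a b \<in> null_sets \<mu>"
proof -
  have "nonneg_weight (restricted (sides a b)) P"
    unfolding restricted_def by (intro cutoffs_weight_nonneg tame_L w) simp
  then have "restricted (sides a b) (P * 1\<^sup>2) \<ge> 0" unfolding nonneg_weight_def by blast
  then have pos: "(\<integral>x. indicator (rat_box a b) x * eval_poly P x \<partial>\<mu>) \<ge> 0"
    by (simp add: restricted_eq_box_form[OF ab] box_form_def)
  have "(\<integral>x. - (indicator (rat_box a b) x * eval_poly P x) \<partial>\<mu>) = 0"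
  proof (rule antisym)
    show "(\<integral>x. - (indicator (rat_box a b) x * eval_poly P x) \<partial>\<mu>) \<le> 0" using pos by simp
    show "0 \<le> (\<integral>x. - (indicator (rat_box a b) x * eval_poly P x) \<partial>\<mu>)"
      using neg by (intro Bochner_Integration.integral_nonneg) (auto simp: indicator_def less_imp_le)
  qed
  then have "AE x in \<mu>. - (indicator (rat_box a b) x * eval_poly P x) = 0"
    using neg integrable_box[of a b P]
    by (subst (asm) integral_nonneg_eq_0_iff_AE) (auto simp: indicator_def less_imp_le)
  then have "AE x in \<mu>. x \<notin> rat_box a b"
  proof eventually_elim
    case (elim x)
    then show ?case using neg[of x] by auto
  qed
  then show ?thesis
    by (subst (asm) AE_iff_null) (auto simp: sets_\<mu>)
qed

end

section \<open>Uniqueness and the main theorem\<close>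

definition represents :: "(real ^ 'n::finite) measure \<Rightarrow> ('n rpoly \<Rightarrow> real) \<Rightarrow> bool"
  where "represents \<nu> \<Lambda> \<longleftrightarrow> sets \<nu> = sets borel \<and> finite_measure \<nu> \<and>
    (\<forall>p. integrable \<nu> (eval_poly p) \<and> (\<integral>x. eval_poly p x \<partial>\<nu>) = \<Lambda> p)"

context carleman_form
begin

text \<open>The image of \<open>\<nu>\<close> with density \<open>h\<^sup>2\<close> under coordinate
  \<open>i\<close> is a tame measure with the moments of the slice, so it computes the cutoff at
  \<open>h\<^sup>2\<close>; polarisation extends this to all polynomials.\<close>

lemma cutoff_represented:
  assumes t: "tame \<Lambda>" and r: "represents \<nu> \<Lambda>" and B: "B \<in> sets borel"
  shows "represents (density \<nu> (indicator {x. x $ i \<in> B})) (cutoff i B \<Lambda>)"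
proof -
  have sets_\<nu> [measurable_cong]: "sets \<nu> = sets borel" using r by (simp add: represents_def)
  interpret \<nu>: finite_measure \<nu> using r by (simp add: represents_def)
  have int: "integrable \<nu> (eval_poly p)" "(\<integral>x. eval_poly p x \<partial>\<nu>) = \<Lambda> p" for p
    using r by (auto simp: represents_def)
  have proj [measurable]: "(\<lambda>x :: real ^ 'n. x $ i) \<in> borel_measurable borel" by measurable
  have A [measurable]: "{x :: real ^ 'n. x $ i \<in> B} \<in> sets borel"
    using measurable_sets[OF proj B] by (simp add: vimage_def)
  have space_\<nu>: "space \<nu> = UNIV" using sets_\<nu> by (metis sets_eq_imp_space_eq space_borel)
  have intA: "integrable \<nu> (\<lambda>x. indicator {x. x $ i \<in> B} x * eval_poly p x)" for p
    using integrable_mult_indicator[of "{x. x $ i \<in> B}" \<nu> "eval_poly p"] int A sets_\<nu> by simp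
  have sq: "cutoff i B \<Lambda> (h\<^sup>2) = (\<integral>x. indicator {x. x $ i \<in> B} x * eval_poly (h\<^sup>2) x \<partial>\<nu>)" for h
  proof -
    define \<kappa> where "\<kappa> = distr (density \<nu> (\<lambda>x. ennreal ((eval_poly h x)\<^sup>2))) borel (\<lambda>x. x $ i)"
    have int\<kappa>: "integrable \<kappa> f \<longleftrightarrow> integrable \<nu> (\<lambda>x. (eval_poly h x)\<^sup>2 * f (x $ i))"
      "(\<integral>x. f x \<partial>\<kappa>) = (\<integral>x. (eval_poly h x)\<^sup>2 * f (x $ i) \<partial>\<nu>)" if [measurable]: "f \<in> borel_measurable borel" for f :: "real \<Rightarrow> real"
      unfolding \<kappa>_def by (simp_all add: integrable_distr_eq integral_distr integrable_density integral_density)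
    have ev: "(eval_poly h x)\<^sup>2 * (x $ i) ^ k = eval_poly (var i ^ k * h\<^sup>2) x" for x k
      by (simp add: mult.commute)
    have pw: "integrable \<kappa> (\<lambda>x. x ^ k)" "(\<integral>x. x ^ k \<partial>\<kappa>) = \<Lambda> (var i ^ k * h\<^sup>2)" for k
    proof -
      have meas: "(\<lambda>x :: real. x ^ k) \<in> borel_measurable borel" by measurable
      show "integrable \<kappa> (\<lambda>x. x ^ k)" "(\<integral>x. x ^ k \<partial>\<kappa>) = \<Lambda> (var i ^ k * h\<^sup>2)"
        unfolding int\<kappa>[OF meas] ev by (rule int)+
    qed
    have sets\<kappa>: "sets \<kappa> = sets borel" by (simp add: \<kappa>_def)
    have "emeasure \<kappa> (space \<kappa>) = (\<integral>\<^sup>+x. 1 \<partial>\<kappa>)" by simp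
    also have "\<dots> < \<infinity>" using pw(1)[of 0] by (simp add: integrable_iff_bounded)
    finally have "finite_measure \<kappa>" by (intro finite_measureI) auto
    with pw sets\<kappa> have "moment_measure \<kappa>" by (simp add: moment_measure_def moment_measure_axioms_def)
    then have "tame_measure i \<kappa>"
      using t unfolding tame_measure_def tame_def by (simp add: pw)
    from cutoff_eq_measure[OF t this B] have "cutoff i B \<Lambda> (h\<^sup>2) = measure \<kappa> B" by (simp add: pw)
    also have "\<dots> = (\<integral>x. indicator B x \<partial>\<kappa>)" using sets_eq_imp_space_eq[OF sets\<kappa>] by simp
    also have "\<dots> = (\<integral>x. indicator {x. x $ i \<in> B} x * eval_poly (h\<^sup>2) x \<partial>\<nu>)"
      using B by (subst int\<kappa>) (auto intro!: Bochner_Integration.integral_cong simp: indicator_def)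
    finally show ?thesis .
  qed
  have eq: "cutoff i B \<Lambda> p = (\<integral>x. indicator {x. x $ i \<in> B} x * eval_poly p x \<partial>\<nu>)" for p
  proof -
    have "indicator {x. x $ i \<in> B} x * eval_poly p x = (indicator {x. x $ i \<in> B} x * eval_poly ((p + 1)\<^sup>2) x - indicator {x. x $ i \<in> B} x * eval_poly ((p - 1)\<^sup>2) x) / 4" for x
      unfolding eval_poly_power eval_poly_add eval_poly_diff eval_poly_1 by (simp add: power2_eq_square algebra_simps)
    then have "(\<integral>x. indicator {x. x $ i \<in> B} x * eval_poly p x \<partial>\<nu>) = (\<integral>x. (indicator {x. x $ i \<in> B} x * eval_poly ((p + 1)\<^sup>2) x - indicator {x. x $ i \<in> B} x * eval_poly ((p - 1)\<^sup>2) x) / 4 \<partial>\<nu>)"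
      by presburger
    also have "\<dots> = (cutoff i B \<Lambda> ((p + 1)\<^sup>2) - cutoff i B \<Lambda> ((p - 1)\<^sup>2)) / 4"
      by (simp only: integral_divide_zero Bochner_Integration.integral_diff intA sq)
    also have "\<dots> = cutoff i B \<Lambda> p"
      using linear_form_polarize[OF linear_form_cutoff[OF t B], of i 1 p] by simp
    finally show ?thesis by simp
  qed
  have dens: "density \<nu> (indicator {x. x $ i \<in> B}) = density \<nu> (\<lambda>x. ennreal (indicator {x. x $ i \<in> B} x))"
    by (intro arg_cong[where f = "density \<nu>"]) (auto simp: indicator_def)
  show ?thesis
    unfolding represents_def
  proof (intro conjI allI)
    show "sets (density \<nu> (indicator {x. x $ i \<in> B})) = sets borel" by (simp add: sets_\<nu>)
    show "integrable (density \<nu> (indicator {x. x $ i \<in> B})) (eval_poly p)" for p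
      unfolding dens using intA[of p] by (subst integrable_density) auto
    show "(\<integral>x. eval_poly p x \<partial>density \<nu> (indicator {x. x $ i \<in> B})) = cutoff i B \<Lambda> p" for p
      unfolding dens eq by (subst integral_density) auto
    show "finite_measure (density \<nu> (indicator {x. x $ i \<in> B}))"
    proof (rule finite_measureI)
      have "emeasure (density \<nu> (indicator {x. x $ i \<in> B})) UNIV = emeasure \<nu> {x. x $ i \<in> B}"
        using A by (subst emeasure_density) (auto simp: sets_\<nu>)
      then show "emeasure (density \<nu> (indicator {x. x $ i \<in> B})) (space (density \<nu> (indicator {x. x $ i \<in> B}))) \<noteq> \<infinity>"
        by (simp add: space_\<nu> \<nu>.emeasure_eq_measure)
    qed
  qed
qed

text \<open>All Borel sets \<open>A\<close> are tracked, and not just the total mass, because the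
  induction restricts the measure once more in each coordinate.\<close>

lemma cutoffs_represented:
  assumes B: "\<And>i. B i \<in> sets borel"
  shows "tame \<Lambda> \<Longrightarrow> represents \<nu> \<Lambda> \<Longrightarrow> \<exists>\<nu>'. represents \<nu>' (cutoffs is B \<Lambda>) \<and>
    (\<forall>A\<in>sets borel. emeasure \<nu>' A = emeasure \<nu> (A \<inter> {x. \<forall>i\<in>set is. x $ i \<in> B i}))"
proof (induction "is" arbitrary: \<Lambda> \<nu>)
  case Nil
  then show ?case by (auto intro!: exI[of _ \<nu>])
next
  case (Cons i "is")
  let ?\<nu> = "density \<nu> (indicator {x. x $ i \<in> B i})"
  have sets_\<nu>: "sets \<nu> = sets borel" using Cons.prems by (simp add: represents_def)
  have proj: "(\<lambda>x :: real ^ 'n. x $ i) \<in> borel_measurable borel" for i by measurable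
  have S [measurable]: "{x :: real ^ 'n. x $ i \<in> B i} \<in> sets borel" for i
    using measurable_sets[OF proj B] by (simp add: vimage_def)
  have S' [measurable]: "{x :: real ^ 'n. \<forall>i\<in>set is. x $ i \<in> B i} \<in> sets borel"
  proof -
    have "{x :: real ^ 'n. \<forall>i\<in>I. x $ i \<in> B i} \<in> sets borel" if "finite I" for I
      using that
    proof (induction I)
      case (insert j I)
      have "{x :: real ^ 'n. \<forall>i\<in>insert j I. x $ i \<in> B i} = {x. x $ j \<in> B j} \<inter> {x. \<forall>i\<in>I. x $ i \<in> B i}" by auto
      then show ?case using insert by simp
    qed simp
    then show ?thesis by simp
  qed
  obtain \<nu>' where \<nu>': "represents \<nu>' (cutoffs is B (cutoff i (B i) \<Lambda>))"
    "\<And>A. A \<in> sets borel \<Longrightarrow> emeasure \<nu>' A = emeasure ?\<nu> (A \<inter> {x. \<forall>i\<in>set is. x $ i \<in> B i})"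
    using Cons.IH[OF tame_cutoff[OF Cons.prems(1) B] cutoff_represented[OF Cons.prems B]] by blast
  have "emeasure ?\<nu> (A \<inter> {x. \<forall>i\<in>set is. x $ i \<in> B i}) = emeasure \<nu> (A \<inter> {x. \<forall>j\<in>set (i # is). x $ j \<in> B j})" if A: "A \<in> sets borel" for A
  proof -
    have "emeasure ?\<nu> (A \<inter> {x. \<forall>i\<in>set is. x $ i \<in> B i}) = emeasure \<nu> ({x. x $ i \<in> B i} \<inter> (A \<inter> {x. \<forall>i\<in>set is. x $ i \<in> B i}))"
      using A S[of i] S' sets_\<nu> by (intro emeasure_restricted) auto
    also have "{x. x $ i \<in> B i} \<inter> (A \<inter> {x. \<forall>i\<in>set is. x $ i \<in> B i}) = A \<inter> {x. \<forall>j\<in>set (i # is). x $ j \<in> B j}" by auto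
    finally show ?thesis .
  qed
  with \<nu>' show ?case by auto
qed

lemma represents_box:
  assumes r: "represents \<nu> L" and B: "\<And>i. B i \<in> sets borel"
  shows "emeasure \<nu> {x. \<forall>i. x $ i \<in> B i} = ennreal (restricted B 1)"
proof -
  obtain \<nu>' where \<nu>': "represents \<nu>' (cutoffs coords B L)"
    "\<And>A. A \<in> sets borel \<Longrightarrow> emeasure \<nu>' A = emeasure \<nu> (A \<inter> {x. \<forall>i\<in>set coords. x $ i \<in> B i})"
    using cutoffs_represented[of B L \<nu> coords, OF B tame_L r] by blast
  interpret \<nu>': finite_measure \<nu>' using \<nu>' by (simp add: represents_def)
  have sp: "space \<nu>' = UNIV" using \<nu>'(1) by (metis represents_def sets_eq_imp_space_eq space_borel)
  have "emeasure \<nu> {x. \<forall>i. x $ i \<in> B i} = emeasure \<nu>' UNIV" using \<nu>'(2)[of UNIV] by (simp add: coords)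
  also have "\<dots> = ennreal (measure \<nu>' UNIV)" by (rule \<nu>'.emeasure_eq_measure)
  also have "measure \<nu>' UNIV = (\<integral>x. eval_poly 1 x \<partial>\<nu>')" by (simp add: sp)
  also have "\<dots> = restricted B 1" using \<nu>'(1) unfolding represents_def restricted_def by blast
  finally show ?thesis .
qed

text \<open>Lower orthants are boxes with sides \<open>{..a $ i}\<close>, so every representing
  measure gives them the same mass; they generate the Borel sets and are closed under
  intersection.\<close>

lemma represents_unique:
  assumes r: "represents \<mu> L" "represents \<nu> L"
  shows "\<mu> = \<nu>"
proof (rule measure_eqI_generator_eq[where \<Omega> = UNIV and E = "range atMost" and A = "\<lambda>n. {..(\<chi> i. real n)}"])
  have sets: "sets \<mu> = sets borel" "sets \<nu> = sets borel" using r by (auto simp: represents_def)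
  have gen: "sets (borel :: (real ^ 'n) measure) = sigma_sets UNIV (range atMost)"
    by (subst borel_eq_atMost) simp
  show "sets \<mu> = sigma_sets UNIV (range atMost)" "sets \<nu> = sigma_sets UNIV (range atMost)"
    by (simp_all add: sets gen)
  show "Int_stable (range (atMost :: real ^ 'n \<Rightarrow> _))"
  proof -
    have "{..a} \<inter> {..b} = {..inf a b}" for a b :: "real ^ 'n" by auto
    then show ?thesis by (auto simp: Int_stable_def)
  qed
  show "emeasure \<mu> X = emeasure \<nu> X" if X: "X \<in> range atMost" for X
  proof -
    obtain a :: "real ^ 'n" where "X = {..a}" using X by auto
    then have "X = {x. \<forall>i. x $ i \<in> {..a $ i}}" by (auto simp: less_eq_vec_def)
    then show ?thesis using represents_box[OF r(1), of "\<lambda>i. {..a $ i}"] represents_box[OF r(2), of "\<lambda>i. {..a $ i}"] by simp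
  qed
  show "(\<Union>n. {..(\<chi> i. real n)}) = (UNIV :: (real ^ 'n) set)"
  proof (rule sym, rule UNIV_eq_I)
    fix x :: "real ^ 'n"
    obtain N where N: "(\<Sum>i\<in>UNIV. \<bar>x $ i\<bar>) < real N" using reals_Archimedean2 by blast
    have "x $ i \<le> real N" for i
    proof -
      have "\<bar>x $ i\<bar> \<le> (\<Sum>i\<in>UNIV. \<bar>x $ i\<bar>)" by (rule member_le_sum) auto
      then show ?thesis using N by linarith
    qed
    then show "x \<in> (\<Union>n. {..(\<chi> i. real n)})" by (auto simp: less_eq_vec_def)
  qed
  show "emeasure \<mu> {..(\<chi> i. real n)} \<noteq> \<infinity>" for n
    using r(1) finite_measure.emeasure_finite[of \<mu>] by (simp add: represents_def)
qed auto

lemma represents_exists: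
  obtains \<mu> where "represents \<mu> L"
    "\<forall>P a b. nonneg_weight L P \<longrightarrow> (\<forall>i. a i < b i) \<longrightarrow> (\<forall>x\<in>rat_box a b. eval_poly P x < 0) \<longrightarrow> rat_box a b \<in> null_sets \<mu>"
proof -
  obtain \<mu> :: "(real ^ 'n) measure" where \<mu>: "sets \<mu> = sets borel" "finite_measure \<mu>"
    "\<And>a b. (\<And>i. a i < b i) \<Longrightarrow>
      measure \<mu> {x. \<forall>i. of_rat (a i) < x $ i \<and> x $ i \<le> of_rat (b i)}
        = restricted (\<lambda>i. {of_rat (a i)<..of_rat (b i)}) 1"
    using box_measure_exists by blast
  have bm: "box_measure L \<mu>"
    unfolding box_measure_def box_measure_axioms_def
    using carleman_form_axioms \<mu> by (simp add: rat_box_def sides_def[abs_def])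
  have "represents \<mu> L"
    using \<mu>(1,2) box_measure.integral_eval_poly[OF bm] by (simp add: represents_def)
  then show ?thesis using that box_measure.box_null[OF bm] by blast
qed

end

theorem theorem4p1:
  fixes m :: "'n::finite multi_index \<Rightarrow> real"
    and Y :: "'i set"
    and P :: "'i \<Rightarrow> 'n rpoly"
  assumes "carleman m"
  shows "((\<exists>!\<mu>. \<mu> \<in> moment_measures (semialg Y P) \<and> realized_by m \<mu>) \<longleftrightarrow>
            (\<forall>h. riesz m (h\<^sup>2) \<ge> 0 \<and> (\<forall>i\<in>Y. riesz m (P i * h\<^sup>2) \<ge> 0)))
       \<and> ((\<exists>!\<mu>. \<mu> \<in> moment_measures (semialg Y P) \<and> realized_by m \<mu>) \<longleftrightarrow>
            (\<forall>q\<in>quadratic_module (P ` Y). riesz m q \<ge> 0))"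
proof -
  define pos where "pos \<longleftrightarrow> (\<forall>h. riesz m (h\<^sup>2) \<ge> 0 \<and> (\<forall>i\<in>Y. riesz m (P i * h\<^sup>2) \<ge> 0))"
  note lin = linear_form_riesz[of m]
  have rep: "represents \<mu> (riesz m)" if \<mu>: "\<mu> \<in> moment_measures S" "realized_by m \<mu>" for \<mu> and S :: "(real ^ 'n) set"
  proof -
    have int: "integrable \<mu> (monomial \<alpha>)" for \<alpha> using \<mu>(1) by (simp add: moment_measures_def)
    have "integrable \<mu> (eval_poly p)" "(\<integral>x. eval_poly p x \<partial>\<mu>) = riesz m p" for p
    proof -
      have *: "eval_poly p = (\<lambda>r. \<Sum>\<alpha>\<in>Poly_Mapping.keys p. Poly_Mapping.lookup p \<alpha> * monomial \<alpha> r)"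
        by (auto simp: eval_poly_def)
      show "integrable \<mu> (eval_poly p)"
        unfolding * by (intro Bochner_Integration.integrable_sum integrable_mult_right int)
      show "(\<integral>x. eval_poly p x \<partial>\<mu>) = riesz m p"
        unfolding * riesz_def using \<mu>(2)
        by (subst Bochner_Integration.integral_sum) (auto intro!: integrable_mult_right int simp: realized_by_def)
    qed
    then show ?thesis using \<mu>(1) by (simp add: represents_def moment_measures_def)
  qed
  have necessary: pos if \<mu>: "\<mu> \<in> moment_measures (semialg Y P)" "realized_by m \<mu>" for \<mu>
    unfolding pos_def
  proof (intro allI conjI ballI)
    have r: "(\<integral>x. eval_poly p x \<partial>\<mu>) = riesz m p" for p using rep[OF \<mu>] by (simp add: represents_def)
    fix h
    show "0 \<le> riesz m (h\<^sup>2)"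
      unfolding r[symmetric] by (intro Bochner_Integration.integral_nonneg) simp
    fix i assume i: "i \<in> Y"
    \<comment> \<open>Almost every point lies in the set, so the integrand is nonnegative almost
      everywhere; only the one index \<open>i\<close> is treated at a time.\<close>
    have "- semialg Y P \<in> null_sets \<mu>" using \<mu>(1) by (simp add: moment_measures_def)
    then have "AE x in \<mu>. x \<notin> - semialg Y P" by (rule AE_not_in)
    then have "AE x in \<mu>. 0 \<le> eval_poly (P i * h\<^sup>2) x"
      by eventually_elim (use i in \<open>auto simp: semialg_def\<close>)
    then show "0 \<le> riesz m (P i * h\<^sup>2)"
      unfolding r[symmetric] by (rule integral_nonneg_AE)
  qed
  have sufficient: "\<exists>!\<mu>. \<mu> \<in> moment_measures (semialg Y P) \<and> realized_by m \<mu>" if pos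
  proof -
    interpret carleman_form "riesz m"
    proof
      show "psd_form (riesz m)" using \<open>pos\<close> lin by (simp add: psd_form_def pos_def)
      show "quasi_analytic (ultra_class (\<lambda>n. sqrt \<bar>riesz m (var i ^ (2 * n))\<bar>))" for i
        using assms by (simp add: carleman_def var_power riesz_single)
    qed
    obtain \<mu> where \<mu>: "represents \<mu> (riesz m)"
      "\<forall>P a b. nonneg_weight (riesz m) P \<longrightarrow> (\<forall>i. a i < b i) \<longrightarrow> (\<forall>x\<in>rat_box a b. eval_poly P x < 0) \<longrightarrow> rat_box a b \<in> null_sets \<mu>"
      by (rule represents_exists)
    have mon: "monomial \<alpha> = eval_poly (Poly_Mapping.single \<alpha> 1)" for \<alpha> :: "'n multi_index"
      by (auto simp: eval_poly_single)
    have mon_int: "integrable \<mu> (monomial \<alpha>)" "(\<integral>x. monomial \<alpha> x \<partial>\<mu>) = m \<alpha>" for \<alpha>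
      using \<mu>(1) riesz_single[of m \<alpha> 1] unfolding mon represents_def by auto
    have null: "- semialg Y P \<in> null_sets \<mu>"
    proof -
      \<comment> \<open>The index \<open>j\<close> is hidden behind an existential, so that the
        union runs over pairs of rational corners and is countable even when \<open>Y\<close> is
        not.\<close>
      define K where "K = {(a, b) | a b. (\<forall>i. a i < b i) \<and> (\<exists>j\<in>Y. \<forall>x\<in>rat_box a b. eval_poly (P j) x < 0)}"
      have "- semialg Y P = (\<Union>(a, b)\<in>K. rat_box a b)"
      proof (intro set_eqI iffI)
        fix x assume "x \<in> - semialg Y P"
        then obtain j where j: "j \<in> Y" "eval_poly (P j) x < 0" by (auto simp: semialg_def not_le)
        have "open {x. eval_poly (P j) x < 0}"
          by (intro open_Collect_less continuous_on_eval_poly continuous_on_const)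
        then obtain a b where "\<And>i. a i < b i" "x \<in> rat_box a b" "rat_box a b \<subseteq> {x. eval_poly (P j) x < 0}"
          using rat_box_near j(2) by blast
        then show "x \<in> (\<Union>(a, b)\<in>K. rat_box a b)" using j(1) unfolding K_def by blast
      next
        fix x assume "x \<in> (\<Union>(a, b)\<in>K. rat_box a b)"
        then show "x \<in> - semialg Y P" by (force simp: K_def semialg_def not_le)
      qed
      also have "\<dots> \<in> null_sets \<mu>"
      proof (rule null_sets_UN')
        fix ab assume "ab \<in> K"
        then obtain a b j where ab: "ab = (a, b)" "\<And>i. a i < b i" "j \<in> Y" "\<And>x. x \<in> rat_box a b \<Longrightarrow> eval_poly (P j) x < 0"
          unfolding K_def by blast
        have "nonneg_weight (riesz m) (P j)" using \<open>pos\<close> ab(3) by (simp add: pos_def nonneg_weight_def)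
        with \<mu>(2) ab(2,4) have "rat_box a b \<in> null_sets \<mu>" by blast
        then show "(case ab of (a, b) \<Rightarrow> rat_box a b) \<in> null_sets \<mu>" by (simp add: ab(1))
      qed simp
      finally show ?thesis .
    qed
    show ?thesis
    proof (rule ex1I[of _ \<mu>])
      show "\<mu> \<in> moment_measures (semialg Y P) \<and> realized_by m \<mu>"
        using \<mu>(1) mon_int null by (simp add: moment_measures_def realized_by_def represents_def)
      show "\<nu> = \<mu>" if "\<nu> \<in> moment_measures (semialg Y P) \<and> realized_by m \<nu>" for \<nu>
        using represents_unique[OF rep \<mu>(1)] that by blast
    qed
  qed
  have module: "pos \<longleftrightarrow> (\<forall>q\<in>quadratic_module (P ` Y). riesz m q \<ge> 0)"
  proof
    assume pos: pos
    show "\<forall>q\<in>quadratic_module (P ` Y). riesz m q \<ge> 0"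
    proof
      fix q assume "q \<in> quadratic_module (P ` Y)"
      then obtain F Q where q: "q = (\<Sum>p\<in>F. Q p * p)" "F \<subseteq> insert 1 (P ` Y)" "\<forall>p\<in>F. Q p \<in> sums_of_squares"
        by (auto simp: quadratic_module_def)
      have "riesz m (Q p * p) \<ge> 0" if "p \<in> F" for p
      proof -
        have "Q p \<in> sums_of_squares" using q(3) that by blast
        then obtain h :: "nat \<Rightarrow> 'n rpoly" and k where "Q p = (\<Sum>j<k. (h j)\<^sup>2)"
          unfolding sums_of_squares_def by blast
        then have "riesz m (Q p * p) = (\<Sum>j<k. riesz m (p * (h j)\<^sup>2))"
          by (simp only: sum_distrib_left linear_form_sum[OF lin] mult.commute[of _ p])
        also have "\<dots> \<ge> 0"
          using pos q(2) that by (intro sum_nonneg) (auto simp: pos_def)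
        finally show ?thesis .
      qed
      then show "riesz m q \<ge> 0" by (simp add: q(1) linear_form_sum[OF lin] sum_nonneg)
    qed
  next
    assume Q: "\<forall>q\<in>quadratic_module (P ` Y). riesz m q \<ge> 0"
    have sq: "h\<^sup>2 \<in> sums_of_squares" for h :: "'n rpoly"
      unfolding sums_of_squares_def by (intro CollectI exI[of _ "\<lambda>_. h"] exI[of _ 1]) simp
    \<comment> \<open>Sums with a single term suffice; the generator \<open>1\<close> gives the
      condition on plain squares.\<close>
    have "h\<^sup>2 * p \<in> quadratic_module (P ` Y)" if "p \<in> insert 1 (P ` Y)" for h p
      unfolding quadratic_module_def
      by (intro CollectI exI[of _ "{p}"] exI[of _ "\<lambda>_. h\<^sup>2"]) (use that sq in auto)
    then have "riesz m (h\<^sup>2 * p) \<ge> 0" if "p \<in> insert 1 (P ` Y)" for h p using Q that by blast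
    from this[of 1] this[of "P _"] show pos by (auto simp: pos_def mult.commute)
  qed
  show ?thesis
    using necessary sufficient module unfolding pos_def by blast
qed

end
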